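(* Let $\Gamma$ be a countably infinite group, acting on $\{0,1\}^\Gamma$ by the shift action. If $Y \subsetneq \{0,1\}^\Gamma$ is a closed (in the product topology) shift-invariant proper subset, then there exists a closed shift-invariant subset $X \subseteq \{0,1\}^\Gamma \setminus Y$ such that the action of $\Gamma$ on $X$ (the restriction of the shift action) is free and admits an invariant probability measure, i.e., there is a Borel probability measure on $X$ that is invariant under the action of $\Gamma$.
   Context: The set $\{0,1\}$ carries the discrete topology and $\{0,1\}^\Gamma$ (the set of all functions $\Gamma \to \{0,1\}$) carries the product topology. The shift action of $\Gamma$ on $\{0,1\}^\Gamma$ is the left action given by $(\gamma \cdot f)(\delta) := f(\delta\gamma)$ for all $f \in \{0,1\}^\Gamma$ and $\gamma, \delta \in \Gamma$. An action of $\Gamma$ on a set $X$ is free if for all $x \in X$ and $\gamma \in \Gamma$, $\gamma \cdot x = x$ implies that $\gamma$ is the identity element of $\Gamma$. *)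

theory Defs
  imports
    "HOL-Probability.Probability_Measure"
    "HOL-Analysis.Function_Topology"
    "HOL-Algebra.Group_Action"
begin

text \<open>The space \<open>{0,1}\<^sup>\<Gamma>\<close>. Functions on \<open>\<Gamma>\<close> are represented as extensional functions on
  the carrier, so that the underlying set is \<open>carrier G \<rightarrow>\<^sub>E {0, 1}\<close>.\<close>

definition full_shift :: "('g, 'b) monoid_scheme \<Rightarrow> ('g \<Rightarrow> nat) topology" where
  "full_shift G = product_topology (\<lambda>_. discrete_topology {0, 1}) (carrier G)"

definition shift :: "('g, 'b) monoid_scheme \<Rightarrow> 'g \<Rightarrow> ('g \<Rightarrow> nat) \<Rightarrow> 'g \<Rightarrow> nat" where
  "shift G \<gamma> f = (\<lambda>\<delta>\<in>carrier G. f (\<delta> \<otimes>\<^bsub>G\<^esub> \<gamma>))"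

text \<open>The next three notions are stated for an arbitrary map \<open>\<phi>\<close> giving the action on some
  ambient set; they refer only to the values of \<open>\<phi>\<close> on the given subset.\<close>

definition invariant_set ::
  "('g, 'b) monoid_scheme \<Rightarrow> ('g \<Rightarrow> 'x \<Rightarrow> 'x) \<Rightarrow> 'x set \<Rightarrow> bool" where
  "invariant_set G \<phi> X \<longleftrightarrow> (\<forall>\<gamma>\<in>carrier G. \<forall>x\<in>X. \<phi> \<gamma> x \<in> X)"

definition free_on ::
  "('g, 'b) monoid_scheme \<Rightarrow> ('g \<Rightarrow> 'x \<Rightarrow> 'x) \<Rightarrow> 'x set \<Rightarrow> bool" where
  "free_on G \<phi> X \<longleftrightarrow> (\<forall>x\<in>X. \<forall>\<gamma>\<in>carrier G. \<phi> \<gamma> x = x \<longrightarrow> \<gamma> = \<one>\<^bsub>G\<^esub>)"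

definition invariant_measure ::
  "('g, 'b) monoid_scheme \<Rightarrow> ('g \<Rightarrow> 'x \<Rightarrow> 'x) \<Rightarrow> 'x measure \<Rightarrow> bool" where
  "invariant_measure G \<phi> \<mu> \<longleftrightarrow>
     (\<forall>\<gamma>\<in>carrier G. \<phi> \<gamma> \<in> \<mu> \<rightarrow>\<^sub>M \<mu> \<and> distr \<mu> \<mu> (\<phi> \<gamma>) = \<mu>)"

text \<open>A Borel probability measure on an abstract topological space. The library's \<open>borel\<close>
  is only available for topologies given by a type class.\<close>

definition borel_prob_measure :: "'x topology \<Rightarrow> 'x measure \<Rightarrow> bool" where
  "borel_prob_measure T \<mu> \<longleftrightarrow>
     prob_space \<mu> \<and> space \<mu> = topspace T \<and>
     sets \<mu> = sigma_sets (topspace T) {U. openin T U}"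

lemma topspace_full_shift: "topspace (full_shift G) = carrier G \<rightarrow>\<^sub>E {0, 1}"
  by (simp add: full_shift_def)

text \<open>The restriction of the shift to an invariant set is a left action in the sense of the
  library.\<close>

lemma group_action_shift:
  assumes "group G" and X: "X \<subseteq> topspace (full_shift G)"
    and inv: "invariant_set G (shift G) X"
  shows "group_action G X (\<lambda>\<gamma>. \<lambda>f\<in>X. shift G \<gamma> f)"
proof -
  interpret group G by fact
  have mem: "shift G \<gamma> f \<in> X" if "\<gamma> \<in> carrier G" "f \<in> X" for \<gamma> f
    using inv that by (auto simp: invariant_set_def)
  have comp: "shift G (\<gamma> \<otimes>\<^bsub>G\<^esub> \<eta>) f = shift G \<gamma> (shift G \<eta> f)"
    if "\<gamma> \<in> carrier G" "\<eta> \<in> carrier G" for \<gamma> \<eta> f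
    using that by (auto simp: shift_def fun_eq_iff m_assoc)
  have one: "shift G \<one>\<^bsub>G\<^esub> f = f" if "f \<in> X" for f
  proof -
    have "f \<in> extensional (carrier G)"
      using that X by (auto simp: topspace_full_shift PiE_def)
    then show ?thesis
      by (auto simp: shift_def fun_eq_iff extensional_def)
  qed
  have bij: "bij_betw (shift G \<gamma>) X X" if "\<gamma> \<in> carrier G" for \<gamma>
    by (rule bij_betw_byWitness[where f' = "shift G (inv\<^bsub>G\<^esub> \<gamma>)"])
       (use that mem comp[symmetric] one in auto)
  have "(\<lambda>f\<in>X. shift G \<gamma> f) \<in> Bij X" if "\<gamma> \<in> carrier G" for \<gamma>
    using bij[OF that] by (auto simp: Bij_def cong: bij_betw_cong)
  moreover have "(\<lambda>f\<in>X. shift G (\<gamma> \<otimes>\<^bsub>G\<^esub> \<eta>) f) =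
      compose X (\<lambda>f\<in>X. shift G \<gamma> f) (\<lambda>f\<in>X. shift G \<eta> f)"
    if "\<gamma> \<in> carrier G" "\<eta> \<in> carrier G" for \<gamma> \<eta>
    using that mem comp by (auto simp: compose_def fun_eq_iff)
  ultimately show ?thesis
    by (intro group_action.intro group_hom.intro group_hom_axioms.intro group_BijGroup is_group
        homI) (simp_all add: BijGroup_def)
qed

end

theory Submission
  imports Defs "HOL-Real_Asymp.Real_Asymp" "HOL-Probability.Infinite_Product_Measure"
begin

text \<open>Label \<open>G\<close> by independent uniform elements of \<open>{1..K}\<close>. Off an event of probability
  \<open>O(1/K)\<close> the labels are distinct on any prescribed finite window, so they can serve as the time
  order of a local greedy algorithm, whose output is an equivariant finite-range function of the labels.

  A state of the algorithm is a configuration \<open>x\<close> with a set \<open>\<sigma>\<close> of sites that may still be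
  modified. Stage \<open>0\<close> plants, in every translate of some finite window, a pattern that does not occur
  in \<open>Y\<close>. Stage \<open>j\<close> picks a separated and syndetic set of markers \<open>m\<close>, reserves some sites of
  \<open>\<sigma>\<close> near each \<open>m\<close> for later stages, and fills about \<open>n\<close> other ones so that \<open>x\<close> near \<open>m\<close> differs
  from \<open>x\<close> near each of the polynomially (in \<open>n\<close>) many points to which \<open>\<gamma>\<^sub>j\<close> can move \<open>m\<close>; a
  greedy choice exists because each requirement excludes an exponentially small proportion of the
  fillings. Later stages only touch \<open>\<sigma>\<close>, so everything achieved survives, and the windows do not
  depend on the number of stages or on \<open>K\<close>.

  The laws of the outputs are invariant contents on the algebra of cylinder sets; by compactness
  there is one that vanishes on all the bad events, and it extends to a measure. \<open>X\<close> is the set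
  of points whose orbits avoid the bad events.\<close>

text \<open>The obstacle: \<open>x\<close> near a marker \<open>m\<close> must differ from
  \<open>x\<close> near a moved point whose sites may lie in the block of another marker, filled at
  another time. Each pair of sites is therefore charged to the marker that freezes the later of the
  two; that marker knows the other value when it chooses. The price is that one marker must serve
  every position from which it can be charged, so the requirements have to be counted. With blocks
  of size linear in a parameter \<open>r\<close> they are bounded by a polynomial of degree 10 in
  \<open>r\<close>, while \<open>3 * r\<close> comparisons leave a requirement unsatisfied for at
  most the fraction \<open>1 / 2 ^ r\<close> of the fillings. A union bound, conditional on the
  past, then suffices.

  The order of choice is forced: first the windows \<open>T j\<close> of the bad events, since the
  limit content must vanish on fixed cylinder sets; then, for finitely many stages, \<open>B\<close>
  and \<open>W\<close>, which say where colours must differ and must be nonzero; only then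
  \<open>K\<close>. The range of the block map may grow with \<open>K\<close>, but success at a site
  needs colours only on a translate of \<open>W\<close>, so failure has probability at most a
  constant over \<open>K\<close>.\<close>

section \<open>Breaking coincidences by counting\<close>

text \<open>Greedy choice: taking \<open>f\<close> rules out only \<open>f\<close> itself, at most
  one \<open>f'\<close> with \<open>\<beta> f' = \<alpha> f\<close> and at most one with
  \<open>\<alpha> f' = \<beta> f\<close>; hence the factor 3. It extracts comparisons that can be
  decided independently from ones that share sites.\<close>

lemma large_matching:
  fixes \<alpha> \<beta> :: "'k \<Rightarrow> 'v"
  assumes "finite K" "inj_on \<alpha> K" "inj_on \<beta> K"
  shows "\<exists>Q\<subseteq>K. card K \<le> 3 * card Q \<and> (\<forall>f\<in>Q. \<forall>f'\<in>Q. f \<noteq> f' \<longrightarrow> \<alpha> f \<noteq> \<beta> f')"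
  using assms
proof (induction "card K" arbitrary: K rule: less_induct)
  case less
  show ?case
  proof (cases "K = {}")
    case True
    then show ?thesis by auto
  next
    case False
    then obtain f where f: "f \<in> K" by auto
    define A where "A = {f'\<in>K. \<beta> f' = \<alpha> f}"
    define B where "B = {f'\<in>K. \<alpha> f' = \<beta> f}"
    have cA: "card A \<le> 1" "finite A" and cB: "card B \<le> 1" "finite B"
      using less.prems unfolding A_def B_def
      by (auto simp: card_le_Suc0_iff_eq inj_on_def)
    define K' where "K' = K - ({f} \<union> A \<union> B)"
    have sub: "K' \<subseteq> K" by (auto simp: K'_def)
    have lt: "card K' < card K"
      using f less.prems by (intro psubset_card_mono) (auto simp: K'_def)
    have "card ({f} \<union> A \<union> B) \<le> 3"
      using cA cB card_Un_le[of "{f} \<union> A" B] card_Un_le[of "{f}" A] by simp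
    moreover have "card K - card ({f} \<union> A \<union> B) \<le> card K'"
      unfolding K'_def using cA cB by (intro diff_card_le_card_Diff) auto
    ultimately have big: "card K \<le> card K' + 3" by linarith
    obtain Q where Q: "Q \<subseteq> K'" "card K' \<le> 3 * card Q"
      "\<forall>f\<in>Q. \<forall>f'\<in>Q. f \<noteq> f' \<longrightarrow> \<alpha> f \<noteq> \<beta> f'"
      using less.hyps[OF lt] sub less.prems by (meson finite_subset inj_on_subset)
    have "finite Q" using Q sub less.prems by (meson finite_subset)
    moreover have "f \<notin> Q" using Q by (auto simp: K'_def)
    ultimately have "card (insert f Q) = Suc (card Q)" by simp
    then have "card K \<le> 3 * card (insert f Q)" using big Q by linarith
    moreover have "insert f Q \<subseteq> K" using Q sub f by auto
    moreover have "\<alpha> g \<noteq> \<beta> g'" if "g \<in> insert f Q" "g' \<in> insert f Q" "g \<noteq> g'" for g g'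
      using that Q by (fastforce simp: K'_def A_def B_def)
    ultimately show ?thesis by blast
  qed
qed

definition overwrite :: "'v set \<Rightarrow> ('v \<Rightarrow> bool) \<Rightarrow> 'v set \<Rightarrow> 'v \<Rightarrow> bool" where
  "overwrite A z p v \<longleftrightarrow> (if v \<in> A then v \<in> p else z v)"

text \<open>Along a matching \<open>Q\<close>, each comparison has an endpoint in \<open>A\<close>
  that serves as its own dependent site, and its other endpoint is never dependent. Agreement then
  determines the filling on the dependent sites from its values elsewhere, so \<open>card Q\<close>
  bits are lost.\<close>

lemma card_agreeing_le:
  fixes \<alpha> \<beta> :: "'k \<Rightarrow> 'v"
  assumes A: "finite A" and K: "finite K" and inj: "inj_on \<alpha> K" "inj_on \<beta> K"
    and ne: "\<And>f. f \<in> K \<Longrightarrow> \<alpha> f \<noteq> \<beta> f"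
    and inA: "\<And>f. f \<in> K \<Longrightarrow> \<alpha> f \<in> A \<or> \<beta> f \<in> A"
    and r: "3 * r \<le> card K"
  shows "card {p. p \<subseteq> A \<and> (\<forall>f\<in>K. overwrite A z p (\<alpha> f) = overwrite A z p (\<beta> f))} * 2 ^ r \<le> 2 ^ card A"
proof -
  obtain Q where Q: "Q \<subseteq> K" "card K \<le> 3 * card Q"
    and dis: "\<And>f f'. f \<in> Q \<Longrightarrow> f' \<in> Q \<Longrightarrow> f \<noteq> f' \<Longrightarrow> \<alpha> f \<noteq> \<beta> f'"
    using large_matching[OF K inj] by metis
  define g where "g f = (if \<alpha> f \<in> A then \<alpha> f else \<beta> f)" for f
  define J where "J = g ` Q"
  have finQ: "finite Q" using Q K by (meson finite_subset)
  have "inj_on g Q"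
  proof (rule inj_onI, rule ccontr)
    fix f f' assume "f \<in> Q" "f' \<in> Q" "g f = g f'" "f \<noteq> f'"
    moreover have "f \<in> K" "f' \<in> K" using \<open>f \<in> Q\<close> \<open>f' \<in> Q\<close> Q by auto
    ultimately show False
      using dis[of f f'] dis[of f' f] inj unfolding g_def inj_on_def by (auto split: if_splits)
  qed
  then have cardJ: "card J = card Q" by (simp add: J_def card_image)
  have JA: "J \<subseteq> A" using inA Q by (auto simp: J_def g_def)
  define Bad where "Bad = {p. p \<subseteq> A \<and> (\<forall>f\<in>K. overwrite A z p (\<alpha> f) = overwrite A z p (\<beta> f))}"
  have other: "(if \<alpha> f \<in> A then \<beta> f else \<alpha> f) \<notin> J" if f: "f \<in> Q" for f
  proof
    assume "(if \<alpha> f \<in> A then \<beta> f else \<alpha> f) \<in> J"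
    then obtain f' where f': "f' \<in> Q" "(if \<alpha> f \<in> A then \<beta> f else \<alpha> f) = g f'"
      by (auto simp: J_def)
    have K: "f \<in> K" "f' \<in> K" using f f' Q by auto
    show False
    proof (cases "f = f'")
      case True
      then show ?thesis using f' ne[OF K(1)] by (auto simp: g_def split: if_splits)
    next
      case False
      then show ?thesis using f' f dis[of f f'] dis[of f' f] inj K inA[of f]
        unfolding g_def inj_on_def by (auto split: if_splits)
    qed
  qed
  have "inj_on (\<lambda>p. p - J) Bad"
  proof (rule inj_onI)
    fix p p' assume p: "p \<in> Bad" "p' \<in> Bad" and eq: "p - J = p' - J"
    have out: "overwrite A z p v = overwrite A z p' v" if "v \<notin> J" for v
      using that eq by (auto simp: overwrite_def)
    have "v \<in> p \<longleftrightarrow> v \<in> p'" for v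
    proof (cases "v \<in> J")
      case True
      then obtain f where f: "f \<in> Q" "v = g f" by (auto simp: J_def)
      then have fK: "f \<in> K" using Q by auto
      have vA: "v \<in> A" using True JA by auto
      have "overwrite A z q (\<alpha> f) = overwrite A z q (\<beta> f)" if "q \<in> {p, p'}" for q
        using that p fK by (auto simp: Bad_def)
      then have "overwrite A z p v = overwrite A z p' v"
        using out[OF other[OF f(1)]] f(2) by (auto simp: g_def split: if_splits)
      then show ?thesis using vA by (simp add: overwrite_def)
    next
      case False
      then show ?thesis using eq by blast
    qed
    then show "p = p'" by blast
  qed
  moreover have "(\<lambda>p. p - J) ` Bad \<subseteq> Pow (A - J)" by (auto simp: Bad_def)
  ultimately have "card Bad \<le> card (Pow (A - J))"
    by (intro card_inj_on_le) (use A in auto)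
  also have "\<dots> = 2 ^ (card A - card Q)"
    using A JA by (simp add: card_Pow card_Diff_subset finite_subset cardJ)
  finally have "card Bad * 2 ^ r \<le> 2 ^ (card A - card Q) * 2 ^ r" by simp
  also have "\<dots> = 2 ^ (card A - card Q + r)" by (simp add: power_add)
  also have "\<dots> \<le> 2 ^ card A"
    using Q r card_mono[OF A JA] cardJ by (intro power_increasing) auto
  finally show ?thesis by (simp add: Bad_def)
qed

text \<open>Union bound: a requirement with at least \<open>3 * r\<close> comparisons fails for at
  most the fraction \<open>1 / 2 ^ r\<close> of the fillings of \<open>A\<close>, and there are
  fewer than \<open>2 ^ r\<close> requirements.\<close>

lemma exists_breaking:
  fixes \<alpha> \<beta> :: "'i \<Rightarrow> 'k \<Rightarrow> 'v"
  assumes A: "finite A" and I: "finite I" "card I < 2 ^ r"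
    and K: "\<And>i. i \<in> I \<Longrightarrow> finite (K i)"
    and inj: "\<And>i. i \<in> I \<Longrightarrow> inj_on (\<alpha> i) (K i)" "\<And>i. i \<in> I \<Longrightarrow> inj_on (\<beta> i) (K i)"
    and ne: "\<And>i f. i \<in> I \<Longrightarrow> f \<in> K i \<Longrightarrow> \<alpha> i f \<noteq> \<beta> i f"
    and inA: "\<And>i f. i \<in> I \<Longrightarrow> f \<in> K i \<Longrightarrow> \<alpha> i f \<in> A \<or> \<beta> i f \<in> A"
  shows "\<exists>p\<subseteq>A. \<forall>i\<in>I. 3 * r \<le> card (K i) \<longrightarrow>
           (\<exists>f\<in>K i. overwrite A z p (\<alpha> i f) \<noteq> overwrite A z p (\<beta> i f))"
proof (rule ccontr)
  define Bad where "Bad i = {p. p \<subseteq> A \<and> (\<forall>f\<in>K i. overwrite A z p (\<alpha> i f) = overwrite A z p (\<beta> i f))}" for i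
  define I' where "I' = {i\<in>I. 3 * r \<le> card (K i)}"
  assume "\<not> ?thesis"
  then have "Pow A \<subseteq> (\<Union>i\<in>I'. Bad i)"
    by (auto simp: Bad_def I'_def)
  moreover have "finite (\<Union>i\<in>I'. Bad i)"
    by (rule finite_subset[of _ "Pow A"]) (use A in \<open>auto simp: Bad_def\<close>)
  ultimately have "2 ^ card A \<le> card (\<Union>i\<in>I'. Bad i)"
    using A card_mono card_Pow by metis
  also have "\<dots> \<le> (\<Sum>i\<in>I'. card (Bad i))"
    using I by (intro card_UN_le) (auto simp: I'_def)
  finally have "2 ^ card A * 2 ^ r \<le> (\<Sum>i\<in>I'. card (Bad i)) * 2 ^ r" by simp
  also have "\<dots> = (\<Sum>i\<in>I'. card (Bad i) * 2 ^ r)" by (simp add: sum_distrib_right)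
  also have "\<dots> \<le> (\<Sum>i\<in>I'. 2 ^ card A)"
    unfolding Bad_def
    by (intro sum_mono card_agreeing_le) (use A K inj ne inA in \<open>auto simp: I'_def\<close>)
  also have "\<dots> = card I' * 2 ^ card A" by simp
  also have "\<dots> \<le> card I * 2 ^ card A"
    using I card_mono[of I I'] by (intro mult_right_mono) (auto simp: I'_def)
  also have "\<dots> < 2 ^ r * 2 ^ card A" using I by simp
  finally show False by (simp add: mult.commute)
qed

text \<open>Supplies the \<open>r\<close> of a refinement stage: \<open>(6 * r + e + 1) * e\<close>
  will bound the size of a marker's block, and the exponent 10 is 6 + 4, from the bounds on two sets
  of relative positions there.\<close>

lemma exists_pow2_gt_poly: "\<exists>r::nat. 2 * ((6 * r + e + 1) * e) ^ 10 < 2 ^ r"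
proof -
  define a where "a = real ((7 + e) * e) + 1"
  have "a > 0" by (simp add: a_def add_nonneg_pos)
  then have "eventually (\<lambda>r::nat. 2 * (real r * a) ^ 10 < 2 ^ r) at_top"
    by real_asymp
  then obtain r where r: "2 * (real r * a) ^ 10 < 2 ^ r" "r \<ge> 1"
    using eventually_happens'[OF _ eventually_conj[OF _ eventually_ge_at_top[of 1]]] by force
  have "(6 * r + e + 1) * e \<le> r * ((7 + e) * e)"
  proof -
    have "e \<le> r * e" using r(2) by simp
    then have "6 * r + e + 1 \<le> r * (7 + e)" using r(2) unfolding distrib_left by linarith
    then show ?thesis by (metis mult.assoc mult_le_mono1)
  qed
  then have "real ((6 * r + e + 1) * e) \<le> real r * a"
    unfolding a_def by (simp only: of_nat_mult[symmetric] distrib_left mult_1_right)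
  then have "2 * real ((6 * r + e + 1) * e) ^ 10 \<le> 2 * (real r * a) ^ 10"
    by (intro mult_left_mono power_mono) auto
  then have "2 * real ((6 * r + e + 1) * e) ^ 10 < 2 ^ r" using r(1) by linarith
  then have "real (2 * ((6 * r + e + 1) * e) ^ 10) < real (2 ^ r)" by simp
  then show ?thesis by (metis of_nat_less_iff)
qed

context group
begin

section \<open>Block maps and greedy constructions\<close>

text \<open>Using the same dependence at \<open>g\<close> and at \<open>g'\<close> encodes locality and equivariance at once. Only
  the values on the carrier matter.\<close>

definition block_map :: "(('a \<Rightarrow> 'i) \<Rightarrow> 'a \<Rightarrow> 'y) \<Rightarrow> bool" where
  "block_map f \<longleftrightarrow> (\<exists>V. finite V \<and> V \<subseteq> carrier G \<and>
     (\<forall>\<omega> \<omega>' g g'. g \<in> carrier G \<longrightarrow> g' \<in> carrier G \<longrightarrow>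
        (\<forall>v\<in>V. \<omega> (v \<otimes> g) = \<omega>' (v \<otimes> g')) \<longrightarrow> f \<omega> g = f \<omega>' g'))"

lemma finite_set_mult: "finite A \<Longrightarrow> finite B \<Longrightarrow> finite (A <#> B)"
  by (auto simp: set_mult_def)

lemma card_set_mult_le:
  assumes "finite A" "finite B"
  shows "card (A <#> B) \<le> card A * card B"
proof -
  have "A <#> B = (\<lambda>(a, b). a \<otimes> b) ` (A \<times> B)" by (auto simp: set_mult_def)
  then show ?thesis
    using card_image_le[of "A \<times> B" "\<lambda>(a, b). a \<otimes> b"] assms by (simp add: card_cartesian_product)
qed

lemma set_multI: "a \<in> A \<Longrightarrow> b \<in> B \<Longrightarrow> a \<otimes> b \<in> A <#> B"
  by (auto simp: set_mult_def)

lemma inv_image_closed: "A \<subseteq> carrier G \<Longrightarrow> m_inv G ` A \<subseteq> carrier G"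
  by auto

text \<open>Sliding block codes compose, the product of the windows being a window. With
  \<open>f\<close> a tuple built by \<open>block_map_pair\<close>, locality of a construction
  reduces to naming the finitely many positions it inspects.\<close>

lemma block_map_via:
  fixes f :: "('a \<Rightarrow> 'i) \<Rightarrow> 'a \<Rightarrow> 'y" and h :: "('a \<Rightarrow> 'i) \<Rightarrow> 'a \<Rightarrow> 'z"
  assumes f: "block_map f" and V: "finite V" "V \<subseteq> carrier G"
    and h: "\<And>\<omega> \<omega>' g g'. g \<in> carrier G \<Longrightarrow> g' \<in> carrier G \<Longrightarrow>
      (\<And>v. v \<in> V \<Longrightarrow> f \<omega> (v \<otimes> g) = f \<omega>' (v \<otimes> g')) \<Longrightarrow> h \<omega> g = h \<omega>' g'"
  shows "block_map h"
proof -
  obtain W where W: "finite W" "W \<subseteq> carrier G" and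
    loc: "\<And>\<omega> \<omega>' g g'. g \<in> carrier G \<Longrightarrow> g' \<in> carrier G \<Longrightarrow>
        (\<forall>v\<in>W. \<omega> (v \<otimes> g) = \<omega>' (v \<otimes> g')) \<Longrightarrow> f \<omega> g = f \<omega>' g'"
    using f unfolding block_map_def by metis
  show ?thesis
    unfolding block_map_def
  proof (intro exI[of _ "W <#> V"] conjI allI impI)
    fix \<omega> \<omega>' :: "'a \<Rightarrow> 'i" and g g'
    assume g: "g \<in> carrier G" "g' \<in> carrier G"
      and eq: "\<forall>v\<in>W <#> V. \<omega> (v \<otimes> g) = \<omega>' (v \<otimes> g')"
    show "h \<omega> g = h \<omega>' g'"
    proof (rule h[OF g])
      fix v assume v: "v \<in> V"
      show "f \<omega> (v \<otimes> g) = f \<omega>' (v \<otimes> g')"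
      proof (rule loc)
        show "\<forall>w\<in>W. \<omega> (w \<otimes> (v \<otimes> g)) = \<omega>' (w \<otimes> (v \<otimes> g'))"
        proof
          fix w assume w: "w \<in> W"
          have "w \<in> carrier G" "v \<in> carrier G" using w v W V by auto
          then show "\<omega> (w \<otimes> (v \<otimes> g)) = \<omega>' (w \<otimes> (v \<otimes> g'))"
            using bspec[OF eq set_multI[OF w v]] g by (simp add: m_assoc)
        qed
      qed (use v V g in auto)
    qed
  qed (use W V finite_set_mult set_mult_closed in auto)
qed

lemma block_map_pair:
  fixes f :: "('a \<Rightarrow> 'i) \<Rightarrow> 'a \<Rightarrow> 'y" and h :: "('a \<Rightarrow> 'i) \<Rightarrow> 'a \<Rightarrow> 'z"
  assumes "block_map f" "block_map h"
  shows "block_map (\<lambda>\<omega> g. (f \<omega> g, h \<omega> g))"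
proof -
  obtain V where "finite V" "V \<subseteq> carrier G"
    "\<And>\<omega> \<omega>' g g'. g \<in> carrier G \<Longrightarrow> g' \<in> carrier G \<Longrightarrow>
        (\<forall>v\<in>V. \<omega> (v \<otimes> g) = \<omega>' (v \<otimes> g')) \<Longrightarrow> f \<omega> g = f \<omega>' g'"
    using assms(1) unfolding block_map_def by metis
  moreover obtain W where "finite W" "W \<subseteq> carrier G"
    "\<And>\<omega> \<omega>' g g'. g \<in> carrier G \<Longrightarrow> g' \<in> carrier G \<Longrightarrow>
        (\<forall>v\<in>W. \<omega> (v \<otimes> g) = \<omega>' (v \<otimes> g')) \<Longrightarrow> h \<omega> g = h \<omega>' g'"
    using assms(2) unfolding block_map_def by metis
  ultimately show ?thesis
    unfolding block_map_def by (intro exI[of _ "V \<union> W"]) auto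
qed

text \<open>Colour 0 means uncoloured, so clashes between uncoloured sites are permitted. This lets
  a site with a clashing random label simply be given up.\<close>

definition proper_colouring :: "'a set \<Rightarrow> ('a \<Rightarrow> nat) \<Rightarrow> bool" where
  "proper_colouring B c \<longleftrightarrow> (\<forall>g\<in>carrier G. \<forall>b\<in>B. b \<noteq> \<one> \<longrightarrow> c (b \<otimes> g) = c g \<longrightarrow> c g = 0)"

lemma proper_colouringD:
  "proper_colouring B c \<Longrightarrow> g \<in> carrier G \<Longrightarrow> b \<in> B \<Longrightarrow> b \<noteq> \<one> \<Longrightarrow> c (b \<otimes> g) = c g \<Longrightarrow> c g = 0"
  by (auto simp: proper_colouring_def)

lemma proper_colouring_mono: "proper_colouring B c \<Longrightarrow> A \<subseteq> B \<Longrightarrow> proper_colouring A c"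
  by (auto simp: proper_colouring_def)

text \<open>A greedy maximal independent set with colours as time: at its time, a site becomes a
  marker unless its \<open>R\<close>-neighbourhood already contains one. Two sites that become
  markers at the same time are not \<open>R\<close>-neighbours because the colouring is
  proper.\<close>

lemma exists_markers:
  fixes c :: "('a \<Rightarrow> 'i) \<Rightarrow> 'a \<Rightarrow> nat"
  assumes R: "finite R" "R \<subseteq> carrier G" "\<one> \<in> R" "m_inv G ` R \<subseteq> R"
    and c: "block_map c" and proper: "\<And>\<omega>. proper_colouring R (c \<omega>)"
  shows "\<exists>M. block_map M \<and> (\<forall>\<omega>. \<forall>g\<in>carrier G.
     (M \<omega> g \<longrightarrow> c \<omega> g \<in> {1..K}) \<and>
     (\<forall>r\<in>R. M \<omega> g \<longrightarrow> M \<omega> (r \<otimes> g) \<longrightarrow> r = \<one>) \<and>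
     (c \<omega> g \<in> {1..K} \<longrightarrow> (\<exists>r\<in>R. M \<omega> (r \<otimes> g))))"
proof (induction K)
  case 0
  show ?case
    by (rule exI[of _ "\<lambda>\<omega> g. False"]) (auto simp: block_map_def)
next
  case (Suc K)
  then obtain M where M: "block_map M"
    and col: "\<And>\<omega> g. g \<in> carrier G \<Longrightarrow> M \<omega> g \<Longrightarrow> c \<omega> g \<in> {1..K}"
    and sep: "\<And>\<omega> g r. g \<in> carrier G \<Longrightarrow> r \<in> R \<Longrightarrow> M \<omega> g \<Longrightarrow> M \<omega> (r \<otimes> g) \<Longrightarrow> r = \<one>"
    and dense: "\<And>\<omega> g. g \<in> carrier G \<Longrightarrow> c \<omega> g \<in> {1..K} \<Longrightarrow> \<exists>r\<in>R. M \<omega> (r \<otimes> g)"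
    by metis
  define N where "N \<omega> g \<longleftrightarrow> M \<omega> g \<or> (c \<omega> g = Suc K \<and> (\<forall>r\<in>R. \<not> M \<omega> (r \<otimes> g)))" for \<omega> g
  have "block_map N"
  proof (rule block_map_via[OF block_map_pair[OF M c] R(1,2)])
    fix \<omega> \<omega>' g g'
    assume g: "g \<in> carrier G" "g' \<in> carrier G"
      and eq: "\<And>v. v \<in> R \<Longrightarrow> (M \<omega> (v \<otimes> g), c \<omega> (v \<otimes> g)) = (M \<omega>' (v \<otimes> g'), c \<omega>' (v \<otimes> g'))"
    then show "N \<omega> g = N \<omega>' g'"
      using eq[OF R(3)] by (auto simp: N_def)
  qed
  moreover have "N \<omega> g \<longrightarrow> c \<omega> g \<in> {1..Suc K}" if "g \<in> carrier G" for \<omega> g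
    using col[OF that] by (fastforce simp: N_def)
  moreover have "r = \<one>" if "g \<in> carrier G" "r \<in> R" "N \<omega> g" "N \<omega> (r \<otimes> g)" for \<omega> g r
  proof (rule ccontr)
    assume r: "r \<noteq> \<one>"
    have rc: "r \<in> carrier G" using R that by auto
    have "\<not> M \<omega> (r \<otimes> g)" if "c \<omega> g = Suc K" "\<not> M \<omega> g"
      using that \<open>N \<omega> g\<close> \<open>r \<in> R\<close> by (auto simp: N_def)
    \<comment> \<open>A new marker at \<open>r \<otimes> g\<close> looks back at \<open>g\<close>
      through \<open>inv r\<close>, which is why \<open>R\<close> has to be symmetric.\<close>
    moreover have "\<not> M \<omega> g" if "\<not> M \<omega> (r \<otimes> g)"
    proof
      assume "M \<omega> g"
      have "inv r \<in> R" using R \<open>r \<in> R\<close> by auto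
      moreover have "inv r \<otimes> (r \<otimes> g) = g"
        using rc \<open>g \<in> carrier G\<close> by (simp add: m_assoc[symmetric])
      ultimately show False
        using \<open>M \<omega> g\<close> that \<open>N \<omega> (r \<otimes> g)\<close> by (auto simp: N_def)
    qed
    moreover have "\<not> (c \<omega> g = Suc K \<and> c \<omega> (r \<otimes> g) = Suc K)"
      using proper_colouringD[OF proper[of \<omega>] \<open>g \<in> carrier G\<close> \<open>r \<in> R\<close> r] by auto
    ultimately show False
      using sep[OF that(1,2)] r that(3,4) unfolding N_def by blast
  qed
  moreover have "\<exists>r\<in>R. N \<omega> (r \<otimes> g)" if g: "g \<in> carrier G" "c \<omega> g \<in> {1..Suc K}" for \<omega> g
  proof (cases "\<exists>r\<in>R. M \<omega> (r \<otimes> g)")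
    case True
    then show ?thesis by (auto simp: N_def)
  next
    case False
    then have "c \<omega> g = Suc K" using dense[OF g(1), of \<omega>] g(2) by (cases "c \<omega> g = Suc K") auto
    then have "N \<omega> (\<one> \<otimes> g)" using False g by (auto simp: N_def)
    then show ?thesis using R(3) by blast
  qed
  ultimately show ?case by (intro exI[of _ N]) blast
qed

text \<open>Coordinates are relative to a marker \<open>m\<close>, and \<open>a v\<close> is the time at which the site \<open>v m\<close> is
  frozen. Comparing the translates of \<open>D\<close> by \<open>u m\<close> and \<open>w m\<close>, these are the places settled at time
  \<open>k\<close> by the marker \<open>m\<close>: both sites are frozen by then, and \<open>m\<close> freezes at least one of them.\<close>

definition comparisons :: "'a set \<Rightarrow> nat \<Rightarrow> ('a \<Rightarrow> nat) \<Rightarrow> 'a \<Rightarrow> 'a \<Rightarrow> 'a set" where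
  "comparisons D k a u w = {f\<in>D. let A = {v\<in>D. a v = k} in
     (f \<otimes> u \<in> A \<or> f \<otimes> w \<in> A) \<and> (f \<otimes> u \<in> A \<or> a (f \<otimes> u) < k) \<and> (f \<otimes> w \<in> A \<or> a (f \<otimes> w) < k)}"

lemma comparisons_cong:
  assumes "\<And>v. v \<in> D \<Longrightarrow> a v = b v" "\<And>f. f \<in> D \<Longrightarrow> a (f \<otimes> u) = b (f \<otimes> u)"
    "\<And>f. f \<in> D \<Longrightarrow> a (f \<otimes> w) = b (f \<otimes> w)"
  shows "comparisons D k a u w = comparisons D k b u w"
  by (auto simp: comparisons_def assms)

text \<open>The counting applied to one block. What it asks for is cancellation in the group: right
  multiplication is injective, and \<open>u \<noteq> w\<close> separates the two sites of every
  comparison.\<close>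

lemma exists_block_pattern:
  assumes D: "finite D" "D \<subseteq> carrier G" and I: "finite I" "I \<subseteq> carrier G \<times> carrier G"
    and ne: "\<And>u w. (u, w) \<in> I \<Longrightarrow> u \<noteq> w" and card: "card I < 2 ^ r"
  shows "\<exists>p. \<forall>(u, w)\<in>I. 3 * r \<le> card (comparisons D k a u w) \<longrightarrow>
    (\<exists>f\<in>comparisons D k a u w.
       overwrite {v\<in>D. a v = k} z p (f \<otimes> u) \<noteq> overwrite {v\<in>D. a v = k} z p (f \<otimes> w))"
proof -
  have "\<exists>p\<subseteq>{v\<in>D. a v = k}. \<forall>i\<in>I. 3 * r \<le> card (comparisons D k a (fst i) (snd i)) \<longrightarrow>
    (\<exists>f\<in>comparisons D k a (fst i) (snd i).
       overwrite {v\<in>D. a v = k} z p (f \<otimes> fst i) \<noteq> overwrite {v\<in>D. a v = k} z p (f \<otimes> snd i))"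
  proof (rule exists_breaking)
    fix i assume i: "i \<in> I"
    then have c: "fst i \<in> carrier G" "snd i \<in> carrier G" using I by auto
    have sub: "comparisons D k a (fst i) (snd i) \<subseteq> D" by (auto simp: comparisons_def)
    then show "finite (comparisons D k a (fst i) (snd i))" using D finite_subset by blast
    show "inj_on (\<lambda>f. f \<otimes> fst i) (comparisons D k a (fst i) (snd i))"
      "inj_on (\<lambda>f. f \<otimes> snd i) (comparisons D k a (fst i) (snd i))"
      using c sub D by (auto intro!: inj_onI dest!: subsetD[OF D(2)] subsetD[OF sub])
    fix f assume f: "f \<in> comparisons D k a (fst i) (snd i)"
    show "f \<otimes> fst i \<noteq> f \<otimes> snd i"
      using f sub D c ne[of "fst i" "snd i"] i by auto
    show "f \<otimes> fst i \<in> {v\<in>D. a v = k} \<or> f \<otimes> snd i \<in> {v\<in>D. a v = k}"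
      using f by (auto simp: comparisons_def Let_def)
  qed (use D I card in auto)
  then show ?thesis by (auto simp: split_beta)
qed

text \<open>Induction over time. At time \<open>Suc K\<close> each marker fills the sites of that
  age in its block after seeing what was frozen before; comparisons settled earlier involve only
  sites that are no longer touched. Disjointness of the blocks lets all markers act at once.\<close>

lemma exists_patterns:
  fixes x M :: "('a \<Rightarrow> 'i) \<Rightarrow> 'a \<Rightarrow> bool"
  assumes D: "finite D" "D \<subseteq> carrier G" and I: "finite I" "I \<subseteq> carrier G \<times> carrier G"
    and ne: "\<And>u w. (u, w) \<in> I \<Longrightarrow> u \<noteq> w" and card: "card I < 2 ^ r"
    and x: "block_map x" and age: "block_map age" and M: "block_map M"
    and disj: "\<And>\<omega> m m' d d'. m \<in> carrier G \<Longrightarrow> m' \<in> carrier G \<Longrightarrow> M \<omega> m \<Longrightarrow> M \<omega> m' \<Longrightarrow>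
       d \<in> D \<Longrightarrow> d' \<in> D \<Longrightarrow> d \<otimes> m = d' \<otimes> m' \<Longrightarrow> m = m'"
  shows "\<exists>x'. block_map x' \<and> (\<forall>\<omega>. 
     (\<forall>g\<in>carrier G. age \<omega> g \<notin> {1..K} \<longrightarrow> x' \<omega> g = x \<omega> g) \<and>
     (\<forall>m\<in>carrier G. M \<omega> m \<longrightarrow> (\<forall>k\<in>{1..K}. \<forall>(u, w)\<in>I.
        3 * r \<le> card (comparisons D k (\<lambda>v. age \<omega> (v \<otimes> m)) u w) \<longrightarrow>
        (\<exists>f\<in>comparisons D k (\<lambda>v. age \<omega> (v \<otimes> m)) u w.
           x' \<omega> (f \<otimes> u \<otimes> m) \<noteq> x' \<omega> (f \<otimes> w \<otimes> m)))))"
proof (induction K)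
  case 0
  show ?case by (rule exI[of _ x]) (use x in auto)
next
  case (Suc K)
  then obtain y where y: "block_map y"
    and y_out: "\<And>\<omega> g. g \<in> carrier G \<Longrightarrow> age \<omega> g \<notin> {1..K} \<Longrightarrow> y \<omega> g = x \<omega> g"
    and y_in: "\<And>\<omega> m k u w. m \<in> carrier G \<Longrightarrow> M \<omega> m \<Longrightarrow> k \<in> {1..K} \<Longrightarrow> (u, w) \<in> I \<Longrightarrow>
        3 * r \<le> card (comparisons D k (\<lambda>v. age \<omega> (v \<otimes> m)) u w) \<Longrightarrow>
        (\<exists>f\<in>comparisons D k (\<lambda>v. age \<omega> (v \<otimes> m)) u w.
           y \<omega> (f \<otimes> u \<otimes> m) \<noteq> y \<omega> (f \<otimes> w \<otimes> m))"
    by (fastforce simp: split_beta)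
  define V where "V = D \<union> (D <#> fst ` I) \<union> (D <#> snd ` I)"
  have Ic: "fst ` I \<subseteq> carrier G" "snd ` I \<subseteq> carrier G" using I by auto
  have V: "finite V" "V \<subseteq> carrier G" "D \<subseteq> V"
    using D I Ic by (auto simp: V_def intro!: finite_set_mult dest!: subsetD[OF set_mult_closed, rotated -1])
  have inV: "f \<otimes> u \<in> V" "f \<otimes> w \<in> V" if "f \<in> D" "(u, w) \<in> I" for f u w
    using that by (force simp: V_def set_mult_def)+
  define P where "P z p \<longleftrightarrow> (\<forall>(u, w)\<in>I. 3 * r \<le> card (comparisons D (Suc K) (snd \<circ> z) u w) \<longrightarrow>
    (\<exists>f\<in>comparisons D (Suc K) (snd \<circ> z) u w.
       overwrite {v\<in>D. (snd \<circ> z) v = Suc K} (fst \<circ> z) p (f \<otimes> u) \<noteq>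
       overwrite {v\<in>D. (snd \<circ> z) v = Suc K} (fst \<circ> z) p (f \<otimes> w)))"
    for z :: "'a \<Rightarrow> bool \<times> nat" and p
  define pick where "pick z = (SOME p. P z p)" for z
  have pick: "P z (pick z)" for z
    unfolding pick_def P_def
    by (rule someI_ex) (rule exists_block_pattern[OF D I ne card])
  \<comment> \<open>The restriction to \<open>V\<close> makes equal local data give equal functions,
    hence equal picks. This is where the arbitrary choice \<open>pick\<close> becomes
    equivariant.\<close>
  define view where "view \<omega> m = (\<lambda>v\<in>V. (y \<omega> (v \<otimes> m), age \<omega> (v \<otimes> m)))" for \<omega> m
  \<comment> \<open>A site of this age that lies in no marker's block gets \<open>False\<close>;
    nothing is claimed about it.\<close>
  define y' where "y' \<omega> g = (if age \<omega> g = Suc K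
      then \<exists>d\<in>D. M \<omega> (inv d \<otimes> g) \<and> d \<in> pick (view \<omega> (inv d \<otimes> g)) else y \<omega> g)" for \<omega> g
  have "block_map y'"
  proof (rule block_map_via[OF block_map_pair[OF M block_map_pair[OF y age]]])
    let ?V = "insert \<one> (m_inv G ` D \<union> (V <#> m_inv G ` D))"
    show "finite ?V" "?V \<subseteq> carrier G"
      using D V set_mult_closed[OF V(2) inv_image_closed[OF D(2)]] by (auto intro!: finite_set_mult)
    fix \<omega> \<omega>' g g'
    assume g: "g \<in> carrier G" "g' \<in> carrier G"
      and eq: "\<And>v. v \<in> ?V \<Longrightarrow> (M \<omega> (v \<otimes> g), y \<omega> (v \<otimes> g), age \<omega> (v \<otimes> g)) =
        (M \<omega>' (v \<otimes> g'), y \<omega>' (v \<otimes> g'), age \<omega>' (v \<otimes> g'))"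
    have 1: "age \<omega> g = age \<omega>' g'" "y \<omega> g = y \<omega>' g'" using eq[of \<one>] g by auto
    have "M \<omega> (inv d \<otimes> g) = M \<omega>' (inv d \<otimes> g')" if "d \<in> D" for d
      using eq[of "inv d"] that by auto
    moreover have "view \<omega> (inv d \<otimes> g) = view \<omega>' (inv d \<otimes> g')" if d: "d \<in> D" for d
    proof -
      have "(y \<omega> (v \<otimes> (inv d \<otimes> g)), age \<omega> (v \<otimes> (inv d \<otimes> g))) =
        (y \<omega>' (v \<otimes> (inv d \<otimes> g')), age \<omega>' (v \<otimes> (inv d \<otimes> g')))" if v: "v \<in> V" for v
      proof -
        have "v \<otimes> inv d \<in> ?V" using v d by (auto intro: set_multI)
        from eq[OF this] show ?thesis using v d V D g by (auto simp: m_assoc subset_iff)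
      qed
      then show ?thesis by (auto simp: view_def)
    qed
    ultimately show "y' \<omega> g = y' \<omega>' g'" using 1 by (simp add: y'_def)
  qed
  moreover have "y' \<omega> g = x \<omega> g" if "g \<in> carrier G" "age \<omega> g \<notin> {1..Suc K}" for \<omega> g
    using that y_out[of g \<omega>] by (auto simp: y'_def)
  moreover have inner: "\<exists>f\<in>comparisons D k (\<lambda>v. age \<omega> (v \<otimes> m)) u w.
           y' \<omega> (f \<otimes> u \<otimes> m) \<noteq> y' \<omega> (f \<otimes> w \<otimes> m)"
    if m: "m \<in> carrier G" "M \<omega> m" and k: "k \<in> {1..Suc K}" and uw: "(u, w) \<in> I"
      and big: "3 * r \<le> card (comparisons D k (\<lambda>v. age \<omega> (v \<otimes> m)) u w)" for \<omega> m k u w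
  proof (cases "k = Suc K")
    case False
    then have k': "k \<in> {1..K}" using k by auto
    obtain f where f: "f \<in> comparisons D k (\<lambda>v. age \<omega> (v \<otimes> m)) u w"
      "y \<omega> (f \<otimes> u \<otimes> m) \<noteq> y \<omega> (f \<otimes> w \<otimes> m)"
      using y_in[OF m k' uw big] by blast
    then have "age \<omega> (f \<otimes> u \<otimes> m) < Suc K" "age \<omega> (f \<otimes> w \<otimes> m) < Suc K"
      using k' by (auto simp: comparisons_def Let_def)
    then show ?thesis using f by (intro bexI[of _ f]) (auto simp: y'_def)
  next
    case True
    define A where "A = {v\<in>D. age \<omega> (v \<otimes> m) = k}"
    define z where "z = view \<omega> m"
    have zV: "z v = (y \<omega> (v \<otimes> m), age \<omega> (v \<otimes> m))" if "v \<in> V" for v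
      using that by (simp add: z_def view_def)
    have A_eq: "{v\<in>D. (snd \<circ> z) v = Suc K} = A"
      using zV V by (auto simp: A_def True)
    have comp_eq: "comparisons D (Suc K) (snd \<circ> z) u w = comparisons D k (\<lambda>v. age \<omega> (v \<otimes> m)) u w"
      unfolding True by (rule comparisons_cong) (use zV V inV uw in auto)
    have "3 * r \<le> card (comparisons D (Suc K) (snd \<circ> z) u w)"
      unfolding comp_eq by (rule big)
    then have "\<exists>f\<in>comparisons D (Suc K) (snd \<circ> z) u w.
       overwrite {v\<in>D. (snd \<circ> z) v = Suc K} (fst \<circ> z) (pick z) (f \<otimes> u) \<noteq>
       overwrite {v\<in>D. (snd \<circ> z) v = Suc K} (fst \<circ> z) (pick z) (f \<otimes> w)"
      using bspec[OF pick[of z, unfolded P_def] uw] by blast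
    then obtain f where f: "f \<in> comparisons D k (\<lambda>v. age \<omega> (v \<otimes> m)) u w"
      and dis: "overwrite A (fst \<circ> z) (pick z) (f \<otimes> u) \<noteq> overwrite A (fst \<circ> z) (pick z) (f \<otimes> w)"
      unfolding comp_eq A_eq by blast
    have val: "y' \<omega> (v \<otimes> m) = overwrite A (fst \<circ> z) (pick z) v"
      if v: "v \<in> V" "v \<in> A \<or> age \<omega> (v \<otimes> m) < k" for v
    proof (cases "v \<in> A")
      case False
      then show ?thesis using v zV by (auto simp: y'_def overwrite_def True)
    next
      case vA: True
      have vc: "v \<in> carrier G" "v \<in> D" "age \<omega> (v \<otimes> m) = Suc K"
        using vA v V True by (auto simp: A_def)
      \<comment> \<open>No other marker can claim the site \<open>v \<otimes> m\<close>, so the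
        existential in \<open>y'\<close> reduces to the pick made by \<open>m\<close>.\<close>
      have uniq: "d = v" if d: "d \<in> D" "M \<omega> (inv d \<otimes> (v \<otimes> m))" for d
      proof -
        have dc: "d \<in> carrier G" using d D by auto
        have eq: "d \<otimes> (inv d \<otimes> (v \<otimes> m)) = v \<otimes> m"
          using dc vc m by (simp add: m_assoc[symmetric])
        have "inv d \<otimes> (v \<otimes> m) = m"
          by (rule disj[OF _ m(1) d(2) m(2) d(1) vc(2) eq]) (use dc vc m in auto)
        then show "d = v" using eq dc vc m by auto
      qed
      have inv_v: "inv v \<otimes> (v \<otimes> m) = m" using vc m by (simp add: m_assoc[symmetric])
      have "y' \<omega> (v \<otimes> m) \<longleftrightarrow>
          (\<exists>d\<in>D. M \<omega> (inv d \<otimes> (v \<otimes> m)) \<and> d \<in> pick (view \<omega> (inv d \<otimes> (v \<otimes> m))))"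
        using vc by (simp add: y'_def)
      also have "\<dots> \<longleftrightarrow> v \<in> pick z"
        using uniq vc(2) m(2) inv_v unfolding z_def by metis
      finally have "y' \<omega> (v \<otimes> m) \<longleftrightarrow> v \<in> pick z" .
      then show ?thesis using vA by (simp add: overwrite_def)
    qed
    have fD: "f \<in> D" using f by (auto simp: comparisons_def)
    have "f \<otimes> u \<in> A \<or> age \<omega> (f \<otimes> u \<otimes> m) < k" "f \<otimes> w \<in> A \<or> age \<omega> (f \<otimes> w \<otimes> m) < k"
      using f by (auto simp: comparisons_def A_def Let_def)
    then show ?thesis
      using f dis val[OF inV(1)[OF fD uw]] val[OF inV(2)[OF fD uw]] by blast
  qed
  ultimately show ?case
  proof (intro exI[of _ y'] conjI allI ballI impI)
    fix \<omega> m k i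
    assume "m \<in> carrier G" "M \<omega> m" "k \<in> {1..Suc K}" "i \<in> I"
    then show "case i of (u, w) \<Rightarrow>
      3 * r \<le> card (comparisons D k (\<lambda>v. age \<omega> (v \<otimes> m)) u w) \<longrightarrow>
      (\<exists>f\<in>comparisons D k (\<lambda>v. age \<omega> (v \<otimes> m)) u w. y' \<omega> (f \<otimes> u \<otimes> m) \<noteq> y' \<omega> (f \<otimes> w \<otimes> m))"
      using inner[of m \<omega> k] by (cases i) simp
  qed simp_all
qed


lemma inv_mult_cancel [simp]:
  "x \<in> carrier G \<Longrightarrow> y \<in> carrier G \<Longrightarrow> inv x \<otimes> (x \<otimes> y) = y"
  "x \<in> carrier G \<Longrightarrow> y \<in> carrier G \<Longrightarrow> x \<otimes> (inv x \<otimes> y) = y"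
  by (simp_all flip: m_assoc)

section \<open>Aperiodicity on a sparse set of free sites\<close>

text \<open>\<open>D\<close> is a union of \<open>n\<close> pairwise disjoint translates of
  \<open>E\<close>, all disjoint from \<open>E\<close> itself, and each contributes a point of its
  own; an infinite group always has room for another one. The bound on \<open>card D\<close>, linear
  in \<open>n\<close>, keeps the later count of requirements polynomial.\<close>

lemma exists_translates:
  assumes inf: "infinite (carrier G)" and E: "finite E" "E \<subseteq> carrier G"
  shows "\<exists>D L. finite D \<and> D \<subseteq> carrier G \<and> D \<inter> E = {} \<and> card D \<le> n * card E \<and>
    finite L \<and> L \<subseteq> carrier G \<and> (\<forall>P. \<forall>h\<in>carrier G.
      (\<forall>a\<in>L. \<exists>e\<in>E. P (e \<otimes> (a \<otimes> h))) \<longrightarrow> n \<le> card {d\<in>D. P (d \<otimes> h)})"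
proof (induction n)
  case 0
  show ?case by (rule exI[of _ "{}"], rule exI[of _ "{}"]) simp
next
  case (Suc n)
  then obtain D L where D: "finite D" "D \<subseteq> carrier G" "D \<inter> E = {}" "card D \<le> n * card E"
    and L: "finite L" "L \<subseteq> carrier G" and
    DL: "\<forall>P. \<forall>h\<in>carrier G. (\<forall>a\<in>L. \<exists>e\<in>E. P (e \<otimes> (a \<otimes> h))) \<longrightarrow> n \<le> card {d\<in>D. P (d \<otimes> h)}"
    by (elim exE conjE) (rule that; assumption)
  have "finite (m_inv G ` E <#> (D \<union> E))" using D E by (intro finite_set_mult) auto
  then obtain a where a: "a \<in> carrier G" "a \<notin> m_inv G ` E <#> (D \<union> E)"
    using inf by (meson finite_subset subsetI)
  have new: "e \<otimes> a \<notin> D \<union> E" if "e \<in> E" for e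
  proof
    assume "e \<otimes> a \<in> D \<union> E"
    then have "inv e \<otimes> (e \<otimes> a) \<in> m_inv G ` E <#> (D \<union> E)"
      using that by (intro set_multI) auto
    then show False using a that E by (auto simp: subset_iff)
  qed
  define D' where "D' = D \<union> (\<lambda>e. e \<otimes> a) ` E"
  have "card D' \<le> card D + card E"
    unfolding D'_def using E card_Un_le[of D "(\<lambda>e. e \<otimes> a) ` E"] card_image_le[of E "\<lambda>e. e \<otimes> a"]
    by linarith
  then have "card D' \<le> Suc n * card E" using D by simp
  moreover have "Suc n \<le> card {d\<in>D'. P (d \<otimes> h)}"
    if h: "h \<in> carrier G" and P: "\<forall>b\<in>insert a L. \<exists>e\<in>E. P (e \<otimes> (b \<otimes> h))" for P h
  proof -
    obtain e where e: "e \<in> E" "P (e \<otimes> (a \<otimes> h))" using P by blast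
    then have "e \<otimes> a \<in> {d\<in>D'. P (d \<otimes> h)}" "e \<otimes> a \<notin> {d\<in>D. P (d \<otimes> h)}"
      using new a h E by (auto simp: D'_def m_assoc subset_iff)
    moreover have "{d\<in>D. P (d \<otimes> h)} \<subseteq> {d\<in>D'. P (d \<otimes> h)}" by (auto simp: D'_def)
    ultimately have "card {d\<in>D. P (d \<otimes> h)} < card {d\<in>D'. P (d \<otimes> h)}"
      using D E by (intro psubset_card_mono) (auto simp: D'_def)
    then show ?thesis using DL[rule_format, OF h, of P] P by force
  qed
  ultimately show ?case
    using D E L a new by (intro exI[of _ D'] exI[of _ "insert a L"]) (auto simp: D'_def)
qed


text \<open>The difference \<open>x' (t h) \<noteq> x' (t \<gamma> h)\<close> is obtained at sites outside \<open>\<sigma>'\<close>, hence it survives all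
  later modifications inside \<open>\<sigma>'\<close>. The order of the quantifiers matters: \<open>T\<close> and \<open>E'\<close> must not
  depend on the colouring.\<close>

lemma exists_aperiodic_refinement:
  assumes inf: "infinite (carrier G)" and E: "finite E" "E \<subseteq> carrier G" "E \<noteq> {}"
    and \<gamma>: "\<gamma> \<in> carrier G" "\<gamma> \<noteq> \<one>"
  shows "\<exists>T E' B W. finite T \<and> T \<subseteq> carrier G \<and> finite E' \<and> E' \<subseteq> carrier G \<and> E' \<noteq> {} \<and>
    finite B \<and> B \<subseteq> carrier G \<and> finite W \<and> W \<subseteq> carrier G \<and>
    (\<forall>K (c :: ('a \<Rightarrow> 'i) \<Rightarrow> 'a \<Rightarrow> nat)
      (x :: ('a \<Rightarrow> 'i) \<Rightarrow> 'a \<Rightarrow> bool) (\<sigma> :: ('a \<Rightarrow> 'i) \<Rightarrow> 'a \<Rightarrow> bool).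
      block_map c \<longrightarrow> block_map x \<longrightarrow> block_map \<sigma> \<longrightarrow>
      (\<forall>\<omega>. proper_colouring B (c \<omega>) \<and> (\<forall>g\<in>carrier G. c \<omega> g \<le> K)) \<longrightarrow>
      (\<exists>x' \<sigma>'. block_map x' \<and> block_map \<sigma>' \<and> (\<forall>\<omega>. 
         (\<forall>g\<in>carrier G. \<sigma>' \<omega> g \<longrightarrow> \<sigma> \<omega> g) \<and>
         (\<forall>g\<in>carrier G. \<not> \<sigma> \<omega> g \<longrightarrow> x' \<omega> g = x \<omega> g) \<and>
         (\<forall>h\<in>carrier G. c \<omega> h \<noteq> 0 \<longrightarrow> (\<forall>w\<in>W. \<exists>e\<in>E. \<sigma> \<omega> (e \<otimes> (w \<otimes> h))) \<longrightarrow>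
            (\<exists>e\<in>E'. \<sigma>' \<omega> (e \<otimes> h)) \<and>
            (\<exists>t\<in>T. \<not> \<sigma>' \<omega> (t \<otimes> h) \<and> \<not> \<sigma>' \<omega> (t \<otimes> \<gamma> \<otimes> h) \<and>
               x' \<omega> (t \<otimes> h) \<noteq> x' \<omega> (t \<otimes> \<gamma> \<otimes> h))))))"
proof -

  \<comment> \<open>Windows of one refinement stage\<close>
  define e where "e = card E"
  obtain r where r: "2 * ((6 * r + e + 1) * e) ^ 10 < 2 ^ r" using exists_pow2_gt_poly by blast
  have e: "e > 0" using E by (auto simp: e_def card_gt_0_iff)
  have r0: "r > 0" using r e by (cases r) auto
  \<comment> \<open>Of \<open>6 * r + e\<close> free sites at most \<open>e\<close> are lost to
    reservations; the larger half of the rest has \<open>3 * r\<close> elements and so contains a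
    matching of size \<open>r\<close>.\<close>
  obtain D L where D: "finite D" "D \<subseteq> carrier G" "D \<inter> E = {}" "card D \<le> (6 * r + e) * e"
    and L: "finite L" "L \<subseteq> carrier G" and
    DL: "\<forall>P. \<forall>h\<in>carrier G. (\<forall>a\<in>L. \<exists>e\<in>E. P (e \<otimes> (a \<otimes> h))) \<longrightarrow>
      6 * r + e \<le> card {d\<in>D. P (d \<otimes> h)}"
    using exists_translates[OF inf E(1,2), of "6 * r + e"] unfolding e_def[symmetric]
    by (elim exE conjE) (rule that; assumption)
  \<comment> \<open>The territory of a marker \<open>m\<close>: sites \<open>D m\<close> to be
    filled and sites \<open>E m\<close> to be reserved.\<close>
  define C where "C = D \<union> E"
  define Di where "Di = m_inv G ` D"
  \<comment> \<open>Separation by \<open>R\<close> means that at most one territory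
    \<open>C m\<close> meets any given translate \<open>D g\<close>; this is \<open>sep\<close>
    below.\<close>
  define R where "R = (m_inv G ` C) <#> D <#> Di <#> C"
  \<comment> \<open>If \<open>m = t \<otimes> h\<close>, then
    \<open>t \<otimes> \<gamma> \<otimes> h = \<delta> \<otimes> m\<close> with
    \<open>\<delta> = t \<otimes> \<gamma> \<otimes> inv t\<close>: these are the displacements of a
    marker caused by \<open>\<gamma>\<close>.\<close>
  define \<Delta> where "\<Delta> = (\<lambda>t. t \<otimes> \<gamma> \<otimes> inv t) ` R"
  \<comment> \<open>Positions of a marker \<open>m\<close> relative to a marker \<open>m2\<close>
    whose block meets \<open>D \<delta> m\<close>: if
    \<open>f \<otimes> \<delta> \<otimes> m = d \<otimes> m2\<close>, then
    \<open>m = u \<otimes> m2\<close> with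
    \<open>u = inv \<delta> \<otimes> inv f \<otimes> d\<close>. The element \<open>\<one>\<close>
    stands for \<open>m\<close> seen from itself.\<close>
  define U where "U = insert \<one> ((m_inv G ` \<Delta>) <#> Di <#> D)"
  define I where "I = (\<lambda>(u, \<delta>). (u, \<delta> \<otimes> u)) ` (U \<times> \<Delta>)"
  \<comment> \<open>Properness along \<open>R\<close> serves the choice of markers. Along the second
    set it forbids equal colours for two distinct markers involved in one comparison.\<close>
  define B where "B = R \<union> (Di <#> D <#> \<Delta>)"
  \<comment> \<open>The marker serving \<open>h\<close> is \<open>t \<otimes> h\<close> with
    \<open>t\<close> in \<open>R\<close>. Free sites are demanded near it for the reserve, and near
    \<open>a \<otimes> t \<otimes> h\<close> for \<open>a\<close> in \<open>L\<close> to make its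
    block rich.\<close>
  define W where "W = R \<union> (L <#> R)"
  have C: "finite C" "C \<subseteq> carrier G" "D \<subseteq> C" "E \<subseteq> C" using D E by (auto simp: C_def)
  have Di: "finite Di" "Di \<subseteq> carrier G" using D by (auto simp: Di_def)
  have Rc: "finite R" "R \<subseteq> carrier G"
    unfolding R_def by (intro finite_set_mult set_mult_closed inv_image_closed finite_imageI C D Di)+
  have \<Delta>c: "finite \<Delta>" "\<Delta> \<subseteq> carrier G" using Rc \<gamma> by (auto simp: \<Delta>_def)
  have Uc: "finite U" "U \<subseteq> carrier G"
    unfolding U_def
    by (intro finite.insertI insert_subsetI one_closed finite_set_mult set_mult_closed
        inv_image_closed finite_imageI C D Di \<Delta>c)+
  have Ic: "finite I" "I \<subseteq> carrier G \<times> carrier G"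
    using Uc \<Delta>c by (auto simp: I_def subset_iff)
  have Bc: "finite B" "B \<subseteq> carrier G"
    unfolding B_def by (intro finite_UnI Un_least finite_set_mult set_mult_closed Rc D Di \<Delta>c)+
  have Wc: "finite W" "W \<subseteq> carrier G"
    unfolding W_def by (intro finite_UnI Un_least finite_set_mult set_mult_closed Rc L)+
  have in_R: "inv a \<otimes> d \<otimes> inv d' \<otimes> b \<in> R" if "a \<in> C" "d \<in> D" "d' \<in> D" "b \<in> C" for a d d' b
    unfolding R_def Di_def using that by (intro set_multI imageI)
  have "6 * r + e \<le> card {d\<in>D. True}"
    using E by (intro DL[rule_format, of \<one> "\<lambda>_. True"]) auto
  then have D_ne: "D \<noteq> {}" using e by auto
  then obtain d0 where d0: "d0 \<in> D" by blast
  have d0c: "d0 \<in> carrier G" using d0 D by blast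
  have R1: "\<one> \<in> R" using in_R[of d0 d0 d0 d0] d0 d0c C by (auto simp: m_assoc subset_iff)
  have R_inv: "m_inv G ` R \<subseteq> R"
  proof
    fix s assume "s \<in> m_inv G ` R"
    then obtain a d d' b where "a \<in> C" "d \<in> D" "d' \<in> D" "b \<in> C"
      and s: "s = inv (inv a \<otimes> d \<otimes> inv d' \<otimes> b)"
      unfolding R_def Di_def set_mult_def by blast
    then have "s = inv b \<otimes> d' \<otimes> inv d \<otimes> a"
      using C D by (simp add: subset_iff inv_mult_group m_assoc)
    then show "s \<in> R" using in_R \<open>a \<in> C\<close> \<open>d \<in> D\<close> \<open>d' \<in> D\<close> \<open>b \<in> C\<close> by simp
  qed
  have \<Delta>_ne: "\<delta> \<noteq> \<one>" if \<delta>: "\<delta> \<in> \<Delta>" for \<delta>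
  proof
    assume "\<delta> = \<one>"
    obtain t where "t \<in> R" "\<delta> = t \<otimes> \<gamma> \<otimes> inv t" using \<delta> unfolding \<Delta>_def by blast
    then have t: "t \<in> carrier G" "t \<otimes> \<gamma> \<otimes> inv t = \<one>"
      using \<open>\<delta> = \<one>\<close> Rc by auto
    then have "inv t \<otimes> (t \<otimes> \<gamma> \<otimes> inv t) \<otimes> t = \<one>" using \<gamma> by simp
    then show False using t(1) \<gamma> by (simp add: m_assoc)
  qed
  have I_ne: "u \<noteq> w" if uw: "(u, w) \<in> I" for u w
  proof
    assume "u = w"
    then obtain \<delta> where "u \<in> U" "\<delta> \<in> \<Delta>" "u = \<delta> \<otimes> u" using uw by (auto simp: I_def)
    then show False using \<Delta>_ne Uc \<Delta>c by (metis r_cancel_one' subsetD)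
  qed
  have card_I: "card I < 2 ^ r"
  proof -
    \<comment> \<open>Bounds \<open>card C\<close>: at most \<open>(6 * r + e) * e\<close> from
      \<open>D\<close> and \<open>e\<close> from \<open>E\<close>. The four factors of
      \<open>R\<close> give \<open>\<kappa> ^ 4\<close> for \<open>\<Delta>\<close>, and two more
      factors give \<open>\<kappa> ^ 6\<close> for the products in \<open>U\<close>.\<close>
    define \<kappa> where "\<kappa> = (6 * r + e + 1) * e"
    have cC: "card C \<le> \<kappa>"
      using card_Un_le[of D E] D(4) by (simp add: C_def \<kappa>_def e_def algebra_simps)
    have cD: "card D \<le> \<kappa>" using cC card_mono[OF C(1,3)] by linarith
    have cDi: "card Di \<le> \<kappa>" using cD card_image_le[OF D(1), of "m_inv G"] by (simp add: Di_def)
    have cCi: "card (m_inv G ` C) \<le> \<kappa>" using cC card_image_le[OF C(1), of "m_inv G"] by simp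
    have mult: "card (X <#> Y) \<le> a * b" if "finite X" "finite Y" "card X \<le> a" "card Y \<le> b" for X Y a b
      using card_set_mult_le[OF that(1,2)] mult_le_mono[OF that(3,4)] by linarith
    have "card R \<le> \<kappa> * \<kappa> * \<kappa> * \<kappa>"
      unfolding R_def using C D Di cC cD cDi cCi by (intro mult finite_set_mult) auto
    then have c\<Delta>: "card \<Delta> \<le> \<kappa> ^ 4"
      using card_image_le[OF Rc(1), of "\<lambda>t. t \<otimes> \<gamma> \<otimes> inv t"]
      by (simp add: \<Delta>_def eval_nat_numeral mult.assoc)
    then have "card (m_inv G ` \<Delta>) \<le> \<kappa> ^ 4"
      using card_image_le[OF \<Delta>c(1), of "m_inv G"] by linarith
    then have "card ((m_inv G ` \<Delta>) <#> Di <#> D) \<le> \<kappa> ^ 4 * \<kappa> * \<kappa>"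
      using D Di cD cDi \<Delta>c by (intro mult finite_set_mult) auto
    then have cU: "card U \<le> 1 + \<kappa> ^ 6"
      using card_insert_le_m1[of "Suc (\<kappa> ^ 6)"] unfolding U_def
      by (simp add: eval_nat_numeral mult.assoc mult.commute card_insert_if)
    have "card I \<le> card (U \<times> \<Delta>)" unfolding I_def using Uc \<Delta>c by (intro card_image_le) auto
    also have "\<dots> \<le> (1 + \<kappa> ^ 6) * \<kappa> ^ 4"
      unfolding card_cartesian_product by (intro mult_le_mono cU c\<Delta>)
    also have "\<dots> \<le> 2 * \<kappa> ^ 10"
    proof -
      have "\<kappa> ^ 4 \<le> \<kappa> ^ 10" using e by (intro power_increasing) (auto simp: \<kappa>_def)
      moreover have "\<kappa> ^ 6 * \<kappa> ^ 4 = \<kappa> ^ 10" by (simp flip: power_add)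
      ultimately show ?thesis by (simp add: algebra_simps)
    qed
    finally show ?thesis using r by (simp add: \<kappa>_def)
  qed
  show ?thesis
  proof (rule exI[of _ "D <#> R"], rule exI[of _ "E <#> R"], rule exI[of _ B], rule exI[of _ W],
      intro conjI allI impI)
    show "finite (D <#> R)" "D <#> R \<subseteq> carrier G" "finite (E <#> R)" "E <#> R \<subseteq> carrier G"
      using D Rc E by (auto intro!: finite_set_mult dest!: subsetD[OF set_mult_closed, rotated -1])
    show "E <#> R \<noteq> {}" using E R1 by (auto simp: set_mult_def)
    show "finite B" "B \<subseteq> carrier G" "finite W" "W \<subseteq> carrier G" by fact+

    \<comment> \<open>The refined state and the order of filling\<close>
    fix K and c :: "('a \<Rightarrow> 'i) \<Rightarrow> 'a \<Rightarrow> nat" and x \<sigma> :: "('a \<Rightarrow> 'i) \<Rightarrow> 'a \<Rightarrow> bool"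
    assume c: "block_map c" and x: "block_map x" and \<sigma>: "block_map \<sigma>"
      and col: "\<forall>\<omega>. proper_colouring B (c \<omega>) \<and> (\<forall>g\<in>carrier G. c \<omega> g \<le> K)"
    have prB: "\<And>\<omega>. proper_colouring B (c \<omega>)" using col by blast
    then have prR: "\<And>\<omega>. proper_colouring R (c \<omega>)"
      by (rule proper_colouring_mono) (auto simp: B_def)
    obtain M where M: "block_map M"
      and Mc: "\<And>\<omega> m. m \<in> carrier G \<Longrightarrow> M \<omega> m \<Longrightarrow> c \<omega> m \<in> {1..K}"
      and Msep: "\<And>\<omega> m s. m \<in> carrier G \<Longrightarrow> s \<in> R \<Longrightarrow> M \<omega> m \<Longrightarrow> M \<omega> (s \<otimes> m) \<Longrightarrow> s = \<one>"
      and Mdense: "\<And>\<omega> m. m \<in> carrier G \<Longrightarrow> c \<omega> m \<in> {1..K} \<Longrightarrow> \<exists>s\<in>R. M \<omega> (s \<otimes> m)"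
      using exists_markers[OF Rc R1 R_inv c prR, of K] by metis
    have sep: "m = m'" if m: "m \<in> carrier G" "M \<omega> m" "m' \<in> carrier G" "M \<omega> m'"
      and abcd: "a \<in> C" "d \<in> D" "d' \<in> D" "b \<in> C"
      and g: "g \<in> carrier G" "a \<otimes> m = d \<otimes> g" "b \<otimes> m' = d' \<otimes> g" for \<omega> m m' a b d d' g
    proof -
      have cc: "a \<in> carrier G" "d \<in> carrier G" "d' \<in> carrier G" "b \<in> carrier G"
        using abcd C D by auto
      have "m = inv a \<otimes> (d \<otimes> g)" using g(2)[symmetric] cc m by simp
      moreover have "g = inv d' \<otimes> (b \<otimes> m')" using g(1,3) cc m by simp
      ultimately have eq: "m = (inv a \<otimes> d \<otimes> inv d' \<otimes> b) \<otimes> m'"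
        using cc m by (simp add: m_assoc)
      have "inv a \<otimes> d \<otimes> inv d' \<otimes> b = \<one>"
        using Msep[OF m(3) in_R[OF abcd] m(4)] m(2) eq by simp
      then show ?thesis using eq m by simp
    qed
    have disj: "m = m'" if m: "m \<in> carrier G" "M \<omega> m" "m' \<in> carrier G" "M \<omega> m'"
      and "a \<in> C" "b \<in> C" "a \<otimes> m = b \<otimes> m'" for \<omega> m m' a b
      by (rule sep[OF m that(5) d0 d0 that(6), of "inv d0 \<otimes> (a \<otimes> m)"])
        (use that d0c C in \<open>auto simp: subset_iff\<close>)
    \<comment> \<open>Only the reserves \<open>E m\<close> stay free. A free site outside all blocks
      and reserves gets age 0 below, that is, it is frozen with its old value.\<close>
    define \<sigma>' where "\<sigma>' \<omega> g \<longleftrightarrow> \<sigma> \<omega> g \<and> (\<exists>e\<in>E. M \<omega> (inv e \<otimes> g))" for \<omega> g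
    \<comment> \<open>Sites kept free for later stages get the value \<open>Suc K\<close>, which is never reached. The sum
      has at most one nonzero term, because the blocks \<open>D m\<close> of distinct markers are disjoint.\<close>
    define age where "age \<omega> g = (if \<sigma>' \<omega> g then Suc K else if \<sigma> \<omega> g
      then (\<Sum>d\<in>D. if M \<omega> (inv d \<otimes> g) then c \<omega> (inv d \<otimes> g) else 0) else 0)" for \<omega> g
    let ?V = "insert \<one> (m_inv G ` E \<union> m_inv G ` D)"
    have V: "finite ?V" "?V \<subseteq> carrier G" using D E by auto
    have sc: "block_map (\<lambda>\<omega> g. (\<sigma> \<omega> g, M \<omega> g, c \<omega> g))"
      by (intro block_map_pair \<sigma> M c)
    have \<sigma>': "block_map \<sigma>'"
    proof (rule block_map_via[OF sc V])
      fix \<omega> \<omega>' g g' assume g: "g \<in> carrier G" "g' \<in> carrier G"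
        and eq: "\<And>v. v \<in> ?V \<Longrightarrow> (\<sigma> \<omega> (v \<otimes> g), M \<omega> (v \<otimes> g), c \<omega> (v \<otimes> g)) =
          (\<sigma> \<omega>' (v \<otimes> g'), M \<omega>' (v \<otimes> g'), c \<omega>' (v \<otimes> g'))"
      show "\<sigma>' \<omega> g = \<sigma>' \<omega>' g'" using eq[of \<one>] eq g by (auto simp: \<sigma>'_def)
    qed
    have age: "block_map age"
    proof (rule block_map_via[OF block_map_pair[OF \<sigma>' sc] V])
      fix \<omega> \<omega>' g g' assume g: "g \<in> carrier G" "g' \<in> carrier G"
        and eq: "\<And>v. v \<in> ?V \<Longrightarrow> (\<sigma>' \<omega> (v \<otimes> g), \<sigma> \<omega> (v \<otimes> g), M \<omega> (v \<otimes> g), c \<omega> (v \<otimes> g)) =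
          (\<sigma>' \<omega>' (v \<otimes> g'), \<sigma> \<omega>' (v \<otimes> g'), M \<omega>' (v \<otimes> g'), c \<omega>' (v \<otimes> g'))"
      have "(\<Sum>d\<in>D. if M \<omega> (inv d \<otimes> g) then c \<omega> (inv d \<otimes> g) else 0) =
         (\<Sum>d\<in>D. if M \<omega>' (inv d \<otimes> g') then c \<omega>' (inv d \<otimes> g') else 0)"
        by (rule sum.cong) (use eq in auto)
      then show "age \<omega> g = age \<omega>' g'" using eq[of \<one>] g by (auto simp: age_def)
    qed
    have slot_age: "age \<omega> (d \<otimes> m) = c \<omega> m"
      if m: "m \<in> carrier G" "M \<omega> m" and d: "d \<in> D" and s: "\<sigma> \<omega> (d \<otimes> m)" for \<omega> m d
    proof -
      have dc: "d \<in> carrier G" using d D by auto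
      have uniq: "a = d" if "a \<in> C" "M \<omega> (inv a \<otimes> (d \<otimes> m))" for a
      proof -
        have ac: "a \<in> carrier G" using that C by auto
        have "inv a \<otimes> (d \<otimes> m) = m"
          by (rule disj[OF _ that(2) m that(1)]) (use d dc ac m C in auto)
        then have "a \<otimes> m = d \<otimes> m" using ac dc m by (metis inv_mult_cancel(2) m_closed)
        then show ?thesis using ac dc m by simp
      qed
      have "\<not> \<sigma>' \<omega> (d \<otimes> m)"
        using uniq d D(3) C unfolding \<sigma>'_def by blast
      then have "age \<omega> (d \<otimes> m) =
          (\<Sum>a\<in>D. if M \<omega> (inv a \<otimes> (d \<otimes> m)) then c \<omega> (inv a \<otimes> (d \<otimes> m)) else 0)"
        using s by (simp add: age_def)
      also have "\<dots> = (\<Sum>a\<in>D. if a = d then c \<omega> m else 0)"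
        by (rule sum.cong[OF refl]) (use uniq C dc m in auto)
      also have "\<dots> = c \<omega> m" using d D by simp
      finally show ?thesis .
    qed
    have age_cases: "\<exists>d\<in>D. \<exists>m\<in>carrier G. M \<omega> m \<and> g = d \<otimes> m \<and> \<sigma> \<omega> g \<and> age \<omega> g = c \<omega> m"
      if g: "g \<in> carrier G" "\<not> \<sigma>' \<omega> g" "age \<omega> g \<noteq> 0" for \<omega> g
    proof -
      have \<sigma>g: "\<sigma> \<omega> g" and sum: "(\<Sum>d\<in>D. if M \<omega> (inv d \<otimes> g) then c \<omega> (inv d \<otimes> g) else 0) \<noteq> 0"
        using g by (auto simp: age_def split: if_splits)
      obtain d where d: "d \<in> D" "M \<omega> (inv d \<otimes> g)"
        by (rule sum.not_neutral_contains_not_neutral[OF sum]) (auto split: if_splits)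
      have dc: "d \<in> carrier G" using d D by auto
      have ic: "inv d \<otimes> g \<in> carrier G" and gd: "d \<otimes> (inv d \<otimes> g) = g" using dc g by simp_all
      have "age \<omega> g = c \<omega> (inv d \<otimes> g)"
        using slot_age[OF ic d(2,1)] \<sigma>g unfolding gd by blast
      then show ?thesis
        using d ic gd \<sigma>g by (intro bexI[of _ d] bexI[of _ "inv d \<otimes> g"]) auto
    qed
    obtain x' where x': "block_map x'"
      and x'_out: "\<And>\<omega> g. g \<in> carrier G \<Longrightarrow> age \<omega> g \<notin> {1..K} \<Longrightarrow> x' \<omega> g = x \<omega> g"
      and x'_in: "\<And>\<omega> m k u w. m \<in> carrier G \<Longrightarrow> M \<omega> m \<Longrightarrow> k \<in> {1..K} \<Longrightarrow> (u, w) \<in> I \<Longrightarrow>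
        3 * r \<le> card (comparisons D k (\<lambda>v. age \<omega> (v \<otimes> m)) u w) \<Longrightarrow>
        (\<exists>f\<in>comparisons D k (\<lambda>v. age \<omega> (v \<otimes> m)) u w.
           x' \<omega> (f \<otimes> u \<otimes> m) \<noteq> x' \<omega> (f \<otimes> w \<otimes> m))"
    proof -
      have slots_disj: "m = m'" if "m \<in> carrier G" "m' \<in> carrier G" "M \<omega> m" "M \<omega> m'"
        "d \<in> D" "d' \<in> D" "d \<otimes> m = d' \<otimes> m'" for \<omega> m m' d d'
        by (rule disj[OF that(1,3,2,4) _ _ that(7)]) (use that C in auto)
      obtain y where yb: "block_map y" and y: "\<forall>\<omega>. (\<forall>g\<in>carrier G. age \<omega> g \<notin> {1..K} \<longrightarrow> y \<omega> g = x \<omega> g) \<and>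
          (\<forall>m\<in>carrier G. M \<omega> m \<longrightarrow> (\<forall>k\<in>{1..K}. \<forall>(u, w)\<in>I.
            3 * r \<le> card (comparisons D k (\<lambda>v. age \<omega> (v \<otimes> m)) u w) \<longrightarrow>
            (\<exists>f\<in>comparisons D k (\<lambda>v. age \<omega> (v \<otimes> m)) u w.
               y \<omega> (f \<otimes> u \<otimes> m) \<noteq> y \<omega> (f \<otimes> w \<otimes> m))))"
      proof -
        note pat = exists_patterns[OF D(1,2) Ic _ card_I x age M, where K = K]
        show thesis
          by (rule exE[OF pat]) (use I_ne slots_disj that in \<open>blast+\<close>)
      qed
      show thesis
      proof (rule that[of y])
        show "block_map y" by fact
        show "y \<omega> g = x \<omega> g" if "g \<in> carrier G" "age \<omega> g \<notin> {1..K}" for \<omega> g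
          using y that by blast
        show "\<exists>f\<in>comparisons D k (\<lambda>v. age \<omega> (v \<otimes> m)) u w.
            y \<omega> (f \<otimes> u \<otimes> m) \<noteq> y \<omega> (f \<otimes> w \<otimes> m)"
          if "m \<in> carrier G" "M \<omega> m" "k \<in> {1..K}" "(u, w) \<in> I"
            "3 * r \<le> card (comparisons D k (\<lambda>v. age \<omega> (v \<otimes> m)) u w)" for \<omega> m k u w
          using y[THEN spec[of _ \<omega>], THEN conjunct2, THEN bspec[OF _ that(1)], THEN mp[OF _ that(2)],
              THEN bspec[OF _ that(3)], THEN bspec[OF _ that(4)]] that(5) by simp
      qed
    qed
    show "\<exists>x' \<sigma>'. block_map x' \<and> block_map \<sigma>' \<and> (\<forall>\<omega>. 
         (\<forall>g\<in>carrier G. \<sigma>' \<omega> g \<longrightarrow> \<sigma> \<omega> g) \<and>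
         (\<forall>g\<in>carrier G. \<not> \<sigma> \<omega> g \<longrightarrow> x' \<omega> g = x \<omega> g) \<and>
         (\<forall>h\<in>carrier G. c \<omega> h \<noteq> 0 \<longrightarrow> (\<forall>w\<in>W. \<exists>e\<in>E. \<sigma> \<omega> (e \<otimes> (w \<otimes> h))) \<longrightarrow>
            (\<exists>e\<in>E <#> R. \<sigma>' \<omega> (e \<otimes> h)) \<and>
            (\<exists>t\<in>D <#> R. \<not> \<sigma>' \<omega> (t \<otimes> h) \<and> \<not> \<sigma>' \<omega> (t \<otimes> \<gamma> \<otimes> h) \<and>
               x' \<omega> (t \<otimes> h) \<noteq> x' \<omega> (t \<otimes> \<gamma> \<otimes> h))))"
    proof (rule exI[of _ x'], rule exI[of _ \<sigma>'], intro conjI allI ballI impI)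
      show "block_map x'" "block_map \<sigma>'" by fact+
      show "\<sigma> \<omega> g" if "\<sigma>' \<omega> g" for \<omega> g using that by (simp add: \<sigma>'_def)
      show "x' \<omega> g = x \<omega> g" if "g \<in> carrier G" "\<not> \<sigma> \<omega> g" for \<omega> g
        by (rule x'_out) (use that in \<open>auto simp: age_def \<sigma>'_def\<close>)

      \<comment> \<open>Verification at a coloured site\<close>
      fix \<omega> h
      assume h: "h \<in> carrier G" "c \<omega> h \<noteq> 0" and rich: "\<forall>w\<in>W. \<exists>e\<in>E. \<sigma> \<omega> (e \<otimes> (w \<otimes> h))"
      have "c \<omega> h \<in> {1..K}" using h col by (auto simp: Suc_le_eq)
      then obtain t where t: "t \<in> R" "M \<omega> (t \<otimes> h)" using Mdense[OF h(1)] by blast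
      have tc: "t \<in> carrier G" using t Rc by auto
      define m where "m = t \<otimes> h"
      have m: "m \<in> carrier G" "M \<omega> m" using t tc h by (auto simp: m_def)
      define k where "k = c \<omega> m"
      have k: "k \<in> {1..K}" using Mc[OF m] by (simp add: k_def)
      show "\<exists>e\<in>E <#> R. \<sigma>' \<omega> (e \<otimes> h)"
      proof -
        have "t \<in> W" using t by (simp add: W_def)
        then obtain e where e: "e \<in> E" "\<sigma> \<omega> (e \<otimes> m)" using rich by (auto simp: m_def)
        have ec: "e \<in> carrier G" using e E by auto
        then have "\<sigma>' \<omega> (e \<otimes> m)"
          using e m unfolding \<sigma>'_def by (intro conjI bexI[of _ e]) auto
        then have "\<sigma>' \<omega> ((e \<otimes> t) \<otimes> h)" using ec tc h by (simp add: m_def m_assoc)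
        then show ?thesis using set_multI[OF e(1) t(1)] by blast
      qed
      define \<delta> where "\<delta> = t \<otimes> \<gamma> \<otimes> inv t"
      have \<delta>: "\<delta> \<in> \<Delta>" "\<delta> \<in> carrier G" using t tc \<gamma> by (auto simp: \<delta>_def \<Delta>_def)
      have conclude: "\<exists>t\<in>D <#> R. \<not> \<sigma>' \<omega> (t \<otimes> h) \<and> \<not> \<sigma>' \<omega> (t \<otimes> \<gamma> \<otimes> h) \<and>
               x' \<omega> (t \<otimes> h) \<noteq> x' \<omega> (t \<otimes> \<gamma> \<otimes> h)"
        if f: "f \<in> D" and ages: "age \<omega> (f \<otimes> m) \<le> K" "age \<omega> (f \<otimes> \<delta> \<otimes> m) \<le> K"
          and ne: "x' \<omega> (f \<otimes> m) \<noteq> x' \<omega> (f \<otimes> \<delta> \<otimes> m)" for f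
      proof -
        have fc: "f \<in> carrier G" using f D by auto
        have eqs: "f \<otimes> t \<otimes> h = f \<otimes> m" "f \<otimes> t \<otimes> \<gamma> \<otimes> h = f \<otimes> \<delta> \<otimes> m"
          using fc tc h \<gamma> by (auto simp: m_def \<delta>_def m_assoc)
        \<comment> \<open>Sites of \<open>\<sigma>'\<close> have age \<open>Suc K\<close>, so
          comparisons settled by time \<open>K\<close> take place at frozen sites.\<close>
        have "\<not> \<sigma>' \<omega> g" if "age \<omega> g \<le> K" for g using that by (auto simp: age_def)
        then show ?thesis
          using ages ne f t by (intro bexI[of _ "f \<otimes> t"]) (auto simp: eqs intro: set_multI)
      qed
      define S where "S = {f\<in>D. \<sigma> \<omega> (f \<otimes> m)}"
      \<comment> \<open>Comparisons lost because the moved site is reserved. By \<open>sep\<close>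
        all these sites lie in the reserve of a single marker, hence at most \<open>e\<close> are
        lost.\<close>
      define N where "N = {f\<in>S. \<sigma>' \<omega> (f \<otimes> \<delta> \<otimes> m)}"
      have SD: "S \<subseteq> D" "finite S" using D by (auto simp: S_def)
      have "6 * r + e \<le> card S"
        unfolding S_def
      proof (rule DL[rule_format, OF m(1)])
        fix a assume a: "a \<in> L"
        then have "a \<otimes> t \<in> W" using t by (auto simp: W_def intro: set_multI)
        then have "\<exists>e\<in>E. \<sigma> \<omega> (e \<otimes> (a \<otimes> t \<otimes> h))" using rich by blast
        then show "\<exists>e\<in>E. \<sigma> \<omega> (e \<otimes> (a \<otimes> m))" using a L tc h by (auto simp: m_def m_assoc subset_iff)
      qed
      moreover have "card N \<le> e"
      proof -
        have "\<exists>b m2. b \<in> E \<and> m2 \<in> carrier G \<and> M \<omega> m2 \<and> f \<otimes> \<delta> \<otimes> m = b \<otimes> m2" if f: "f \<in> N" for f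
        proof -
          obtain b where b: "b \<in> E" "M \<omega> (inv b \<otimes> (f \<otimes> \<delta> \<otimes> m))"
            using f by (auto simp: N_def \<sigma>'_def)
          have "b \<in> carrier G" "f \<in> carrier G" using b E f D by (auto simp: N_def S_def)
          then show ?thesis
            using b \<delta> m by (intro exI[of _ b] exI[of _ "inv b \<otimes> (f \<otimes> \<delta> \<otimes> m)"]) auto
        qed
        then obtain b m2 where bm: "\<And>f. f \<in> N \<Longrightarrow> b f \<in> E \<and> m2 f \<in> carrier G \<and> M \<omega> (m2 f) \<and>
            f \<otimes> \<delta> \<otimes> m = b f \<otimes> m2 f"
          by metis
        have "inj_on b N"
        proof (rule inj_onI)
          fix f f' assume f: "f \<in> N" "f' \<in> N" "b f = b f'"
          have fD: "f \<in> D" "f' \<in> D" using f by (auto simp: N_def S_def)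
          then have fc: "f \<in> carrier G" "f' \<in> carrier G" using D by auto
          have "m2 f = m2 f'"
            by (rule sep[of _ \<omega> _ "b f" f f' "b f'" "\<delta> \<otimes> m"])
              (use bm[OF f(1)] bm[OF f(2)] fD fc C \<delta> m in \<open>auto simp: m_assoc\<close>)
          then have "f \<otimes> (\<delta> \<otimes> m) = f' \<otimes> (\<delta> \<otimes> m)"
            using bm[OF f(1)] bm[OF f(2)] f(3) fc \<delta> m by (simp add: m_assoc)
          then show "f = f'" using fc \<delta> m by simp
        qed
        then show ?thesis
          unfolding e_def using bm E by (intro card_inj_on_le[of b]) auto
      qed
      moreover have "card (S - N) = card S - card N"
        using SD by (intro card_Diff_subset) (auto simp: N_def intro: finite_subset)
      ultimately have big: "6 * r \<le> card (S - N)" by linarith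
      \<comment> \<open>Each of these comparisons is settled either by \<open>m\<close> itself or by the unique other marker
        whose block meets \<open>D \<delta> m\<close>, whichever has the larger colour.\<close>
      define S1 where "S1 = {f\<in>S - N. age \<omega> (f \<otimes> \<delta> \<otimes> m) \<le> k}"
      define S2 where "S2 = {f\<in>S - N. k < age \<omega> (f \<otimes> \<delta> \<otimes> m)}"
      have "card (S - N) \<le> card S1 + card S2"
      proof -
        have "S - N = S1 \<union> S2" by (auto simp: S1_def S2_def)
        then show ?thesis using card_Un_le[of S1 S2] by simp
      qed
      then consider (one) "3 * r \<le> card S1" | (two) "3 * r \<le> card S2" using big by linarith
      then show "\<exists>t\<in>D <#> R. \<not> \<sigma>' \<omega> (t \<otimes> h) \<and> \<not> \<sigma>' \<omega> (t \<otimes> \<gamma> \<otimes> h) \<and>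
               x' \<omega> (t \<otimes> h) \<noteq> x' \<omega> (t \<otimes> \<gamma> \<otimes> h)"
      proof cases
        case one
        let ?comp = "comparisons D k (\<lambda>v. age \<omega> (v \<otimes> m)) \<one> \<delta>"
        have "S1 \<subseteq> ?comp"
        proof
          fix f assume f: "f \<in> S1"
          then have fD: "f \<in> D" "\<sigma> \<omega> (f \<otimes> m)" "\<not> \<sigma>' \<omega> (f \<otimes> \<delta> \<otimes> m)"
            "age \<omega> (f \<otimes> \<delta> \<otimes> m) \<le> k"
            by (auto simp: S1_def S_def N_def)
          have fc: "f \<in> carrier G" using fD D by auto
          have "age \<omega> (f \<otimes> m) = k" using slot_age[OF m fD(1,2)] by (simp add: k_def)
          \<comment> \<open>A moved site frozen at exactly time \<open>k\<close> lies in a block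
            whose marker has the colour of \<open>m\<close>. Properness along \<open>B\<close> makes
            that marker \<open>m\<close>, so \<open>m\<close> fills this site too and controls both
            ends of the comparison.\<close>
          moreover have "f \<otimes> \<delta> \<in> D" if eq: "age \<omega> (f \<otimes> \<delta> \<otimes> m) = k"
          proof -
            obtain d m2 where d: "d \<in> D" "m2 \<in> carrier G" "M \<omega> m2" "f \<otimes> \<delta> \<otimes> m = d \<otimes> m2"
              "age \<omega> (f \<otimes> \<delta> \<otimes> m) = c \<omega> m2"
              using age_cases[of "f \<otimes> \<delta> \<otimes> m" \<omega>] eq k fc \<delta> m fD(3) by auto
            have dc: "d \<in> carrier G" using d D by auto
            have "inv d \<otimes> (f \<otimes> \<delta> \<otimes> m) = m2" unfolding d(4) using dc d(2) by simp
            then have m2: "inv d \<otimes> f \<otimes> \<delta> \<otimes> m = m2" using dc fc \<delta> m by (simp add: m_assoc)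
            have "inv d \<otimes> f \<otimes> \<delta> \<in> B"
              unfolding B_def Di_def using d fD \<delta> by (auto intro!: set_multI)
            then have "inv d \<otimes> f \<otimes> \<delta> = \<one>"
              using proper_colouringD[OF prB[of \<omega>] m(1)] m2 d(5) eq k by (auto simp: k_def)
            then have "m2 = m" using m2 m by simp
            then have "f \<otimes> \<delta> = d" using d(4) dc fc \<delta> m by simp
            then show ?thesis using d by simp
          qed
          ultimately show "f \<in> ?comp"
            using fD fc by (auto simp: comparisons_def Let_def)
        qed
        then have "3 * r \<le> card ?comp"
          using one card_mono[of ?comp S1] D by (auto simp: comparisons_def)
        moreover have "(\<one>, \<delta>) \<in> I"
          unfolding I_def using \<delta> by (intro image_eqI[of _ _ "(\<one>, \<delta>)"]) (auto simp: U_def)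
        ultimately obtain f where f: "f \<in> ?comp"
          "x' \<omega> (f \<otimes> \<one> \<otimes> m) \<noteq> x' \<omega> (f \<otimes> \<delta> \<otimes> m)"
          using x'_in[OF m k] by blast
        have fc: "f \<in> D" "f \<in> carrier G" using f D by (auto simp: comparisons_def)
        show ?thesis
          by (rule conclude[OF fc(1)])
            (use f fc k in \<open>auto simp: comparisons_def Let_def split: if_splits\<close>)
      next
        case two
        then obtain f0 where "f0 \<in> S2" using r0 by (cases "S2 = {}") auto
        then have f0: "f0 \<in> D" "\<not> \<sigma>' \<omega> (f0 \<otimes> \<delta> \<otimes> m)" "k < age \<omega> (f0 \<otimes> \<delta> \<otimes> m)"
          by (auto simp: S2_def S_def N_def)
        have f0c: "f0 \<in> carrier G" using f0 D by auto
        \<comment> \<open>A single \<open>f0\<close> determines the other marker: by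
          \<open>sep\<close> it is the same for all elements of \<open>S2\<close>.\<close>
        obtain d m2 where d: "d \<in> D" and m2: "m2 \<in> carrier G" "M \<omega> m2"
          and f0d: "f0 \<otimes> \<delta> \<otimes> m = d \<otimes> m2"
          using age_cases[of "f0 \<otimes> \<delta> \<otimes> m" \<omega>] f0 f0c \<delta> m by auto
        have dc: "d \<in> carrier G" using d D by auto
        \<comment> \<open>Seen from \<open>m2\<close>, the translates at \<open>m\<close> and
          \<open>\<delta> \<otimes> m\<close> are those at \<open>u\<close> and
          \<open>\<delta> \<otimes> u\<close>. The comparisons are charged to \<open>m2\<close>
          because its colour exceeds \<open>k\<close>.\<close>
        define u where "u = inv \<delta> \<otimes> inv f0 \<otimes> d"
        have uU: "u \<in> U"
          unfolding U_def u_def Di_def using \<delta> f0 d by (auto intro!: set_multI)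
        have uc: "u \<in> carrier G" using uU Uc by auto
        have um: "u \<otimes> m2 = m"
        proof -
          have "u \<otimes> m2 = inv \<delta> \<otimes> (inv f0 \<otimes> (d \<otimes> m2))"
            unfolding u_def using \<delta> f0c dc m2 by (simp add: m_assoc)
          also have "\<dots> = m" unfolding f0d[symmetric] using \<delta> f0c m by (simp add: m_assoc)
          finally show ?thesis .
        qed
        define l where "l = c \<omega> m2"
        have l: "l \<in> {1..K}" using Mc[OF m2] by (simp add: l_def)
        let ?comp = "comparisons D l (\<lambda>v. age \<omega> (v \<otimes> m2)) u (\<delta> \<otimes> u)"
        have sites: "f \<otimes> u \<otimes> m2 = f \<otimes> m" "f \<otimes> (\<delta> \<otimes> u) \<otimes> m2 = f \<otimes> \<delta> \<otimes> m"
          if "f \<in> carrier G" for f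
          using that um[symmetric] uc m2 \<delta> by (auto simp: m_assoc)
        have "S2 \<subseteq> ?comp"
        proof
          fix f assume f: "f \<in> S2"
          then have fD: "f \<in> D" "\<sigma> \<omega> (f \<otimes> m)" "\<not> \<sigma>' \<omega> (f \<otimes> \<delta> \<otimes> m)"
            "k < age \<omega> (f \<otimes> \<delta> \<otimes> m)"
            by (auto simp: S2_def S_def N_def)
          have fc: "f \<in> carrier G" using fD D by auto
          have agef: "age \<omega> (f \<otimes> m) = k" using slot_age[OF m fD(1,2)] by (simp add: k_def)
          obtain d' m2' where d': "d' \<in> D" "m2' \<in> carrier G" "M \<omega> m2'" "f \<otimes> \<delta> \<otimes> m = d' \<otimes> m2'"
              "age \<omega> (f \<otimes> \<delta> \<otimes> m) = c \<omega> m2'"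
            using age_cases[of "f \<otimes> \<delta> \<otimes> m" \<omega>] fD fc \<delta> m by auto
          have d'c: "d' \<in> carrier G" using d' D by auto
          have "m2' = m2"
            by (rule sep[of _ \<omega> _ d' f f0 d "\<delta> \<otimes> m"])
              (use d' m2 fD f0 d C f0d \<delta> m fc f0c in \<open>auto simp: m_assoc\<close>)
          moreover from this have "f \<otimes> (\<delta> \<otimes> u) = d'"
            using d'(4) sites(2)[OF fc] d'c fc \<delta> uc m2 by (metis m_closed right_cancel)
          ultimately show "f \<in> ?comp"
            using fD d' agef sites[OF fc] unfolding comparisons_def Let_def l_def by auto
        qed
        then have "3 * r \<le> card ?comp"
          using two card_mono[of ?comp S2] D by (auto simp: comparisons_def)
        moreover have "(u, \<delta> \<otimes> u) \<in> I" using uU \<delta> by (auto simp: I_def)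
        ultimately obtain f where f: "f \<in> ?comp"
          "x' \<omega> (f \<otimes> u \<otimes> m2) \<noteq> x' \<omega> (f \<otimes> (\<delta> \<otimes> u) \<otimes> m2)"
          using x'_in[OF m2 l] by blast
        have fc: "f \<in> D" "f \<in> carrier G" using f D by (auto simp: comparisons_def)
        show ?thesis
          by (rule conclude[OF fc(1)])
            (use f sites[OF fc(2)] l in \<open>auto simp: comparisons_def Let_def\<close>)
      qed
    qed
  qed
qed


section \<open>Iterating the stages\<close>

text \<open>Stage 0: \<open>p\<close> is copied onto \<open>F m\<close> for separated markers
  \<open>m\<close>, and one more site \<open>a m\<close> with \<open>a\<close> outside
  \<open>F\<close> is kept free. Later stages thus find free sites near every coloured point without
  disturbing the planted patterns.\<close>

lemma exists_pattern_markers: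
  fixes p :: "'a \<Rightarrow> bool"
  assumes inf: "infinite (carrier G)" and F: "finite F" "F \<subseteq> carrier G"
  shows "\<exists>T E B. finite T \<and> T \<subseteq> carrier G \<and> finite E \<and> E \<subseteq> carrier G \<and> E \<noteq> {} \<and>
    finite B \<and> B \<subseteq> carrier G \<and>
    (\<forall>K (c :: ('a \<Rightarrow> 'i) \<Rightarrow> 'a \<Rightarrow> nat). block_map c \<longrightarrow>
      (\<forall>\<omega>. proper_colouring B (c \<omega>) \<and> (\<forall>g\<in>carrier G. c \<omega> g \<le> K)) \<longrightarrow>
      (\<exists>x \<sigma>. block_map x \<and> block_map \<sigma> \<and> (\<forall>\<omega>. \<forall>h\<in>carrier G. c \<omega> h \<noteq> 0 \<longrightarrow>
         (\<exists>e\<in>E. \<sigma> \<omega> (e \<otimes> h)) \<and>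
         (\<exists>t\<in>T. \<forall>f\<in>F. \<not> \<sigma> \<omega> (f \<otimes> t \<otimes> h) \<and> x \<omega> (f \<otimes> t \<otimes> h) = p f))))"
proof -
  obtain a where a: "a \<in> carrier G" "a \<notin> F"
    using inf F by (meson finite_subset subsetI)
  define C where "C = insert a F"
  define R where "R = (m_inv G ` C) <#> C"
  have C: "finite C" "C \<subseteq> carrier G" using a F by (auto simp: C_def)
  have R: "finite R" "R \<subseteq> carrier G"
    unfolding R_def by (intro finite_set_mult set_mult_closed inv_image_closed finite_imageI C)+
  have in_R: "inv b \<otimes> d \<in> R" if "b \<in> C" "d \<in> C" for b d
    unfolding R_def using that by (intro set_multI imageI)
  have R1: "\<one> \<in> R" using in_R[of a a] a by (simp add: C_def)
  have R_inv: "m_inv G ` R \<subseteq> R"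
  proof
    fix s assume "s \<in> m_inv G ` R"
    then obtain b d where "b \<in> C" "d \<in> C" and s: "s = inv (inv b \<otimes> d)"
      unfolding R_def set_mult_def by blast
    then have "s = inv d \<otimes> b" using C by (simp add: subset_iff inv_mult_group)
    then show "s \<in> R" using in_R \<open>b \<in> C\<close> \<open>d \<in> C\<close> by simp
  qed
  show ?thesis
  proof (rule exI[of _ R], rule exI[of _ "{a} <#> R"], rule exI[of _ R], intro conjI allI impI)
    show "finite ({a} <#> R)" "{a} <#> R \<subseteq> carrier G"
      using a R by (auto intro!: finite_set_mult dest!: subsetD[OF set_mult_closed, rotated -1])
    show "{a} <#> R \<noteq> {}" using R1 by (auto simp: set_mult_def)
    fix K and c :: "('a \<Rightarrow> 'i) \<Rightarrow> 'a \<Rightarrow> nat"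
    assume c: "block_map c"
      and col: "\<forall>\<omega>. proper_colouring R (c \<omega>) \<and> (\<forall>g\<in>carrier G. c \<omega> g \<le> K)"
    then have prR: "\<And>\<omega>. proper_colouring R (c \<omega>)" by blast
    obtain M where M: "block_map M"
      and Msep: "\<And>\<omega> m s. m \<in> carrier G \<Longrightarrow> s \<in> R \<Longrightarrow> M \<omega> m \<Longrightarrow> M \<omega> (s \<otimes> m) \<Longrightarrow> s = \<one>"
      and Mdense: "\<And>\<omega> m. m \<in> carrier G \<Longrightarrow> c \<omega> m \<in> {1..K} \<Longrightarrow> \<exists>s\<in>R. M \<omega> (s \<otimes> m)"
      using exists_markers[OF R R1 R_inv c prR, of K] by metis
    define x where "x \<omega> g \<longleftrightarrow> (\<exists>f\<in>F. p f \<and> M \<omega> (inv f \<otimes> g))" for \<omega> g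
    define \<sigma> where "\<sigma> \<omega> g \<longleftrightarrow> M \<omega> (inv a \<otimes> g)" for \<omega> g
    have V: "finite (m_inv G ` F)" "m_inv G ` F \<subseteq> carrier G"
      "finite {inv a}" "{inv a} \<subseteq> carrier G" using F a by auto
    show "\<exists>x \<sigma>. block_map x \<and> block_map \<sigma> \<and> (\<forall>\<omega>. \<forall>h\<in>carrier G. c \<omega> h \<noteq> 0 \<longrightarrow>
         (\<exists>e\<in>{a} <#> R. \<sigma> \<omega> (e \<otimes> h)) \<and>
         (\<exists>t\<in>R. \<forall>f\<in>F. \<not> \<sigma> \<omega> (f \<otimes> t \<otimes> h) \<and> x \<omega> (f \<otimes> t \<otimes> h) = p f))"
    proof (rule exI[of _ x], rule exI[of _ \<sigma>], intro conjI allI ballI impI)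
      show "block_map x"
        by (rule block_map_via[OF M V(1,2)]) (auto simp: x_def)
      show "block_map \<sigma>"
        by (rule block_map_via[OF M V(3,4)]) (auto simp: \<sigma>_def)
      fix \<omega> h assume h: "h \<in> carrier G" "c \<omega> h \<noteq> 0"
      then have "c \<omega> h \<in> {1..K}" using col by (auto simp: Suc_le_eq)
      then obtain t where t: "t \<in> R" "M \<omega> (t \<otimes> h)" using Mdense[OF h(1)] by blast
      have tc: "t \<in> carrier G" using t R by auto
      have uniq: "b = f" if "b \<in> C" "f \<in> C" "M \<omega> (inv b \<otimes> (f \<otimes> (t \<otimes> h)))" for b f
      proof -
        have bf: "b \<in> carrier G" "f \<in> carrier G" using that C by auto
        have "inv b \<otimes> f = \<one>"
          by (rule Msep[of "t \<otimes> h" _ \<omega>]) (use that in_R t tc h bf in \<open>auto simp: m_assoc\<close>)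
        then have "b \<otimes> (inv b \<otimes> f) = b" using bf by simp
        then show ?thesis using bf by simp
      qed
      have "\<sigma> \<omega> (a \<otimes> t \<otimes> h)" using a t tc h by (simp add: \<sigma>_def m_assoc)
      then show "\<exists>e\<in>{a} <#> R. \<sigma> \<omega> (e \<otimes> h)" using set_multI[of a "{a}" t R] t by blast
      show "\<exists>t\<in>R. \<forall>f\<in>F. \<not> \<sigma> \<omega> (f \<otimes> t \<otimes> h) \<and> x \<omega> (f \<otimes> t \<otimes> h) = p f"
      proof (intro bexI[of _ t] ballI conjI)
        fix f assume f: "f \<in> F"
        then have fc: "f \<in> carrier G" "f \<in> C" using F by (auto simp: C_def)
        have as: "f \<otimes> t \<otimes> h = f \<otimes> (t \<otimes> h)" using fc tc h by (simp add: m_assoc)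
        show "\<not> \<sigma> \<omega> (f \<otimes> t \<otimes> h)"
          using uniq[of a f] fc f a by (auto simp: \<sigma>_def as C_def)
        have "inv f \<otimes> (f \<otimes> (t \<otimes> h)) = t \<otimes> h" using fc tc h by simp
        then show "x \<omega> (f \<otimes> t \<otimes> h) = p f"
          using uniq[of _ f] fc f t unfolding x_def as by (metis C_def insertCI)
      qed (use t in auto)
    qed
  qed (use R in auto)
qed

text \<open>The conclusion of \<open>exists_aperiodic_refinement\<close> for labels in
  \<open>nat\<close>, named so that its witnesses can be chosen once per stage and the reserve
  \<open>E'\<close> of one stage passed on as the \<open>E\<close> of the next.\<close>

definition aperiodic_refinement where
  "aperiodic_refinement \<gamma> E T E' B W \<longleftrightarrow> finite T \<and> T \<subseteq> carrier G \<and> finite E' \<and> E' \<subseteq> carrier G \<and>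
    E' \<noteq> {} \<and> finite B \<and> B \<subseteq> carrier G \<and> finite W \<and> W \<subseteq> carrier G \<and>
    (\<forall>K (c :: ('a \<Rightarrow> nat) \<Rightarrow> 'a \<Rightarrow> nat)
      (x :: ('a \<Rightarrow> nat) \<Rightarrow> 'a \<Rightarrow> bool) (\<sigma> :: ('a \<Rightarrow> nat) \<Rightarrow> 'a \<Rightarrow> bool).
      block_map c \<longrightarrow> block_map x \<longrightarrow> block_map \<sigma> \<longrightarrow>
      (\<forall>\<omega>. proper_colouring B (c \<omega>) \<and> (\<forall>g\<in>carrier G. c \<omega> g \<le> K)) \<longrightarrow>
      (\<exists>x' \<sigma>'. block_map x' \<and> block_map \<sigma>' \<and> (\<forall>\<omega>. 
         (\<forall>g\<in>carrier G. \<sigma>' \<omega> g \<longrightarrow> \<sigma> \<omega> g) \<and>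
         (\<forall>g\<in>carrier G. \<not> \<sigma> \<omega> g \<longrightarrow> x' \<omega> g = x \<omega> g) \<and>
         (\<forall>h\<in>carrier G. c \<omega> h \<noteq> 0 \<longrightarrow> (\<forall>w\<in>W. \<exists>e\<in>E. \<sigma> \<omega> (e \<otimes> (w \<otimes> h))) \<longrightarrow>
            (\<exists>e\<in>E'. \<sigma>' \<omega> (e \<otimes> h)) \<and>
            (\<exists>t\<in>T. \<not> \<sigma>' \<omega> (t \<otimes> h) \<and> \<not> \<sigma>' \<omega> (t \<otimes> \<gamma> \<otimes> h) \<and>
               x' \<omega> (t \<otimes> h) \<noteq> x' \<omega> (t \<otimes> \<gamma> \<otimes> h))))))"

text \<open>The reserves \<open>E j\<close>, and with them the \<open>T j\<close>, come from one
  recursion that involves neither \<open>N\<close> nor a colouring; only \<open>B\<close> and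
  \<open>W\<close> accumulate over the first \<open>N\<close> stages.\<close>

lemma exists_avoiding_block_maps:
  fixes p :: "'a \<Rightarrow> bool"
  assumes inf: "infinite (carrier G)" and F: "finite F" "F \<subseteq> carrier G"
    and \<gamma>: "\<And>j::nat. \<gamma> j \<in> carrier G" "\<And>j. \<gamma> j \<noteq> \<one>"
  shows "\<exists>T0 T. finite T0 \<and> T0 \<subseteq> carrier G \<and> (\<forall>j. finite (T j) \<and> T j \<subseteq> carrier G) \<and>
    (\<forall>N. \<exists>B W. finite B \<and> B \<subseteq> carrier G \<and> finite W \<and> W \<subseteq> carrier G \<and>
      (\<forall>K (c :: ('a \<Rightarrow> nat) \<Rightarrow> 'a \<Rightarrow> nat). block_map c \<longrightarrow>
        (\<forall>\<omega>. proper_colouring B (c \<omega>) \<and> (\<forall>g\<in>carrier G. c \<omega> g \<le> K)) \<longrightarrow>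
        (\<exists>x. block_map x \<and> (\<forall>\<omega>. \<forall>h\<in>carrier G. (\<forall>w\<in>W. c \<omega> (w \<otimes> h) \<noteq> 0) \<longrightarrow>
          (\<exists>t\<in>T0. \<forall>f\<in>F. x \<omega> (f \<otimes> t \<otimes> h) = p f) \<and>
          (\<forall>j<N. \<exists>t\<in>T j. x \<omega> (t \<otimes> h) \<noteq> x \<omega> (t \<otimes> \<gamma> j \<otimes> h))))))"
proof -
  obtain T0 E0 B0 where T0: "finite T0" "T0 \<subseteq> carrier G"
    and E0: "finite E0" "E0 \<subseteq> carrier G" "E0 \<noteq> {}" and B0: "finite B0" "B0 \<subseteq> carrier G"
    and start: "\<forall>K (c :: ('a \<Rightarrow> nat) \<Rightarrow> 'a \<Rightarrow> nat). block_map c \<longrightarrow>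
      (\<forall>\<omega>. proper_colouring B0 (c \<omega>) \<and> (\<forall>g\<in>carrier G. c \<omega> g \<le> K)) \<longrightarrow>
      (\<exists>x \<sigma>. block_map x \<and> block_map \<sigma> \<and> (\<forall>\<omega>. \<forall>h\<in>carrier G. c \<omega> h \<noteq> 0 \<longrightarrow>
         (\<exists>e\<in>E0. \<sigma> \<omega> (e \<otimes> h)) \<and>
         (\<exists>t\<in>T0. \<forall>f\<in>F. \<not> \<sigma> \<omega> (f \<otimes> t \<otimes> h) \<and> x \<omega> (f \<otimes> t \<otimes> h) = p f)))"
    using exists_pattern_markers[OF inf F, of p] by (elim exE conjE) (rule that; assumption)
  define good where "good j E z \<longleftrightarrow> aperiodic_refinement (\<gamma> j) E (fst z) (fst (snd z))
    (fst (snd (snd z))) (snd (snd (snd z)))" for j E z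
  define Z where "Z j E = (SOME z. good j E z)" for j E
  define TT where "TT j E = fst (Z j E)" for j E
  define EE where "EE j E = fst (snd (Z j E))" for j E
  define BB where "BB j E = fst (snd (snd (Z j E)))" for j E
  define WW where "WW j E = snd (snd (snd (Z j E)))" for j E
  have step: "aperiodic_refinement (\<gamma> j) E (TT j E) (EE j E) (BB j E) (WW j E)"
    if "finite E \<and> E \<subseteq> carrier G \<and> E \<noteq> {}" for j E
  proof -
    have "\<exists>T E' B W. aperiodic_refinement (\<gamma> j) E T E' B W"
      unfolding aperiodic_refinement_def
      by (rule exists_aperiodic_refinement) (use that inf \<gamma> in auto)
    then obtain T E' B W where "good j E (T, E', B, W)" by (auto simp: good_def)
    then have "good j E (Z j E)" unfolding Z_def by (rule someI)
    then show ?thesis by (simp add: good_def TT_def EE_def BB_def WW_def)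
  qed
  define E where "E = rec_nat E0 EE"
  have E_simps [simp]: "E 0 = E0" "\<And>j. E (Suc j) = EE j (E j)" by (simp_all add: E_def)
  have E: "finite (E j) \<and> E j \<subseteq> carrier G \<and> E j \<noteq> {}" for j
  proof (induction j)
    case 0
    then show ?case using E0 by simp
  next
    case (Suc j)
    from step[OF this, of j] show ?case by (simp add: aperiodic_refinement_def)
  qed
  define T where "T j = TT j (E j)" for j
  have TE: "aperiodic_refinement (\<gamma> j) (E j) (T j) (E (Suc j)) (BB j (E j)) (WW j (E j))" for j
    using step[OF E[of j], of j] by (simp add: T_def)
  \<comment> \<open>The induction carries more than the claim: a reserve near \<open>h\<close>, and
    the fact that every site used so far is frozen.\<close>
  have main: "\<exists>B W. finite B \<and> B \<subseteq> carrier G \<and> finite W \<and> W \<subseteq> carrier G \<and>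
      (\<forall>K (c :: ('a \<Rightarrow> nat) \<Rightarrow> 'a \<Rightarrow> nat). block_map c \<longrightarrow>
        (\<forall>\<omega>. proper_colouring B (c \<omega>) \<and> (\<forall>g\<in>carrier G. c \<omega> g \<le> K)) \<longrightarrow>
        (\<exists>x \<sigma>. block_map x \<and> block_map \<sigma> \<and> (\<forall>\<omega>. \<forall>h\<in>carrier G. (\<forall>w\<in>W. c \<omega> (w \<otimes> h) \<noteq> 0) \<longrightarrow>
          (\<exists>e\<in>E N. \<sigma> \<omega> (e \<otimes> h)) \<and>
          (\<exists>t\<in>T0. \<forall>f\<in>F. \<not> \<sigma> \<omega> (f \<otimes> t \<otimes> h) \<and> x \<omega> (f \<otimes> t \<otimes> h) = p f) \<and>
          (\<forall>j<N. \<exists>t\<in>T j. \<not> \<sigma> \<omega> (t \<otimes> h) \<and> \<not> \<sigma> \<omega> (t \<otimes> \<gamma> j \<otimes> h) \<and>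
             x \<omega> (t \<otimes> h) \<noteq> x \<omega> (t \<otimes> \<gamma> j \<otimes> h)))))" for N
  proof (induction N)
    case 0
    show ?case
      by (rule exI[of _ B0], rule exI[of _ "{\<one>}"]) (use start B0 in simp)
  next
    case (Suc N)
    then obtain B W where B: "finite B" "B \<subseteq> carrier G" and W: "finite W" "W \<subseteq> carrier G"
      and IH: "\<forall>K (c :: ('a \<Rightarrow> nat) \<Rightarrow> 'a \<Rightarrow> nat). block_map c \<longrightarrow>
        (\<forall>\<omega>. proper_colouring B (c \<omega>) \<and> (\<forall>g\<in>carrier G. c \<omega> g \<le> K)) \<longrightarrow>
        (\<exists>x \<sigma>. block_map x \<and> block_map \<sigma> \<and> (\<forall>\<omega>. \<forall>h\<in>carrier G. (\<forall>w\<in>W. c \<omega> (w \<otimes> h) \<noteq> 0) \<longrightarrow>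
          (\<exists>e\<in>E N. \<sigma> \<omega> (e \<otimes> h)) \<and>
          (\<exists>t\<in>T0. \<forall>f\<in>F. \<not> \<sigma> \<omega> (f \<otimes> t \<otimes> h) \<and> x \<omega> (f \<otimes> t \<otimes> h) = p f) \<and>
          (\<forall>j<N. \<exists>t\<in>T j. \<not> \<sigma> \<omega> (t \<otimes> h) \<and> \<not> \<sigma> \<omega> (t \<otimes> \<gamma> j \<otimes> h) \<and>
             x \<omega> (t \<otimes> h) \<noteq> x \<omega> (t \<otimes> \<gamma> j \<otimes> h))))"
      by (elim exE conjE) (rule that; assumption)
    define B1 where "B1 = BB N (E N)"
    define W1 where "W1 = WW N (E N)"
    note TEN = TE[of N, unfolded aperiodic_refinement_def, folded B1_def W1_def]
    have B1: "finite B1" "B1 \<subseteq> carrier G" and W1: "finite W1" "W1 \<subseteq> carrier G"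
      and refine: "\<forall>K (c :: ('a \<Rightarrow> nat) \<Rightarrow> 'a \<Rightarrow> nat)
      (x :: ('a \<Rightarrow> nat) \<Rightarrow> 'a \<Rightarrow> bool) (\<sigma> :: ('a \<Rightarrow> nat) \<Rightarrow> 'a \<Rightarrow> bool).
      block_map c \<longrightarrow> block_map x \<longrightarrow> block_map \<sigma> \<longrightarrow>
      (\<forall>\<omega>. proper_colouring B1 (c \<omega>) \<and> (\<forall>g\<in>carrier G. c \<omega> g \<le> K)) \<longrightarrow>
      (\<exists>x' \<sigma>'. block_map x' \<and> block_map \<sigma>' \<and> (\<forall>\<omega>. 
         (\<forall>g\<in>carrier G. \<sigma>' \<omega> g \<longrightarrow> \<sigma> \<omega> g) \<and>
         (\<forall>g\<in>carrier G. \<not> \<sigma> \<omega> g \<longrightarrow> x' \<omega> g = x \<omega> g) \<and>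
         (\<forall>h\<in>carrier G. c \<omega> h \<noteq> 0 \<longrightarrow> (\<forall>w\<in>W1. \<exists>e\<in>E N. \<sigma> \<omega> (e \<otimes> (w \<otimes> h))) \<longrightarrow>
            (\<exists>e\<in>E (Suc N). \<sigma>' \<omega> (e \<otimes> h)) \<and>
            (\<exists>t\<in>T N. \<not> \<sigma>' \<omega> (t \<otimes> h) \<and> \<not> \<sigma>' \<omega> (t \<otimes> \<gamma> N \<otimes> h) \<and>
               x' \<omega> (t \<otimes> h) \<noteq> x' \<omega> (t \<otimes> \<gamma> N \<otimes> h)))))"
      using TEN by - (elim conjE, assumption)+
    have TT: "T j \<subseteq> carrier G" for j using TE[of j] by (simp add: aperiodic_refinement_def)
    show ?case
    \<comment> \<open>The new stage needs a colour at \<open>h\<close>, hence \<open>\<one>\<close>,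
      and reserves near all \<open>w \<otimes> h\<close> with \<open>w\<close> in \<open>W1\<close>.
      The old stages supply those when the colours are nonzero on \<open>W w h\<close>.\<close>
    proof (rule exI[of _ "B \<union> B1"], rule exI[of _ "insert \<one> (W \<union> (W <#> W1))"], intro conjI allI impI)
      show "finite (B \<union> B1)" "B \<union> B1 \<subseteq> carrier G" using B B1 by auto
      show "finite (insert \<one> (W \<union> (W <#> W1)))" "insert \<one> (W \<union> (W <#> W1)) \<subseteq> carrier G"
        using W W1 set_mult_closed[OF W(2) W1(2)] by (auto intro!: finite_set_mult)
      fix K and c :: "('a \<Rightarrow> nat) \<Rightarrow> 'a \<Rightarrow> nat"
      assume c: "block_map c"
        and col: "\<forall>\<omega>. proper_colouring (B \<union> B1) (c \<omega>) \<and> (\<forall>g\<in>carrier G. c \<omega> g \<le> K)"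
      have colB: "\<forall>\<omega>. proper_colouring B (c \<omega>) \<and> (\<forall>g\<in>carrier G. c \<omega> g \<le> K)"
        and colB1: "\<forall>\<omega>. proper_colouring B1 (c \<omega>) \<and> (\<forall>g\<in>carrier G. c \<omega> g \<le> K)"
        using col by (auto intro: proper_colouring_mono)
      obtain x \<sigma> where x: "block_map x" and \<sigma>: "block_map \<sigma>" and
        old: "\<forall>\<omega>. \<forall>h\<in>carrier G. (\<forall>w\<in>W. c \<omega> (w \<otimes> h) \<noteq> 0) \<longrightarrow>
          (\<exists>e\<in>E N. \<sigma> \<omega> (e \<otimes> h)) \<and>
          (\<exists>t\<in>T0. \<forall>f\<in>F. \<not> \<sigma> \<omega> (f \<otimes> t \<otimes> h) \<and> x \<omega> (f \<otimes> t \<otimes> h) = p f) \<and>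
          (\<forall>j<N. \<exists>t\<in>T j. \<not> \<sigma> \<omega> (t \<otimes> h) \<and> \<not> \<sigma> \<omega> (t \<otimes> \<gamma> j \<otimes> h) \<and>
             x \<omega> (t \<otimes> h) \<noteq> x \<omega> (t \<otimes> \<gamma> j \<otimes> h))"
        using IH[rule_format, OF c colB[rule_format]] by (elim exE conjE) (rule that; assumption)
      obtain x' \<sigma>' where x': "block_map x'" and \<sigma>': "block_map \<sigma>'" and
        sub: "\<And>\<omega> g. g \<in> carrier G \<Longrightarrow> \<not> \<sigma> \<omega> g \<Longrightarrow> \<not> \<sigma>' \<omega> g \<and> x' \<omega> g = x \<omega> g" and
        new: "\<And>\<omega> h. h \<in> carrier G \<Longrightarrow> c \<omega> h \<noteq> 0 \<Longrightarrow>
            (\<forall>w\<in>W1. \<exists>e\<in>E N. \<sigma> \<omega> (e \<otimes> (w \<otimes> h))) \<Longrightarrow>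
            (\<exists>e\<in>E (Suc N). \<sigma>' \<omega> (e \<otimes> h)) \<and>
            (\<exists>t\<in>T N. \<not> \<sigma>' \<omega> (t \<otimes> h) \<and> \<not> \<sigma>' \<omega> (t \<otimes> \<gamma> N \<otimes> h) \<and>
               x' \<omega> (t \<otimes> h) \<noteq> x' \<omega> (t \<otimes> \<gamma> N \<otimes> h))"
        using refine[rule_format, OF c x \<sigma> colB1[rule_format]] by (elim exE conjE) blast
      show "\<exists>x \<sigma>. block_map x \<and> block_map \<sigma> \<and> (\<forall>\<omega>. \<forall>h\<in>carrier G.
          (\<forall>w\<in>insert \<one> (W \<union> (W <#> W1)). c \<omega> (w \<otimes> h) \<noteq> 0) \<longrightarrow>
          (\<exists>e\<in>E (Suc N). \<sigma> \<omega> (e \<otimes> h)) \<and>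
          (\<exists>t\<in>T0. \<forall>f\<in>F. \<not> \<sigma> \<omega> (f \<otimes> t \<otimes> h) \<and> x \<omega> (f \<otimes> t \<otimes> h) = p f) \<and>
          (\<forall>j<Suc N. \<exists>t\<in>T j. \<not> \<sigma> \<omega> (t \<otimes> h) \<and> \<not> \<sigma> \<omega> (t \<otimes> \<gamma> j \<otimes> h) \<and>
             x \<omega> (t \<otimes> h) \<noteq> x \<omega> (t \<otimes> \<gamma> j \<otimes> h)))"
      proof (rule exI[of _ x'], rule exI[of _ \<sigma>'], intro conjI allI ballI impI x' \<sigma>')
        fix \<omega> h assume h: "h \<in> carrier G" and cW: "\<forall>w\<in>insert \<one> (W \<union> (W <#> W1)). c \<omega> (w \<otimes> h) \<noteq> 0"
        have ch: "c \<omega> h \<noteq> 0" using cW h by auto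
        have rich: "\<forall>w\<in>W1. \<exists>e\<in>E N. \<sigma> \<omega> (e \<otimes> (w \<otimes> h))"
        proof
          fix w assume w: "w \<in> W1"
          have "\<forall>v\<in>W. c \<omega> (v \<otimes> (w \<otimes> h)) \<noteq> 0"
          proof
            fix v assume v: "v \<in> W"
            then have "c \<omega> (v \<otimes> w \<otimes> h) \<noteq> 0" using cW w by (auto intro: set_multI)
            then show "c \<omega> (v \<otimes> (w \<otimes> h)) \<noteq> 0" using v w W W1 h by (simp add: m_assoc subset_iff)
          qed
          then show "\<exists>e\<in>E N. \<sigma> \<omega> (e \<otimes> (w \<otimes> h))" using old w W1 h by (simp add: subset_iff)
        qed
        note new' = new[OF h ch rich]
        have cW': "\<forall>w\<in>W. c \<omega> (w \<otimes> h) \<noteq> 0" using cW by auto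
        note old' = old[rule_format, OF h cW'[rule_format]]
        show "\<exists>e\<in>E (Suc N). \<sigma>' \<omega> (e \<otimes> h)" using new' by blast
        show "\<exists>t\<in>T0. \<forall>f\<in>F. \<not> \<sigma>' \<omega> (f \<otimes> t \<otimes> h) \<and> x' \<omega> (f \<otimes> t \<otimes> h) = p f"
        proof -
          obtain t where t: "t \<in> T0" "\<forall>f\<in>F. \<not> \<sigma> \<omega> (f \<otimes> t \<otimes> h) \<and> x \<omega> (f \<otimes> t \<otimes> h) = p f"
            using old' by blast
          have "f \<otimes> t \<otimes> h \<in> carrier G" if "f \<in> F" for f
            using that t(1) T0(2) F(2) h by (simp add: subset_iff)
          then show ?thesis using t sub by (intro bexI[of _ t]) auto
        qed
        fix j assume j: "j < Suc N"
        show "\<exists>t\<in>T j. \<not> \<sigma>' \<omega> (t \<otimes> h) \<and> \<not> \<sigma>' \<omega> (t \<otimes> \<gamma> j \<otimes> h) \<and>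
             x' \<omega> (t \<otimes> h) \<noteq> x' \<omega> (t \<otimes> \<gamma> j \<otimes> h)"
        proof (cases "j = N")
          case True
          then show ?thesis using new' by blast
        next
          case False
          then obtain t where t: "t \<in> T j" "\<not> \<sigma> \<omega> (t \<otimes> h)" "\<not> \<sigma> \<omega> (t \<otimes> \<gamma> j \<otimes> h)"
            "x \<omega> (t \<otimes> h) \<noteq> x \<omega> (t \<otimes> \<gamma> j \<otimes> h)"
            using old' j by (metis less_antisym)
          have "t \<in> carrier G" using t TT by blast
          then show ?thesis
            using t sub[of "t \<otimes> h" \<omega>] sub[of "t \<otimes> \<gamma> j \<otimes> h" \<omega>] h \<gamma> by (intro bexI[of _ t]) auto
        qed
      qed
    qed
  qed
  show ?thesis
  proof (rule exI[of _ T0], rule exI[of _ T], intro conjI allI)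
    show "finite (T j)" "T j \<subseteq> carrier G" for j
      using TE[of j] by (simp_all add: aperiodic_refinement_def)
    fix N
    obtain B W where BW: "finite B" "B \<subseteq> carrier G" "finite W" "W \<subseteq> carrier G"
      and ex: "\<forall>K (c :: ('a \<Rightarrow> nat) \<Rightarrow> 'a \<Rightarrow> nat). block_map c \<longrightarrow>
        (\<forall>\<omega>. proper_colouring B (c \<omega>) \<and> (\<forall>g\<in>carrier G. c \<omega> g \<le> K)) \<longrightarrow>
        (\<exists>x \<sigma>. block_map x \<and> block_map \<sigma> \<and> (\<forall>\<omega>. \<forall>h\<in>carrier G. (\<forall>w\<in>W. c \<omega> (w \<otimes> h) \<noteq> 0) \<longrightarrow>
          (\<exists>e\<in>E N. \<sigma> \<omega> (e \<otimes> h)) \<and>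
          (\<exists>t\<in>T0. \<forall>f\<in>F. \<not> \<sigma> \<omega> (f \<otimes> t \<otimes> h) \<and> x \<omega> (f \<otimes> t \<otimes> h) = p f) \<and>
          (\<forall>j<N. \<exists>t\<in>T j. \<not> \<sigma> \<omega> (t \<otimes> h) \<and> \<not> \<sigma> \<omega> (t \<otimes> \<gamma> j \<otimes> h) \<and>
             x \<omega> (t \<otimes> h) \<noteq> x \<omega> (t \<otimes> \<gamma> j \<otimes> h))))"
      using main[of N] by (elim exE conjE) (rule that; assumption)
    show "\<exists>B W. finite B \<and> B \<subseteq> carrier G \<and> finite W \<and> W \<subseteq> carrier G \<and>
      (\<forall>K (c :: ('a \<Rightarrow> nat) \<Rightarrow> 'a \<Rightarrow> nat). block_map c \<longrightarrow>
        (\<forall>\<omega>. proper_colouring B (c \<omega>) \<and> (\<forall>g\<in>carrier G. c \<omega> g \<le> K)) \<longrightarrow>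
        (\<exists>x. block_map x \<and> (\<forall>\<omega>. \<forall>h\<in>carrier G. (\<forall>w\<in>W. c \<omega> (w \<otimes> h) \<noteq> 0) \<longrightarrow>
          (\<exists>t\<in>T0. \<forall>f\<in>F. x \<omega> (f \<otimes> t \<otimes> h) = p f) \<and>
          (\<forall>j<N. \<exists>t\<in>T j. x \<omega> (t \<otimes> h) \<noteq> x \<omega> (t \<otimes> \<gamma> j \<otimes> h)))))"
    proof (rule exI[of _ B], rule exI[of _ W], intro conjI allI impI BW)
      fix K and c :: "('a \<Rightarrow> nat) \<Rightarrow> 'a \<Rightarrow> nat"
      assume c: "block_map c"
        and col: "\<forall>\<omega>. proper_colouring B (c \<omega>) \<and> (\<forall>g\<in>carrier G. c \<omega> g \<le> K)"
      obtain x \<sigma> where x: "block_map x" and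
        good: "\<forall>\<omega>. \<forall>h\<in>carrier G. (\<forall>w\<in>W. c \<omega> (w \<otimes> h) \<noteq> 0) \<longrightarrow>
          (\<exists>e\<in>E N. \<sigma> \<omega> (e \<otimes> h)) \<and>
          (\<exists>t\<in>T0. \<forall>f\<in>F. \<not> \<sigma> \<omega> (f \<otimes> t \<otimes> h) \<and> x \<omega> (f \<otimes> t \<otimes> h) = p f) \<and>
          (\<forall>j<N. \<exists>t\<in>T j. \<not> \<sigma> \<omega> (t \<otimes> h) \<and> \<not> \<sigma> \<omega> (t \<otimes> \<gamma> j \<otimes> h) \<and>
             x \<omega> (t \<otimes> h) \<noteq> x \<omega> (t \<otimes> \<gamma> j \<otimes> h))"
        using ex[rule_format, OF c col[rule_format]] by (elim exE conjE) (rule that; assumption)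
      show "\<exists>x. block_map x \<and> (\<forall>\<omega>. \<forall>h\<in>carrier G. (\<forall>w\<in>W. c \<omega> (w \<otimes> h) \<noteq> 0) \<longrightarrow>
          (\<exists>t\<in>T0. \<forall>f\<in>F. x \<omega> (f \<otimes> t \<otimes> h) = p f) \<and>
          (\<forall>j<N. \<exists>t\<in>T j. x \<omega> (t \<otimes> h) \<noteq> x \<omega> (t \<otimes> \<gamma> j \<otimes> h)))"
        using good by (intro exI[of _ x] conjI x) blast
    qed
  qed (use T0 in auto)
qed


section \<open>Random labels\<close>

definition labels :: "nat \<Rightarrow> ('a \<Rightarrow> nat) measure" where
  "labels K = PiM (carrier G) (\<lambda>_. uniform_count_measure {1..K})"

lemma prob_space_labels: "K \<ge> 1 \<Longrightarrow> prob_space (labels K)"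
  unfolding labels_def by (intro prob_space_PiM prob_space_uniform_count_measure) auto

lemma space_labels: "space (labels K) = carrier G \<rightarrow>\<^sub>E {1..K}"
  by (simp add: labels_def space_PiM space_uniform_count_measure)

text \<open>Labels take finitely many values, so such an event is a finite union of cylinders, one
  for each restriction to \<open>V\<close> that occurs.\<close>

lemma finite_dependence_sets_labels:
  assumes V: "finite V" "V \<subseteq> carrier G"
    and Q: "\<And>\<omega> \<omega>'. \<omega> \<in> space (labels K) \<Longrightarrow> \<omega>' \<in> space (labels K) \<Longrightarrow>
      (\<And>v. v \<in> V \<Longrightarrow> \<omega> v = \<omega>' v) \<Longrightarrow> Q \<omega> \<Longrightarrow> Q \<omega>'"
  shows "{\<omega> \<in> space (labels K). Q \<omega>} \<in> sets (labels K)"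
proof -
  define Y where "Y = (\<lambda>\<omega>. restrict \<omega> V) ` {\<omega> \<in> space (labels K). Q \<omega>}"
  have "Y \<subseteq> V \<rightarrow>\<^sub>E {1..K}" using V by (auto simp: Y_def space_labels)
  then have fin: "finite Y" using V by (meson finite_PiE finite_atLeastAtMost finite_subset)
  have "{\<omega> \<in> space (labels K). Q \<omega>} = (\<Union>y\<in>Y. {\<omega> \<in> space (labels K). \<forall>v\<in>V. \<omega> v = y v})"
    (is "?L = ?R")
  proof
    show "?L \<subseteq> ?R" by (auto simp: Y_def)
    show "?R \<subseteq> ?L"
    proof
      fix \<omega> assume "\<omega> \<in> ?R"
      then obtain \<omega>' where "\<omega> \<in> space (labels K)" "\<omega>' \<in> space (labels K)" "Q \<omega>'" "\<forall>v\<in>V. \<omega> v = \<omega>' v"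
        by (auto simp: Y_def)
      then show "\<omega> \<in> ?L" using Q[of \<omega>' \<omega>] by auto
    qed
  qed
  moreover have "{\<omega> \<in> space (labels K). \<forall>v\<in>V. \<omega> v = y v} \<in> sets (labels K)" for y
  proof (rule sets.sets_Collect_finite_All[OF _ V(1)])
    fix v assume "v \<in> V"
    then have v: "v \<in> carrier G" using V by auto
    have "{\<omega> \<in> space (labels K). \<omega> v \<in> {y v} \<inter> {1..K}} \<in> sets (labels K)"
      unfolding labels_def by (rule sets_Collect_single[OF v]) (simp add: sets_uniform_count_measure)
    moreover have "{\<omega> \<in> space (labels K). \<omega> v \<in> {y v} \<inter> {1..K}} = {\<omega> \<in> space (labels K). \<omega> v = y v}"
      by (auto simp: space_labels dest: PiE_mem[OF _ v])
    ultimately show "{\<omega> \<in> space (labels K). \<omega> v = y v} \<in> sets (labels K)" by simp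
  qed
  ultimately show ?thesis using fin by auto
qed

lemma collision_probability:
  assumes K: "K \<ge> 1" and ij: "i \<in> carrier G" "j \<in> carrier G" "i \<noteq> j"
  shows "measure (labels K) {\<omega> \<in> space (labels K). \<omega> i = \<omega> j} = 1 / K"
proof -
  interpret U: prob_space "uniform_count_measure {1..K}"
    using K by (intro prob_space_uniform_count_measure) auto
  interpret product_prob_space "\<lambda>_. uniform_count_measure {1..K}" "carrier G"
    by unfold_locales
  interpret L: prob_space "labels K" by (rule prob_space_labels[OF K])
  have both: "measure (labels K) {\<omega> \<in> space (labels K). \<omega> i = v \<and> \<omega> j = v} = (1 / K)\<^sup>2"
    if v: "v \<in> {1..K}" for v
  proof -
    have "emeasure (labels K) {\<omega> \<in> space (labels K). \<forall>l\<in>{i, j}. \<omega> l \<in> {v}} =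
        (\<Prod>l\<in>{i, j}. emeasure (uniform_count_measure {1..K}) {v})"
      unfolding labels_def using ij v
      by (intro emeasure_PiM_Collect) (auto simp: sets_uniform_count_measure)
    also have "\<dots> = ennreal (1 / K) * ennreal (1 / K)"
      using ij v by (simp add: emeasure_uniform_count_measure)
    also have "\<dots> = ennreal ((1 / K)\<^sup>2)" 
      unfolding power2_eq_square by (rule ennreal_mult[symmetric]) auto
    finally have "emeasure (labels K) {\<omega> \<in> space (labels K). \<omega> i = v \<and> \<omega> j = v} = ennreal ((1 / K)\<^sup>2)"
      by simp
    then show ?thesis by (simp add: measure_def)
  qed
  have "{\<omega> \<in> space (labels K). \<omega> i = \<omega> j} =
      (\<Union>v\<in>{1..K}. {\<omega> \<in> space (labels K). \<omega> i = v \<and> \<omega> j = v})"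
    using ij by (auto simp: space_labels)
  moreover have "measure (labels K) (\<Union>v\<in>{1..K}. {\<omega> \<in> space (labels K). \<omega> i = v \<and> \<omega> j = v}) =
      (\<Sum>v\<in>{1..K}. measure (labels K) {\<omega> \<in> space (labels K). \<omega> i = v \<and> \<omega> j = v})"
  proof (rule L.finite_measure_finite_Union)
    show "(\<lambda>v. {\<omega> \<in> space (labels K). \<omega> i = v \<and> \<omega> j = v}) ` {1..K} \<subseteq> L.events"
      using ij by (auto intro!: finite_dependence_sets_labels[of "{i, j}"])
  qed (auto simp: disjoint_family_on_def)
  moreover have "(\<Sum>v\<in>{1..K}. measure (labels K) {\<omega> \<in> space (labels K). \<omega> i = v \<and> \<omega> j = v}) =
      K * (1 / K)\<^sup>2"
    using both by simp
  ultimately show ?thesis using K by (simp add: power2_eq_square)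
qed

text \<open>A label is kept as colour unless it clashes with a label at a
  \<open>B\<close>-neighbour. A site loses its colour with probability at most
  \<open>card B / K\<close>, so a large \<open>K\<close> absorbs the sizes of \<open>B\<close> and
  \<open>W\<close>, which are fixed beforehand.\<close>

lemma exists_random_colouring:
  assumes B: "finite B" "B \<subseteq> carrier G" and W: "finite W" "W \<subseteq> carrier G" and \<epsilon>: "\<epsilon> > 0"
  shows "\<exists>K (c :: ('a \<Rightarrow> nat) \<Rightarrow> 'a \<Rightarrow> nat). K \<ge> 1 \<and> block_map c \<and>
    (\<forall>\<omega>. proper_colouring B (c \<omega>) \<and> (\<forall>g\<in>carrier G. c \<omega> g \<le> K)) \<and>
    measure (labels K) {\<omega> \<in> space (labels K). \<exists>w\<in>W. c \<omega> w = 0} \<le> \<epsilon>"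
proof -
  define b where "b = real (card (W \<times> B))"
  obtain K :: nat where K: "K > b / \<epsilon>" using reals_Archimedean2 by blast
  have K1: "K \<ge> 1"
  proof -
    have "0 \<le> b / \<epsilon>" using \<epsilon> by (simp add: b_def)
    then show ?thesis using K by linarith
  qed
  interpret L: prob_space "labels K" by (rule prob_space_labels[OF K1])
  \<comment> \<open>Block maps live on all functions, not only on those with values in
    \<open>{1..K}\<close>; the clause \<open>\<omega> g > K\<close> secures the bound on the colours
    there as well.\<close>
  define c where "c \<omega> g = (if \<omega> g > K \<or> (\<exists>b\<in>B. b \<noteq> \<one> \<and> \<omega> (b \<otimes> g) = \<omega> g) then 0 else \<omega> g)"
    for \<omega> :: "'a \<Rightarrow> nat" and g
  have "block_map c"
    unfolding block_map_def
  proof (intro exI[of _ "insert \<one> B"] conjI allI impI)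
    fix \<omega> \<omega>' :: "'a \<Rightarrow> nat" and g g'
    assume g: "g \<in> carrier G" "g' \<in> carrier G"
      and eq: "\<forall>v\<in>insert \<one> B. \<omega> (v \<otimes> g) = \<omega>' (v \<otimes> g')"
    then have "\<omega> g = \<omega>' g'" by auto
    then show "c \<omega> g = c \<omega>' g'" using eq by (auto simp: c_def)
  qed (use B in auto)
  moreover have "proper_colouring B (c \<omega>)" for \<omega>
    unfolding proper_colouring_def by (auto simp: c_def)
  moreover have "c \<omega> g \<le> K" for \<omega> g by (auto simp: c_def)
  moreover have "measure (labels K) {\<omega> \<in> space (labels K). \<exists>w\<in>W. c \<omega> w = 0} \<le> \<epsilon>"
  proof -
    define P where "P = {(w, b). w \<in> W \<and> b \<in> B \<and> b \<noteq> \<one>}"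
    have P: "P \<subseteq> W \<times> B" by (auto simp: P_def)
    then have finP: "finite P" using W B by (meson finite_SigmaI finite_subset)
    define ev where "ev = (\<lambda>(w, b). {\<omega> \<in> space (labels K). \<omega> (b \<otimes> w) = \<omega> w})"
    have ev_sets: "ev i \<in> L.events" if "i \<in> P" for i
    proof -
      obtain w b where i: "i = (w, b)" by (cases i)
      then have "{b \<otimes> w, w} \<subseteq> carrier G" using that W B by (auto simp: P_def)
      then show ?thesis
        unfolding i ev_def prod.case
        by (rule finite_dependence_sets_labels[rotated]) (metis insertI1 insertI2, simp)
    qed
    have "{\<omega> \<in> space (labels K). \<exists>w\<in>W. c \<omega> w = 0} \<subseteq> (\<Union>i\<in>P. ev i)"
    proof
      fix \<omega> assume "\<omega> \<in> {\<omega> \<in> space (labels K). \<exists>w\<in>W. c \<omega> w = 0}"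
      then obtain w where w: "\<omega> \<in> space (labels K)" "w \<in> W" "c \<omega> w = 0" by blast
      then have "\<omega> w \<in> {1..K}" using W by (auto simp: space_labels)
      then obtain b where "b \<in> B" "b \<noteq> \<one>" "\<omega> (b \<otimes> w) = \<omega> w"
        using w(3) by (auto simp: c_def split: if_splits)
      then show "\<omega> \<in> (\<Union>i\<in>P. ev i)"
        using w by (auto simp: P_def ev_def intro!: bexI[of _ "(w, b)"])
    qed
    then have "measure (labels K) {\<omega> \<in> space (labels K). \<exists>w\<in>W. c \<omega> w = 0} \<le> measure (labels K) (\<Union>i\<in>P. ev i)"
      using ev_sets finP by (intro L.finite_measure_mono) auto
    also have "\<dots> \<le> (\<Sum>i\<in>P. measure (labels K) (ev i))"
      using ev_sets finP by (intro L.finite_measure_subadditive_finite) auto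
    also have "\<dots> = (\<Sum>i\<in>P. 1 / K)"
    proof (rule sum.cong[OF refl])
      fix i assume "i \<in> P"
      then obtain w b where i: "i = (w, b)" "w \<in> W" "b \<in> B" "b \<noteq> \<one>" by (auto simp: P_def)
      then have "w \<in> carrier G" "b \<in> carrier G" using W B by auto
      moreover from this have "b \<otimes> w \<noteq> w" using i by simp
      ultimately show "measure (labels K) (ev i) = 1 / K"
        using collision_probability[OF K1, of "b \<otimes> w" w] by (simp add: i ev_def)
    qed
    also have "\<dots> = real (card P) / K" by simp
    also have "\<dots> \<le> b / K"
      unfolding b_def using P W B by (intro divide_right_mono of_nat_mono card_mono) auto
    also have "\<dots> \<le> \<epsilon>" using K \<epsilon> K1 by (simp add: field_simps)
    finally show ?thesis .
  qed
  ultimately show ?thesis using K1 by blast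
qed

lemma distr_labels_shift:
  assumes K: "K \<ge> 1" and \<gamma>: "\<gamma> \<in> carrier G"
  shows "distr (labels K) (labels K) (shift G \<gamma>) = labels K"
proof -
  have "inj_on (\<lambda>\<delta>. \<delta> \<otimes> \<gamma>) (carrier G)" using \<gamma> by (auto intro!: inj_onI)
  moreover have "(\<lambda>\<delta>. \<delta> \<otimes> \<gamma>) \<in> carrier G \<rightarrow> carrier G" using \<gamma> by auto
  moreover have "prob_space (uniform_count_measure {1..K})"
    using K by (intro prob_space_uniform_count_measure) auto
  ultimately show ?thesis
    using distr_PiM_reindex[of "carrier G" "\<lambda>_. uniform_count_measure {1..K}" "\<lambda>\<delta>. \<delta> \<otimes> \<gamma>" "carrier G"]
    by (simp add: labels_def shift_def[abs_def])
qed

text \<open>Phrased by dependence on coordinates instead of unions of boxes, which makes the algebra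
  laws immediate.\<close>

definition cylinder_sets :: "('a \<Rightarrow> nat) set set" where
  "cylinder_sets = {A. A \<subseteq> topspace (full_shift G) \<and> (\<exists>F. finite F \<and> F \<subseteq> carrier G \<and>
     (\<forall>y\<in>topspace (full_shift G). \<forall>z\<in>topspace (full_shift G).
        (\<forall>f\<in>F. y f = z f) \<longrightarrow> y \<in> A \<longrightarrow> z \<in> A))}"

text \<open>The bounds are imposed on all sets, also where nothing else is required, so that
  contents form a closed subset of a compact product of intervals.\<close>

definition invariant_content :: "(('a \<Rightarrow> nat) set \<Rightarrow> real) \<Rightarrow> bool" where
  "invariant_content f \<longleftrightarrow> (\<forall>A. 0 \<le> f A \<and> f A \<le> 1) \<and> f (topspace (full_shift G)) = 1 \<and>
     (\<forall>A\<in>cylinder_sets. \<forall>B\<in>cylinder_sets. A \<inter> B = {} \<longrightarrow> f (A \<union> B) = f A + f B) \<and>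
     (\<forall>\<gamma>\<in>carrier G. \<forall>A\<in>cylinder_sets. f {y\<in>topspace (full_shift G). shift G \<gamma> y \<in> A} = f A)"

definition indicator_point :: "('a \<Rightarrow> bool) \<Rightarrow> 'a \<Rightarrow> nat" where
  "indicator_point x = (\<lambda>g\<in>carrier G. of_bool (x g))"

lemma indicator_point_in: "indicator_point x \<in> topspace (full_shift G)"
  by (auto simp: indicator_point_def topspace_full_shift)

text \<open>The law of the output inherits invariance from the law of the labels, because a block
  map commutes with the shift. A cylinder event of the output depends on finitely many labels and is
  therefore measurable.\<close>

lemma invariant_content_of_block_map:
  assumes K: "K \<ge> 1" and x: "block_map x"
  defines "f \<equiv> \<lambda>A. measure (labels K) {\<omega> \<in> space (labels K). indicator_point (x \<omega>) \<in> A}"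
  shows "invariant_content f"
    and "A \<in> cylinder_sets \<Longrightarrow> {\<omega> \<in> space (labels K). indicator_point (x \<omega>) \<in> A} \<in> sets (labels K)"
proof -
  interpret L: prob_space "labels K" by (rule prob_space_labels[OF K])
  obtain V where V: "finite V" "V \<subseteq> carrier G" and loc:
    "\<And>\<omega> \<omega>' g g'. g \<in> carrier G \<Longrightarrow> g' \<in> carrier G \<Longrightarrow>
        (\<forall>v\<in>V. \<omega> (v \<otimes> g) = \<omega>' (v \<otimes> g')) \<Longrightarrow> x \<omega> g = x \<omega>' g'"
    using x unfolding block_map_def by metis
  show meas: "{\<omega> \<in> space (labels K). indicator_point (x \<omega>) \<in> A} \<in> sets (labels K)"
    if A: "A \<in> cylinder_sets" for A
  proof -
    obtain F where F: "finite F" "F \<subseteq> carrier G"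
      and FA: "\<And>y z. y \<in> topspace (full_shift G) \<Longrightarrow> z \<in> topspace (full_shift G) \<Longrightarrow>
        (\<forall>f\<in>F. y f = z f) \<Longrightarrow> y \<in> A \<Longrightarrow> z \<in> A"
      using A unfolding cylinder_sets_def by blast
    show ?thesis
    proof (rule finite_dependence_sets_labels[of "V <#> F"])
      show "finite (V <#> F)" "V <#> F \<subseteq> carrier G"
        using V F set_mult_closed by (auto intro: finite_set_mult)
      fix \<omega> \<omega>' assume eq: "\<And>v. v \<in> V <#> F \<Longrightarrow> \<omega> v = \<omega>' v" and "indicator_point (x \<omega>) \<in> A"
      moreover have "x \<omega> f = x \<omega>' f" if "f \<in> F" for f
        using that F eq by (intro loc) (auto intro: set_multI)
      then have "\<forall>f\<in>F. indicator_point (x \<omega>) f = indicator_point (x \<omega>') f"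
        using F by (auto simp: indicator_point_def)
      ultimately show "indicator_point (x \<omega>') \<in> A"
        using FA[OF indicator_point_in indicator_point_in] by blast
    qed
  qed
  have equi: "shift G \<gamma> (indicator_point (x \<omega>)) = indicator_point (x (shift G \<gamma> \<omega>))"
    if "\<gamma> \<in> carrier G" for \<gamma> \<omega>
  proof -
    have "x \<omega> (\<delta> \<otimes> \<gamma>) = x (shift G \<gamma> \<omega>) \<delta>" if "\<delta> \<in> carrier G" for \<delta>
      using that \<open>\<gamma> \<in> carrier G\<close> V by (intro loc) (auto simp: shift_def m_assoc subset_iff)
    then show ?thesis using that by (auto simp: shift_def indicator_point_def fun_eq_iff)
  qed
  have "f {y\<in>topspace (full_shift G). shift G \<gamma> y \<in> A} = f A"
    if \<gamma>: "\<gamma> \<in> carrier G" and A: "A \<in> cylinder_sets" for \<gamma> A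
  proof -
    have sh: "shift G \<gamma> \<in> labels K \<rightarrow>\<^sub>M labels K"
      unfolding labels_def shift_def[abs_def]
      by (rule measurable_restrict) (use \<gamma> in \<open>auto intro!: measurable_component_singleton\<close>)
    have "f A = measure (distr (labels K) (labels K) (shift G \<gamma>))
        {\<omega> \<in> space (labels K). indicator_point (x \<omega>) \<in> A}"
      by (simp add: f_def distr_labels_shift[OF K \<gamma>])
    also have "\<dots> = measure (labels K) (shift G \<gamma> -` {\<omega> \<in> space (labels K). indicator_point (x \<omega>) \<in> A}
        \<inter> space (labels K))"
      by (rule measure_distr[OF sh meas[OF A]])
    also have "shift G \<gamma> -` {\<omega> \<in> space (labels K). indicator_point (x \<omega>) \<in> A} \<inter> space (labels K) =
        {\<omega> \<in> space (labels K). indicator_point (x \<omega>) \<in> {y\<in>topspace (full_shift G). shift G \<gamma> y \<in> A}}"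
      using measurable_space[OF sh] equi[OF \<gamma>] indicator_point_in by auto
    finally show ?thesis by (simp add: f_def)
  qed
  moreover have "f (A \<union> B) = f A + f B"
    if "A \<in> cylinder_sets" "B \<in> cylinder_sets" "A \<inter> B = {}" for A B
  proof -
    have "{\<omega> \<in> space (labels K). indicator_point (x \<omega>) \<in> A \<union> B} =
      {\<omega> \<in> space (labels K). indicator_point (x \<omega>) \<in> A} \<union> {\<omega> \<in> space (labels K). indicator_point (x \<omega>) \<in> B}"
      by auto
    then show ?thesis
      unfolding f_def using that meas by (simp add: L.finite_measure_Union disjoint_iff)
  qed
  ultimately show "invariant_content f"
    unfolding invariant_content_def by (auto simp: f_def indicator_point_in L.prob_space)
qed


section \<open>Invariant contents and measures\<close>

lemma shift_in: "f \<in> topspace (full_shift G) \<Longrightarrow> \<gamma> \<in> carrier G \<Longrightarrow> shift G \<gamma> f \<in> topspace (full_shift G)"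
  by (auto simp: topspace_full_shift shift_def PiE_iff)

lemma shift_mult:
  "\<gamma> \<in> carrier G \<Longrightarrow> \<eta> \<in> carrier G \<Longrightarrow> shift G \<gamma> (shift G \<eta> f) = shift G (\<gamma> \<otimes> \<eta>) f"
  by (auto simp: shift_def fun_eq_iff m_assoc)

lemma shift_one: "f \<in> topspace (full_shift G) \<Longrightarrow> shift G \<one> f = f"
  by (auto simp: topspace_full_shift shift_def fun_eq_iff PiE_def extensional_def)

lemma cylinder_setsI:
  assumes "A \<subseteq> topspace (full_shift G)" "finite F" "F \<subseteq> carrier G"
    "\<And>y z. y \<in> topspace (full_shift G) \<Longrightarrow> z \<in> topspace (full_shift G) \<Longrightarrow>
       (\<And>f. f \<in> F \<Longrightarrow> y f = z f) \<Longrightarrow> y \<in> A \<Longrightarrow> z \<in> A"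
  shows "A \<in> cylinder_sets"
proof -
  have "z \<in> A" if "y \<in> topspace (full_shift G)" "z \<in> topspace (full_shift G)" "\<forall>f\<in>F. y f = z f" "y \<in> A"
    for y z
    using assms(4)[OF that(1,2) _ that(4)] that(3) by simp
  then show ?thesis unfolding cylinder_sets_def using assms(1-3) by blast
qed

lemma cylinder_setsE:
  assumes "A \<in> cylinder_sets"
  obtains F where "A \<subseteq> topspace (full_shift G)" "finite F" "F \<subseteq> carrier G"
    "\<forall>y\<in>topspace (full_shift G). \<forall>z\<in>topspace (full_shift G). (\<forall>f\<in>F. y f = z f) \<longrightarrow> y \<in> A \<longrightarrow> z \<in> A"
  using assms unfolding cylinder_sets_def by blast

lemma algebra_cylinder_sets: "algebra (topspace (full_shift G)) cylinder_sets"
  unfolding algebra_iff_Un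
proof (intro conjI ballI)
  show "cylinder_sets \<subseteq> Pow (topspace (full_shift G))" by (auto simp: cylinder_sets_def)
  show "{} \<in> cylinder_sets" by (rule cylinder_setsI[of _ "{}"]) auto
  fix A assume "A \<in> cylinder_sets"
  then obtain F where F: "A \<subseteq> topspace (full_shift G)" "finite F" "F \<subseteq> carrier G"
    "\<forall>y\<in>topspace (full_shift G). \<forall>z\<in>topspace (full_shift G). (\<forall>f\<in>F. y f = z f) \<longrightarrow> y \<in> A \<longrightarrow> z \<in> A"
    by (rule cylinder_setsE)
  show "topspace (full_shift G) - A \<in> cylinder_sets"
  proof (rule cylinder_setsI[OF _ F(2,3)])
    fix y z
    assume yz: "y \<in> topspace (full_shift G)" "z \<in> topspace (full_shift G)" "\<And>f. f \<in> F \<Longrightarrow> y f = z f"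
      and y: "y \<in> topspace (full_shift G) - A"
    have "y \<in> A" if "z \<in> A"
      by (rule F(4)[rule_format, OF yz(2,1) _ that]) (simp add: yz(3))
    then show "z \<in> topspace (full_shift G) - A" using y yz(2) by blast
  qed auto
  fix B assume "B \<in> cylinder_sets"
  then obtain F' where F': "B \<subseteq> topspace (full_shift G)" "finite F'" "F' \<subseteq> carrier G"
    "\<forall>y\<in>topspace (full_shift G). \<forall>z\<in>topspace (full_shift G). (\<forall>f\<in>F'. y f = z f) \<longrightarrow> y \<in> B \<longrightarrow> z \<in> B"
    by (rule cylinder_setsE)
  show "A \<union> B \<in> cylinder_sets"
  proof (rule cylinder_setsI[of _ "F \<union> F'"])
    fix y z
    assume yz: "y \<in> topspace (full_shift G)" "z \<in> topspace (full_shift G)"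
      "\<And>f. f \<in> F \<union> F' \<Longrightarrow> y f = z f" and y: "y \<in> A \<union> B"
    have "z \<in> A" if "y \<in> A"
      by (rule F(4)[rule_format, OF yz(1,2) _ that]) (simp add: yz(3))
    moreover have "z \<in> B" if "y \<in> B"
      by (rule F'(4)[rule_format, OF yz(1,2) _ that]) (simp add: yz(3))
    ultimately show "z \<in> A \<union> B" using y by blast
  qed (use F(1-3) F'(1-3) in auto)
qed

lemma shift_vimage_cylinder_sets:
  assumes A: "A \<in> cylinder_sets" and \<gamma>: "\<gamma> \<in> carrier G"
  shows "{y \<in> topspace (full_shift G). shift G \<gamma> y \<in> A} \<in> cylinder_sets"
proof -
  obtain F where F: "finite F" "F \<subseteq> carrier G"
    "\<forall>y\<in>topspace (full_shift G). \<forall>z\<in>topspace (full_shift G). (\<forall>f\<in>F. y f = z f) \<longrightarrow> y \<in> A \<longrightarrow> z \<in> A"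
    using A by (rule cylinder_setsE)
  show ?thesis
  proof (rule cylinder_setsI[of _ "(\<lambda>f. f \<otimes> \<gamma>) ` F"])
    fix y z
    assume yz: "y \<in> topspace (full_shift G)" "z \<in> topspace (full_shift G)"
      and eq: "\<And>f. f \<in> (\<lambda>f. f \<otimes> \<gamma>) ` F \<Longrightarrow> y f = z f"
      and y: "y \<in> {y \<in> topspace (full_shift G). shift G \<gamma> y \<in> A}"
    have sh: "shift G \<gamma> y f = shift G \<gamma> z f" if "f \<in> F" for f
      using eq that F(2) by (auto simp: shift_def)
    have "shift G \<gamma> z \<in> A"
      by (rule F(3)[rule_format, OF shift_in[OF yz(1) \<gamma>] shift_in[OF yz(2) \<gamma>] sh]) (use y in auto)
    then show "z \<in> {y \<in> topspace (full_shift G). shift G \<gamma> y \<in> A}" using yz by simp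
  qed (use F(1,2) \<gamma> in auto)
qed

lemma openin_cylinder_sets:
  assumes "A \<in> cylinder_sets"
  shows "openin (full_shift G) A"
proof -
  obtain F where F: "A \<subseteq> topspace (full_shift G)" "finite F" "F \<subseteq> carrier G"
    "\<forall>y\<in>topspace (full_shift G). \<forall>z\<in>topspace (full_shift G). (\<forall>f\<in>F. y f = z f) \<longrightarrow> y \<in> A \<longrightarrow> z \<in> A"
    using assms by (rule cylinder_setsE)
  show ?thesis
    unfolding full_shift_def openin_product_topology_alt
  proof
    fix x assume x: "x \<in> A"
    define U where "U i = (if i \<in> F then {x i} else {0, 1})" for i
    have xT: "x \<in> carrier G \<rightarrow>\<^sub>E {0, 1}" using x F(1) unfolding topspace_full_shift by blast
    have sub: "U i \<subseteq> {0, 1}" if "i \<in> carrier G" for i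
      using PiE_mem[OF xT that] by (auto simp: U_def)
    show "\<exists>U. finite {i \<in> carrier G. U i \<noteq> topspace (discrete_topology {0, 1})} \<and>
      (\<forall>i\<in>carrier G. openin (discrete_topology {0, 1}) (U i)) \<and> x \<in> Pi\<^sub>E (carrier G) U \<and> Pi\<^sub>E (carrier G) U \<subseteq> A"
    proof (intro exI[of _ U] conjI ballI)
      show "finite {i \<in> carrier G. U i \<noteq> topspace (discrete_topology {0, 1})}"
        by (rule finite_subset[OF _ F(2)]) (auto simp: U_def)
      show "openin (discrete_topology {0, 1}) (U i)" if "i \<in> carrier G" for i using sub[OF that] by simp
      show "x \<in> Pi\<^sub>E (carrier G) U" using xT by (auto simp: U_def PiE_iff)
      show "Pi\<^sub>E (carrier G) U \<subseteq> A"
      proof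
        fix z assume z: "z \<in> Pi\<^sub>E (carrier G) U"
        then have "z \<in> topspace (full_shift G)"
          using PiE_mono[of "carrier G" U "\<lambda>_. {0, 1}"] sub unfolding topspace_full_shift by blast
        moreover have "x f = z f" if "f \<in> F" for f
          using PiE_mem[OF z, of f] that F(3) by (auto simp: U_def)
        ultimately show "z \<in> A" using F(4)[rule_format, of x z] F(1) x by auto
      qed
    qed
  qed
qed

lemma closedin_cylinder_sets: "A \<in> cylinder_sets \<Longrightarrow> closedin (full_shift G) A"
  using openin_cylinder_sets[OF algebra.compl_sets[OF algebra_cylinder_sets]]
  by (auto simp: closedin_def cylinder_sets_def)

lemma open_neighbourhood_cylinder:
  assumes U: "openin (full_shift G) U" and x: "x \<in> U"
  obtains F where "finite F" "F \<subseteq> carrier G"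
    "\<And>z. z \<in> topspace (full_shift G) \<Longrightarrow> (\<And>f. f \<in> F \<Longrightarrow> x f = z f) \<Longrightarrow> z \<in> U"
proof -
  obtain V where V: "finite {i \<in> carrier G. V i \<noteq> {0, 1}}"
    "x \<in> Pi\<^sub>E (carrier G) V" "Pi\<^sub>E (carrier G) V \<subseteq> U"
    using U x unfolding full_shift_def openin_product_topology_alt by force
  show thesis
  proof (rule that[of "{i \<in> carrier G. V i \<noteq> {0, 1}}"])
    fix z assume z: "z \<in> topspace (full_shift G)"
      and eq: "\<And>f. f \<in> {i \<in> carrier G. V i \<noteq> {0, 1}} \<Longrightarrow> x f = z f"
    have "z i \<in> V i" if i: "i \<in> carrier G" for i
    proof (cases "V i = {0, 1}")
      case True
      then show ?thesis using PiE_mem[OF z[unfolded topspace_full_shift] i] by simp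
    next
      case False
      then show ?thesis using eq[of i] PiE_mem[OF V(2) i] i by simp
    qed
    then have "z \<in> Pi\<^sub>E (carrier G) V"
      using z by (auto simp: topspace_full_shift PiE_iff)
    then show "z \<in> U" using V(3) by blast
  qed (use V in auto)
qed

lemma compact_space_full_shift: "compact_space (full_shift G)"
  unfolding full_shift_def compact_space_product_topology
  by (simp add: compact_space_discrete_topology)

text \<open>An open set is the union, over finite \<open>F\<close>, of the largest cylinder on
  \<open>F\<close> inside it. Countability of the group enters because it leaves only countably many
  such \<open>F\<close>.\<close>

lemma sigma_sets_cylinder_sets:
  assumes count: "countable (carrier G)"
  shows "sigma_sets (topspace (full_shift G)) cylinder_sets =
    sigma_sets (topspace (full_shift G)) {U. openin (full_shift G) U}"
proof (rule sigma_sets_eqI)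
  fix A assume "A \<in> cylinder_sets"
  then show "A \<in> sigma_sets (topspace (full_shift G)) {U. openin (full_shift G) U}"
    using openin_cylinder_sets by auto
next
  fix U assume "U \<in> {U. openin (full_shift G) U}"
  then have U: "openin (full_shift G) U" by simp
  define A where "A F = {y \<in> topspace (full_shift G).
    \<forall>z\<in>topspace (full_shift G). (\<forall>f\<in>F. y f = z f) \<longrightarrow> z \<in> U}" for F
  define \<F> where "\<F> = {F. finite F \<and> F \<subseteq> carrier G}"
  have "A F \<in> cylinder_sets" if "F \<in> \<F>" for F
    by (rule cylinder_setsI[of _ F]) (use that in \<open>auto simp: A_def \<F>_def\<close>)
  moreover have "countable \<F>"
    using countable_Collect_finite_subset[OF count] by (simp add: \<F>_def conj_commute)
  ultimately have "(\<Union>F\<in>\<F>. A F) \<in> sigma_sets (topspace (full_shift G)) cylinder_sets"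
    by (intro sigma_sets_UNION) auto
  moreover have "(\<Union>F\<in>\<F>. A F) = U"
  proof
    show "(\<Union>F\<in>\<F>. A F) \<subseteq> U" by (auto simp: A_def)
    show "U \<subseteq> (\<Union>F\<in>\<F>. A F)"
    proof
      fix x assume x: "x \<in> U"
      obtain F where "finite F" "F \<subseteq> carrier G"
        "\<And>z. z \<in> topspace (full_shift G) \<Longrightarrow> (\<And>f. f \<in> F \<Longrightarrow> x f = z f) \<Longrightarrow> z \<in> U"
        using open_neighbourhood_cylinder[OF U x] by blast
      moreover have "x \<in> topspace (full_shift G)" using openin_subset[OF U] x by blast
      ultimately show "x \<in> (\<Union>F\<in>\<F>. A F)" by (auto simp: A_def \<F>_def)
    qed
  qed
  ultimately show "U \<in> sigma_sets (topspace (full_shift G)) cylinder_sets" by simp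
qed

section \<open>Limit content and its extension to a measure\<close>

lemma closed_invariant_contents: "closed {f. invariant_content f}"
proof -
  have c: "continuous_on UNIV (\<lambda>f :: ('a \<Rightarrow> nat) set \<Rightarrow> real. f A)" for A
    by (rule continuous_on_product_coordinates)
  have add: "closed {f :: ('a \<Rightarrow> nat) set \<Rightarrow> real. A \<inter> B = {} \<longrightarrow> f (A \<union> B) = f A + f B}" for A B
    by (cases "A \<inter> B = {}") (auto intro!: closed_Collect_eq continuous_on_add c)
  show ?thesis
    unfolding invariant_content_def Ball_def
    by (intro closed_Collect_conj closed_Collect_all closed_Collect_imp closed_Collect_le
        closed_Collect_eq continuous_on_add continuous_on_const c add open_Collect_const)
qed

text \<open>The contents that are small on the first events form a decreasing sequence of nonempty
  closed subsets of a compact cube; a common point vanishes on every \<open>N i\<close>. The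
  topology is pointwise on sets, so the events must not change with \<open>n\<close>.\<close>

lemma exists_null_content:
  assumes "\<And>n. \<exists>f. invariant_content f \<and> (\<forall>i\<le>n. f (N i) \<le> 1 / Suc n)"
  shows "\<exists>f. invariant_content f \<and> (\<forall>i::nat. f (N i) = 0)"
proof -
  define K where "K = (Pi\<^sub>E UNIV (\<lambda>_. {0..1}) :: (('a \<Rightarrow> nat) set \<Rightarrow> real) set)"
  define C where "C n = {f. invariant_content f \<and> (\<forall>i\<le>n. f (N i) \<le> 1 / Suc n)}" for n
  have "compactin (product_topology (\<lambda>_. euclidean) UNIV) K"
    unfolding K_def compactin_PiE by simp
  then have "compact K" by (simp add: euclidean_product_topology flip: compactin_euclidean_iff)
  then have "compact_space (top_of_set K)" by (simp add: compact_space_subtopology)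
  moreover have "closedin (top_of_set K) (C n)" for n
  proof (rule closed_subset)
    show "C n \<subseteq> K" by (auto simp: C_def K_def invariant_content_def)
    have "C n = {f. invariant_content f} \<inter> {f. \<forall>i. i \<le> n \<longrightarrow> f (N i) \<le> 1 / Suc n}"
      by (auto simp: C_def)
    also have "closed \<dots>"
      by (intro closed_Int closed_invariant_contents closed_Collect_all closed_Collect_imp
          open_Collect_const closed_Collect_le continuous_on_const continuous_on_product_coordinates)
    finally show "closed (C n)" .
  qed
  moreover have "C n \<noteq> {}" for n using assms[of n] by (auto simp: C_def)
  moreover have "C n \<subseteq> C m" if "m \<le> n" for m n
  proof
    fix f assume f: "f \<in> C n"
    have "1 / real (Suc n) \<le> 1 / real (Suc m)" using that by (intro divide_left_mono) auto
    then show "f \<in> C m" using f that unfolding C_def by (auto intro: order_trans)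
  qed
  ultimately have "(\<Inter>n. C n) \<noteq> {}"
    by (intro compact_space_imp_nest) (auto simp: decseq_def)
  then obtain f where f: "\<And>n. f \<in> C n" by blast
  have "f (N i) = 0" for i
  proof (rule antisym)
    show "f (N i) \<le> 0"
    proof (rule field_le_epsilon)
      fix e :: real assume "e > 0"
      then obtain n where "1 / real (Suc n) < e" using nat_approx_posE by blast
      moreover have "1 / real (Suc (max i n)) \<le> 1 / real (Suc n)" by (intro divide_left_mono) auto
      moreover have "f (N i) \<le> 1 / real (Suc (max i n))" using f[of "max i n"] by (auto simp: C_def)
      ultimately show "f (N i) \<le> 0 + e" by linarith
    qed
    show "0 \<le> f (N i)" using f[of 0] by (auto simp: C_def invariant_content_def)
  qed
  moreover have "invariant_content f" using f[of 0] by (simp add: C_def)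
  ultimately show ?thesis by blast
qed

text \<open>Countable additivity is free: cylinder sets are closed in a compact space, so a
  decreasing sequence of them with empty intersection is eventually empty, and Caratheodory's
  theorem applies.\<close>

lemma content_extends:
  assumes f: "invariant_content f"
  shows "\<exists>\<mu>. prob_space \<mu> \<and> space \<mu> = topspace (full_shift G) \<and>
    sets \<mu> = sigma_sets (topspace (full_shift G)) cylinder_sets \<and>
    (\<forall>A\<in>cylinder_sets. emeasure \<mu> A = ennreal (f A))"
proof -
  interpret C: algebra "topspace (full_shift G)" cylinder_sets by (rule algebra_cylinder_sets)
  have nn: "0 \<le> f A" for A using f by (auto simp: invariant_content_def)
  have add: "f (A \<union> B) = f A + f B" if "A \<in> cylinder_sets" "B \<in> cylinder_sets" "A \<inter> B = {}" for A B
    using f that by (auto simp: invariant_content_def)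
  have f0: "f {} = 0" using add[of "{}" "{}"] by simp
  have "\<exists>\<mu>. (\<forall>s\<in>cylinder_sets. \<mu> s = ennreal (f s)) \<and>
      measure_space (topspace (full_shift G)) (sigma_sets (topspace (full_shift G)) cylinder_sets) \<mu>"
  proof (rule C.caratheodory_empty_continuous)
    show "positive cylinder_sets (\<lambda>A. ennreal (f A))" by (simp add: positive_def f0)
    show "additive cylinder_sets (\<lambda>A. ennreal (f A))"
      by (simp add: additive_def add nn ennreal_plus)
    fix A :: "nat \<Rightarrow> ('a \<Rightarrow> nat) set"
    assume A: "range A \<subseteq> cylinder_sets" "decseq A" "(\<Inter>i. A i) = {}"
    have "\<exists>n. A n = {}"
    proof (rule ccontr)
      assume "\<nexists>n. A n = {}"
      moreover have "closedin (full_shift G) (A n)" for n using A(1) closedin_cylinder_sets by blast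
      ultimately have "(\<Inter>i. A i) \<noteq> {}"
        using A(2) by (intro compact_space_imp_nest[OF compact_space_full_shift]) auto
      then show False using A(3) by simp
    qed
    then obtain n where n: "A n = {}" by blast
    have "A m = {}" if "m \<ge> n" for m using decseqD[OF A(2) that] n by auto
    then have "eventually (\<lambda>m. ennreal (f (A m)) = 0) sequentially"
      unfolding eventually_sequentially by (intro exI[of _ n]) (simp add: f0)
    then show "(\<lambda>i. ennreal (f (A i))) \<longlonglongrightarrow> 0" by (rule tendsto_eventually)
  qed auto
  then obtain m where m: "\<And>s. s \<in> cylinder_sets \<Longrightarrow> m s = ennreal (f s)"
    and ms: "measure_space (topspace (full_shift G)) (sigma_sets (topspace (full_shift G)) cylinder_sets) m"
    by blast
  define \<mu> where "\<mu> = measure_of (topspace (full_shift G)) cylinder_sets m"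
  have sub: "cylinder_sets \<subseteq> Pow (topspace (full_shift G))" by (rule C.space_closed)
  have em: "emeasure \<mu> A = ennreal (f A)" if "A \<in> cylinder_sets" for A
    using ms that m sub unfolding \<mu>_def measure_space_def
    by (subst emeasure_measure_of[OF refl]) (auto simp: sets_measure_of)
  have sp: "space \<mu> = topspace (full_shift G)" unfolding \<mu>_def by (rule space_measure_of[OF sub])
  moreover have "prob_space \<mu>"
    using em[OF C.top] f by (intro prob_spaceI) (simp add: sp invariant_content_def)
  moreover have "sets \<mu> = sigma_sets (topspace (full_shift G)) cylinder_sets"
    unfolding \<mu>_def by (rule sets_measure_of[OF sub])
  ultimately show ?thesis using em by blast
qed


lemma block_map_event_sets:
  assumes c: "block_map c" and W: "finite W" "W \<subseteq> carrier G"
  shows "{\<omega> \<in> space (labels K). \<exists>w\<in>W. P (c \<omega> w)} \<in> sets (labels K)"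
proof -
  obtain V where V: "finite V" "V \<subseteq> carrier G" and loc:
    "\<And>\<omega> \<omega>' g g'. g \<in> carrier G \<Longrightarrow> g' \<in> carrier G \<Longrightarrow>
        (\<forall>v\<in>V. \<omega> (v \<otimes> g) = \<omega>' (v \<otimes> g')) \<Longrightarrow> c \<omega> g = c \<omega>' g'"
    using c unfolding block_map_def by metis
  show ?thesis
  proof (rule finite_dependence_sets_labels[of "V <#> W"])
    show "finite (V <#> W)" "V <#> W \<subseteq> carrier G"
      using V W set_mult_closed by (auto intro: finite_set_mult)
    fix \<omega> \<omega>' assume eq: "\<And>v. v \<in> V <#> W \<Longrightarrow> \<omega> v = \<omega>' v" and "\<exists>w\<in>W. P (c \<omega> w)"
    moreover have "c \<omega> w = c \<omega>' w" if "w \<in> W" for w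
      using that W eq by (intro loc) (auto intro: set_multI)
    ultimately show "\<exists>w\<in>W. P (c \<omega>' w)" by auto
  qed
qed

text \<open>The orbit condition removes countably many shift preimages of null cylinders. These are
  open, so \<open>X\<close> is closed, and it has full measure, in particular it is nonempty; the
  extended content restricts to it.\<close>

lemma exists_invariant_measure:
  assumes count: "countable (carrier G)" and f: "invariant_content f"
    and N: "\<And>i::nat. N i \<in> cylinder_sets" "\<And>i. f (N i) = 0"
  defines "X \<equiv> {x \<in> topspace (full_shift G). \<forall>h\<in>carrier G. \<forall>i. shift G h x \<notin> N i}"
  shows "closedin (full_shift G) X" "invariant_set G (shift G) X"
    "\<exists>\<mu>. borel_prob_measure (subtopology (full_shift G) X) \<mu> \<and> invariant_measure G (shift G) \<mu>"
proof -
  let ?\<Omega> = "topspace (full_shift G)"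
  interpret C: algebra ?\<Omega> cylinder_sets by (rule algebra_cylinder_sets)
  have X\<Omega>: "X \<subseteq> ?\<Omega>" by (auto simp: X_def)
  define Z where "Z h i = {y \<in> ?\<Omega>. shift G h y \<in> N i}" for h i
  have Z: "Z h i \<in> cylinder_sets" if "h \<in> carrier G" for h i
    unfolding Z_def by (rule shift_vimage_cylinder_sets[OF N(1) that])
  have X_eq: "X = ?\<Omega> - (\<Union>h\<in>carrier G. \<Union>i. Z h i)" by (auto simp: X_def Z_def)
  have "openin (full_shift G) (\<Union>h\<in>carrier G. \<Union>i. Z h i)"
    using Z openin_cylinder_sets by (intro openin_Union) auto
  then show "closedin (full_shift G) X" unfolding X_eq by (rule closedin_diff[OF closedin_topspace])
  show inv: "invariant_set G (shift G) X"
    unfolding invariant_set_def by (auto simp: X_def shift_in shift_mult)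
  obtain \<mu> where \<mu>: "prob_space \<mu>" and sp: "space \<mu> = ?\<Omega>"
    and st: "sets \<mu> = sigma_sets ?\<Omega> cylinder_sets"
    and em: "\<And>A. A \<in> cylinder_sets \<Longrightarrow> emeasure \<mu> A = ennreal (f A)"
    using content_extends[OF f] by blast
  interpret M: prob_space \<mu> by (rule \<mu>)
  have cyl_sets: "A \<in> sets \<mu>" if "A \<in> cylinder_sets" for A using that st by auto
  have meas: "shift G \<gamma> \<in> \<mu> \<rightarrow>\<^sub>M \<mu>" if \<gamma>: "\<gamma> \<in> carrier G" for \<gamma>
  proof (rule measurable_sigma_sets[OF st C.space_closed])
    show "shift G \<gamma> \<in> space \<mu> \<rightarrow> ?\<Omega>" using shift_in \<gamma> by (auto simp: sp)
    fix A assume "A \<in> cylinder_sets"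
    from shift_vimage_cylinder_sets[OF this \<gamma>] show "shift G \<gamma> -` A \<inter> space \<mu> \<in> sets \<mu>"
      by (intro cyl_sets) (simp add: sp vimage_def Int_def conj_commute)
  qed
  have distr_eq: "distr \<mu> \<mu> (shift G \<gamma>) = \<mu>" if \<gamma>: "\<gamma> \<in> carrier G" for \<gamma>
  proof (rule measure_eqI_generator_eq[OF _ C.space_closed, of _ _ "\<lambda>_. ?\<Omega>"])
    show "Int_stable cylinder_sets" by (auto simp: Int_stable_def)
    show "sets (distr \<mu> \<mu> (shift G \<gamma>)) = sigma_sets ?\<Omega> cylinder_sets" by (simp add: st)
    show "sets \<mu> = sigma_sets ?\<Omega> cylinder_sets" by (rule st)
    fix A assume A: "A \<in> cylinder_sets"
    have "emeasure (distr \<mu> \<mu> (shift G \<gamma>)) A = emeasure \<mu> (shift G \<gamma> -` A \<inter> space \<mu>)"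
      by (rule emeasure_distr[OF meas[OF \<gamma>] cyl_sets[OF A]])
    also have "shift G \<gamma> -` A \<inter> space \<mu> = {y \<in> ?\<Omega>. shift G \<gamma> y \<in> A}" by (auto simp: sp)
    also have "emeasure \<mu> \<dots> = ennreal (f {y \<in> ?\<Omega>. shift G \<gamma> y \<in> A})"
      by (rule em[OF shift_vimage_cylinder_sets[OF A \<gamma>]])
    also have "\<dots> = emeasure \<mu> A" using f \<gamma> A em[OF A] by (simp add: invariant_content_def)
    finally show "emeasure (distr \<mu> \<mu> (shift G \<gamma>)) A = emeasure \<mu> A" .
  qed (use meas[OF \<gamma>] in \<open>auto simp: emeasure_distr cyl_sets M.emeasure_finite\<close>)
  have UZ: "(\<Union>h\<in>carrier G. \<Union>i. Z h i) \<in> null_sets \<mu>"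
  proof (intro null_sets_UN' count null_setsI)
    fix h i assume h: "h \<in> carrier G"
    have "f (Z h i) = f (N i)" using f h N(1) by (simp add: invariant_content_def Z_def)
    then show "emeasure \<mu> (Z h i) = 0" using em[OF Z[OF h]] N(2) by simp
    show "Z h i \<in> sets \<mu>" using Z[OF h] by (rule cyl_sets)
  qed auto
  have X_sets: "X \<in> sets \<mu>" unfolding X_eq using UZ sp by (metis null_setsD2 sets.compl_sets)
  have "emeasure \<mu> X = emeasure \<mu> (space \<mu>)"
    unfolding X_eq sp[symmetric] by (rule emeasure_Diff_null_set[OF UZ]) simp
  then have X1: "emeasure \<mu> X = 1" by (simp add: M.emeasure_space_1)
  define \<nu> where "\<nu> = restrict_space \<mu> X"
  have space_\<nu>: "space \<nu> = X" using X\<Omega> by (auto simp: \<nu>_def space_restrict_space sp)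
  have sets_\<nu>: "A \<in> sets \<nu> \<longleftrightarrow> A \<in> sets \<mu> \<and> A \<subseteq> X" for A
    using sets_restrict_space_iff[of X \<mu> A] X_sets X\<Omega> sp by (auto simp: \<nu>_def Int_absorb2)
  have em_\<nu>: "emeasure \<nu> A = emeasure \<mu> A" if "A \<in> sets \<nu>" for A
    unfolding \<nu>_def by (rule emeasure_restrict_space) (use that sets_\<nu> X_sets X\<Omega> sp in \<open>auto simp: Int_absorb2\<close>)
  have "borel_prob_measure (subtopology (full_shift G) X) \<nu>"
    unfolding borel_prob_measure_def
  proof (intro conjI)
    show "prob_space \<nu>"
      by (rule prob_spaceI) (use em_\<nu>[of X] X1 X_sets sets_\<nu> space_\<nu> in simp)
    show "space \<nu> = topspace (subtopology (full_shift G) X)"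
      using X\<Omega> space_\<nu> by (simp add: Int_absorb1)
    have "sets \<nu> = (\<inter>) X ` sigma_sets ?\<Omega> {U. openin (full_shift G) U}"
      by (simp add: \<nu>_def sets_restrict_space st sigma_sets_cylinder_sets[OF count])
    also have "\<dots> = sigma_sets X ((\<inter>) X ` {U. openin (full_shift G) U})"
      by (rule sigma_sets_Int) (use X_sets X\<Omega> st sigma_sets_cylinder_sets[OF count] in auto)
    also have "(\<inter>) X ` {U. openin (full_shift G) U} = {U. openin (subtopology (full_shift G) X) U}"
      by (auto simp: openin_subtopology)
    finally show "sets \<nu> = sigma_sets (topspace (subtopology (full_shift G) X))
        {U. openin (subtopology (full_shift G) X) U}"
      using X\<Omega> by (simp add: Int_absorb1)
  qed
  moreover have "invariant_measure G (shift G) \<nu>"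
    unfolding invariant_measure_def
  proof (intro ballI conjI)
    fix \<gamma> assume \<gamma>: "\<gamma> \<in> carrier G"
    \<comment> \<open>A point whose shift lies in \<open>X\<close> already lies in \<open>X\<close>,
      by invariance under \<open>inv \<gamma>\<close>. Hence taking preimages commutes with the
      restriction to \<open>X\<close>.\<close>
    have pre: "shift G \<gamma> -` A \<inter> X = shift G \<gamma> -` A \<inter> space \<mu>" if "A \<subseteq> X" for A
    proof -
      have "y \<in> X" if y: "y \<in> ?\<Omega>" "shift G \<gamma> y \<in> X" for y
      proof -
        have "shift G (inv \<gamma>) (shift G \<gamma> y) \<in> X"
          using inv y(2) \<gamma> by (auto simp: invariant_set_def)
        then show ?thesis using \<gamma> y(1) by (simp add: shift_mult shift_one)
      qed
      then show ?thesis using that X\<Omega> by (auto simp: sp)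
    qed
    have meas_pre: "shift G \<gamma> -` A \<inter> X \<in> sets \<nu>" if "A \<in> sets \<nu>" for A
      using measurable_sets[OF meas[OF \<gamma>], of A] pre[of A] that by (auto simp: sets_\<nu>)
    show m: "shift G \<gamma> \<in> \<nu> \<rightarrow>\<^sub>M \<nu>"
      by (rule measurableI) (use inv \<gamma> meas_pre in \<open>auto simp: space_\<nu> invariant_set_def\<close>)
    show "distr \<nu> \<nu> (shift G \<gamma>) = \<nu>"
    proof (rule measure_eqI)
      fix A assume "A \<in> sets (distr \<nu> \<nu> (shift G \<gamma>))"
      then have A: "A \<in> sets \<nu>" by simp
      then have A': "A \<in> sets \<mu>" "A \<subseteq> X" using sets_\<nu> by auto
      have "emeasure (distr \<nu> \<nu> (shift G \<gamma>)) A = emeasure \<nu> (shift G \<gamma> -` A \<inter> X)"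
        using emeasure_distr[OF m A] by (simp add: space_\<nu>)
      also have "\<dots> = emeasure \<mu> (shift G \<gamma> -` A \<inter> space \<mu>)"
        using em_\<nu>[OF meas_pre[OF A]] pre[OF A'(2)] by simp
      also have "\<dots> = emeasure (distr \<mu> \<mu> (shift G \<gamma>)) A"
        by (rule emeasure_distr[OF meas[OF \<gamma>] A'(1), symmetric])
      also have "\<dots> = emeasure \<nu> A" using distr_eq[OF \<gamma>] em_\<nu>[OF A] by simp
      finally show "emeasure (distr \<nu> \<nu> (shift G \<gamma>)) A = emeasure \<nu> A" .
    qed simp
  qed
  ultimately show "\<exists>\<mu>. borel_prob_measure (subtopology (full_shift G) X) \<mu> \<and> invariant_measure G (shift G) \<mu>"
    by blast
qed

end

theorem theorem1p1:
  fixes G :: "('g, 'b) monoid_scheme"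
    and Y :: "('g \<Rightarrow> nat) set"
  assumes "group G"
    and "countable (carrier G)" and "infinite (carrier G)"
    and "Y \<subset> topspace (full_shift G)"
    and "closedin (full_shift G) Y"
    and "invariant_set G (shift G) Y"
  shows "\<exists>X. X \<subseteq> topspace (full_shift G) - Y
    \<and> closedin (full_shift G) X
    \<and> invariant_set G (shift G) X
    \<and> free_on G (shift G) X
    \<and> (\<exists>\<mu>. borel_prob_measure (subtopology (full_shift G) X) \<mu>
           \<and> invariant_measure G (shift G) \<mu>)"
proof -
  interpret group G by (rule assms)
  let ?\<Omega> = "topspace (full_shift G)"
  obtain x0 where x0: "x0 \<in> ?\<Omega> - Y" using assms(4) by blast
  have "openin (full_shift G) (?\<Omega> - Y)" using assms(5) by (simp add: closedin_def)
  \<comment> \<open>The values of \<open>x0\<close> on \<open>F\<close> are the pattern to be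
    planted: no point of \<open>Y\<close> shows it on \<open>F\<close>, and by invariance of
    \<open>Y\<close> none shows it on any translate.\<close>
  from open_neighbourhood_cylinder[OF this x0] obtain F where F: "finite F" "F \<subseteq> carrier G"
    and FY: "\<And>z. z \<in> ?\<Omega> \<Longrightarrow> (\<And>f. f \<in> F \<Longrightarrow> x0 f = z f) \<Longrightarrow> z \<in> ?\<Omega> - Y"
    by blast
  define \<gamma> where "\<gamma> = from_nat_into (carrier G - {\<one>\<^bsub>G\<^esub>})"
  have ne: "carrier G - {\<one>\<^bsub>G\<^esub>} \<noteq> {}"
    using assms(3) by (metis finite.emptyI finite_insert infinite_remove)
  have range_\<gamma>: "range \<gamma> = carrier G - {\<one>\<^bsub>G\<^esub>}"
    unfolding \<gamma>_def using assms(2) ne by (intro range_from_nat_into) auto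
  then have \<gamma>: "\<gamma> j \<in> carrier G" "\<gamma> j \<noteq> \<one>\<^bsub>G\<^esub>" for j by auto
  obtain T0 T where T0: "finite T0" "T0 \<subseteq> carrier G"
    and T: "\<forall>j. finite (T j) \<and> T j \<subseteq> carrier G"
    and TN: "\<forall>N. \<exists>B W. finite B \<and> B \<subseteq> carrier G \<and> finite W \<and> W \<subseteq> carrier G \<and>
      (\<forall>K (c :: ('g \<Rightarrow> nat) \<Rightarrow> 'g \<Rightarrow> nat). block_map c \<longrightarrow>
        (\<forall>\<omega>. proper_colouring B (c \<omega>) \<and> (\<forall>g\<in>carrier G. c \<omega> g \<le> K)) \<longrightarrow>
        (\<exists>x. block_map x \<and> (\<forall>\<omega>. \<forall>h\<in>carrier G. (\<forall>w\<in>W. c \<omega> (w \<otimes>\<^bsub>G\<^esub> h) \<noteq> 0) \<longrightarrow>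
          (\<exists>t\<in>T0. \<forall>f\<in>F. x \<omega> (f \<otimes>\<^bsub>G\<^esub> t \<otimes>\<^bsub>G\<^esub> h) = (x0 f = 1)) \<and>
          (\<forall>j<N. \<exists>t\<in>T j. x \<omega> (t \<otimes>\<^bsub>G\<^esub> h) \<noteq> x \<omega> (t \<otimes>\<^bsub>G\<^esub> \<gamma> j \<otimes>\<^bsub>G\<^esub> h)))))"
    using exists_avoiding_block_maps[where p = "\<lambda>f. x0 f = 1" and \<gamma> = \<gamma>, OF assms(3) F \<gamma>] 
    by (elim exE conjE) (rule that; assumption)
  \<comment> \<open>Event 0: the pattern is not seen through \<open>T0\<close>. Event
    \<open>Suc j\<close>: through \<open>T j\<close>, the element \<open>\<gamma> j\<close> looks
    like a period. The offset makes room for event 0, so the events with \<open>i \<le> n\<close>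
    need only the first \<open>n\<close> stages.\<close>
  define N where "N i = (case i of
      0 \<Rightarrow> {y \<in> ?\<Omega>. \<forall>t\<in>T0. \<exists>f\<in>F. y (f \<otimes>\<^bsub>G\<^esub> t) \<noteq> x0 f}
    | Suc j \<Rightarrow> {y \<in> ?\<Omega>. \<forall>t\<in>T j. y t = y (t \<otimes>\<^bsub>G\<^esub> \<gamma> j)})" for i
  have N_cyl: "N i \<in> cylinder_sets" for i
  proof (cases i)
    case 0
    show ?thesis
    proof (rule cylinder_setsI[of _ "F <#>\<^bsub>G\<^esub> T0"])
      fix y z assume yz: "y \<in> ?\<Omega>" "z \<in> ?\<Omega>" "\<And>f. f \<in> F <#>\<^bsub>G\<^esub> T0 \<Longrightarrow> y f = z f" "y \<in> N i"
      have "y (f \<otimes>\<^bsub>G\<^esub> t) = z (f \<otimes>\<^bsub>G\<^esub> t)" if "f \<in> F" "t \<in> T0" for f t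
        using that by (intro yz(3) set_multI)
      then show "z \<in> N i" using yz by (simp add: N_def 0)
    qed (use F T0 finite_set_mult set_mult_closed in \<open>auto simp: N_def 0\<close>)
  next
    case (Suc j)
    show ?thesis
    proof (rule cylinder_setsI[of _ "T j \<union> (\<lambda>t. t \<otimes>\<^bsub>G\<^esub> \<gamma> j) ` T j"])
      fix y z assume yz: "y \<in> ?\<Omega>" "z \<in> ?\<Omega>"
        "\<And>f. f \<in> T j \<union> (\<lambda>t. t \<otimes>\<^bsub>G\<^esub> \<gamma> j) ` T j \<Longrightarrow> y f = z f" "y \<in> N i"
      then show "z \<in> N i" by (simp add: N_def Suc)
    qed (use T \<gamma> in \<open>auto simp: N_def Suc\<close>)
  qed
  have "\<exists>f. invariant_content f \<and> (\<forall>i\<le>n. f (N i) \<le> 1 / Suc n)" for n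
  proof -
    obtain B W where B: "finite B" "B \<subseteq> carrier G" and W: "finite W" "W \<subseteq> carrier G"
      and ex: "\<forall>K (c :: ('g \<Rightarrow> nat) \<Rightarrow> 'g \<Rightarrow> nat). block_map c \<longrightarrow>
        (\<forall>\<omega>. proper_colouring B (c \<omega>) \<and> (\<forall>g\<in>carrier G. c \<omega> g \<le> K)) \<longrightarrow>
        (\<exists>x. block_map x \<and> (\<forall>\<omega>. \<forall>h\<in>carrier G. (\<forall>w\<in>W. c \<omega> (w \<otimes>\<^bsub>G\<^esub> h) \<noteq> 0) \<longrightarrow>
          (\<exists>t\<in>T0. \<forall>f\<in>F. x \<omega> (f \<otimes>\<^bsub>G\<^esub> t \<otimes>\<^bsub>G\<^esub> h) = (x0 f = 1)) \<and>
          (\<forall>j<n. \<exists>t\<in>T j. x \<omega> (t \<otimes>\<^bsub>G\<^esub> h) \<noteq> x \<omega> (t \<otimes>\<^bsub>G\<^esub> \<gamma> j \<otimes>\<^bsub>G\<^esub> h))))"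
      using TN[THEN spec[of _ n]] by (elim exE conjE) (rule that; assumption)
    have "1 / real (Suc n) > 0" by simp
    from exists_random_colouring[OF B W this]
    obtain K and c :: "('g \<Rightarrow> nat) \<Rightarrow> 'g \<Rightarrow> nat" where K: "K \<ge> 1" and c: "block_map c"
      and col: "\<forall>\<omega>. proper_colouring B (c \<omega>) \<and> (\<forall>g\<in>carrier G. c \<omega> g \<le> K)"
      and small: "measure (labels K) {\<omega> \<in> space (labels K). \<exists>w\<in>W. c \<omega> w = 0} \<le> 1 / Suc n"
      by (elim exE conjE) (rule that; assumption)
    obtain x where x: "block_map x" and good:
        "\<forall>\<omega>. \<forall>h\<in>carrier G. (\<forall>w\<in>W. c \<omega> (w \<otimes>\<^bsub>G\<^esub> h) \<noteq> 0) \<longrightarrow>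
          (\<exists>t\<in>T0. \<forall>f\<in>F. x \<omega> (f \<otimes>\<^bsub>G\<^esub> t \<otimes>\<^bsub>G\<^esub> h) = (x0 f = 1)) \<and>
          (\<forall>j<n. \<exists>t\<in>T j. x \<omega> (t \<otimes>\<^bsub>G\<^esub> h) \<noteq> x \<omega> (t \<otimes>\<^bsub>G\<^esub> \<gamma> j \<otimes>\<^bsub>G\<^esub> h))"
      using ex[rule_format, OF c col[rule_format]] by (elim exE conjE) (rule that; assumption)
    interpret L: prob_space "labels K" by (rule prob_space_labels[OF K])
    let ?f = "\<lambda>A. measure (labels K) {\<omega> \<in> space (labels K). indicator_point (x \<omega>) \<in> A}"
    have "?f (N i) \<le> 1 / Suc n" if i: "i \<le> n" for i
    proof -
      \<comment> \<open>The guarantee is used at \<open>h = \<one>\<close> only; invariance of the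
        content later carries it to all other sites.\<close>
      have "\<exists>w\<in>W. c \<omega> w = 0" if bad: "indicator_point (x \<omega>) \<in> N i" for \<omega>
      proof (rule ccontr)
        assume "\<not> (\<exists>w\<in>W. c \<omega> w = 0)"
        then have "\<forall>w\<in>W. c \<omega> (w \<otimes>\<^bsub>G\<^esub> \<one>\<^bsub>G\<^esub>) \<noteq> 0" using W by (auto simp: subset_iff)
        then have g: "\<exists>t\<in>T0. \<forall>f\<in>F. x \<omega> (f \<otimes>\<^bsub>G\<^esub> t \<otimes>\<^bsub>G\<^esub> \<one>\<^bsub>G\<^esub>) = (x0 f = 1)"
          "\<forall>j<n. \<exists>t\<in>T j. x \<omega> (t \<otimes>\<^bsub>G\<^esub> \<one>\<^bsub>G\<^esub>) \<noteq> x \<omega> (t \<otimes>\<^bsub>G\<^esub> \<gamma> j \<otimes>\<^bsub>G\<^esub> \<one>\<^bsub>G\<^esub>)"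
          using good by blast+
        show False
        proof (cases i)
          case 0
          obtain t where t: "t \<in> T0" "\<forall>f\<in>F. x \<omega> (f \<otimes>\<^bsub>G\<^esub> t \<otimes>\<^bsub>G\<^esub> \<one>\<^bsub>G\<^esub>) = (x0 f = 1)"
            using g(1) by blast
          have "indicator_point (x \<omega>) (f \<otimes>\<^bsub>G\<^esub> t) = x0 f" if f: "f \<in> F" for f
          proof -
            have fc: "f \<in> carrier G" "t \<in> carrier G" using f t(1) F T0 by auto
            have "x0 f \<in> {0, 1}"
              using x0 fc unfolding topspace_full_shift by (blast dest: PiE_mem)
            then show ?thesis using t(2) f fc by (auto simp: indicator_point_def)
          qed
          then show False using bad t(1) by (auto simp: N_def 0)
        next
          case (Suc j)
          obtain t where t: "t \<in> T j" "x \<omega> (t \<otimes>\<^bsub>G\<^esub> \<one>\<^bsub>G\<^esub>) \<noteq> x \<omega> (t \<otimes>\<^bsub>G\<^esub> \<gamma> j \<otimes>\<^bsub>G\<^esub> \<one>\<^bsub>G\<^esub>)"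
            using g(2)[rule_format, of j] i Suc by auto
          have tc: "t \<in> carrier G" using t(1) T by blast
          have "indicator_point (x \<omega>) t \<noteq> indicator_point (x \<omega>) (t \<otimes>\<^bsub>G\<^esub> \<gamma> j)"
            using t(2) tc \<gamma> by (simp add: indicator_point_def)
          then show False using bad t(1) by (auto simp: N_def Suc)
        qed
      qed
      then have "?f (N i) \<le> measure (labels K) {\<omega> \<in> space (labels K). \<exists>w\<in>W. c \<omega> w = 0}"
        using block_map_event_sets[OF c W, of K "\<lambda>k. k = 0"] by (intro L.finite_measure_mono) auto
      then show ?thesis using small by linarith
    qed
    then show ?thesis using invariant_content_of_block_map(1)[OF K x] by blast
  qed
  from exists_null_content[of N, OF this] obtain f where f: "invariant_content f" "\<And>i. f (N i) = 0"
    by blast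
  define X where "X = {x \<in> ?\<Omega>. \<forall>h\<in>carrier G. \<forall>i. shift G h x \<notin> N i}"
  note measure = exists_invariant_measure[where N = N, OF assms(2) f(1) N_cyl f(2), folded X_def]
  have no: "x \<notin> N i" if "x \<in> X" for x i
    using that shift_one[of x] by (auto simp: X_def dest!: bspec[of _ _ "\<one>\<^bsub>G\<^esub>"])
  \<comment> \<open>A point of \<open>X\<close> shows the pattern of \<open>x0\<close> on some
    translate \<open>F t\<close>; shifting by \<open>t\<close> brings it to \<open>F\<close>, where
    points of \<open>Y\<close> cannot show it.\<close>
  have "X \<inter> Y = {}"
  proof (rule ccontr)
    assume "X \<inter> Y \<noteq> {}"
    then obtain y where y: "y \<in> X" "y \<in> Y" by blast
    have y\<Omega>: "y \<in> ?\<Omega>" using y by (simp add: X_def)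
    obtain t where t: "t \<in> T0" "\<forall>f\<in>F. y (f \<otimes>\<^bsub>G\<^esub> t) = x0 f"
      using no[OF y(1), of 0] y\<Omega> by (auto simp: N_def)
    have tc: "t \<in> carrier G" using t(1) T0 by blast
    have "shift G t y \<in> ?\<Omega> - Y"
      by (rule FY[OF shift_in[OF y\<Omega> tc]]) (use t(2) F in \<open>auto simp: shift_def\<close>)
    moreover have "shift G t y \<in> Y" using assms(6) y(2) tc by (simp add: invariant_set_def)
    ultimately show False by blast
  qed
  moreover have "free_on G (shift G) X"
    unfolding free_on_def
  proof (intro ballI impI, rule ccontr)
    fix x \<eta> assume x: "x \<in> X" and \<eta>: "\<eta> \<in> carrier G" "shift G \<eta> x = x" "\<eta> \<noteq> \<one>\<^bsub>G\<^esub>"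
    then obtain j where j: "\<eta> = \<gamma> j" using range_\<gamma> by blast
    have "x t = x (t \<otimes>\<^bsub>G\<^esub> \<gamma> j)" if "t \<in> T j" for t
    proof -
      have "t \<in> carrier G" using that T by blast
      then have "shift G \<eta> x t = x (t \<otimes>\<^bsub>G\<^esub> \<gamma> j)" by (simp add: shift_def j)
      then show ?thesis using \<eta>(2) by simp
    qed
    then have "x \<in> N (Suc j)" using x by (simp add: N_def X_def)
    then show False using no[OF x] by blast
  qed
  moreover have "X \<subseteq> ?\<Omega>" by (auto simp: X_def)
  ultimately show ?thesis using measure by (intro exI[of _ X]) blast
qed

end
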